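(* Let $\mathcal V$ be a distributive, cartesian monoidal category with finite limits, with terminal object $\mathbf 1$. Then there is a conjunction $-\ast\mathbf 1\dashv\mathcal V(\mathbf 1,-)$ in the double category $\mathsf{PsDbCat}$; that is, $\mathcal V(\mathbf 1,-)\colon\mathsf{Span}(\mathcal V)\to\mathcal V\text{-}\mathsf{Mat}$ is a lax functor which is a conjoint, in $\mathsf{PsDbCat}$, of the oplax functor $-\ast\mathbf 1\colon\mathcal V\text{-}\mathsf{Mat}\to\mathsf{Span}(\mathcal V)$.
   Context: Distributive: $\mathcal V$ has small coproducts, and $\times$ preserves them in each variable. $X\ast\mathbf 1=\sum_{x\in X}\mathbf 1$ for a set $X$; $-\ast\mathbf 1\colon\mathsf{Set}\to\mathcal V$ is left adjoint to $\mathcal V(\mathbf 1,-)$. **$\mathsf{PsDbCat}$.** A pseudodouble category has a category $\mathbb D_0$ of 0-cells and vertical 1-cells, a category $\mathbb D_1$ of horizontal 1-cells and 2-cells, functors $\mathrm{dom},\mathrm{cod}$, unit $1$ and horizontal composition $\cdot$, and globular (dom and cod identities) natural isomorphisms $\lambda,\rho,\alpha$ satisfying triangle and pentagon. A lax functor $F$ has functors $F_0,F_1$ compatible with dom, cod, and globular natural $\mathsf e^F\colon1_{Fx}\to F1_x$, $\mathsf m^F\colon Fs\cdot Fr\to F(s\cdot r)$ with the usual coherence; oplax functors have these reversed. $\mathsf{PsDbCat}$ is the strict double category with pseudodouble categories as 0-cells, oplax functors as vertical 1-cells, lax functors as horizontal 1-cells, and as 2-cells with horizontal source $H\colon\mathbb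 A\to\mathbb B$ and target $K\colon\mathbb C\to\mathbb D$ (lax), vertical dom $F\colon\mathbb A\to\mathbb C$ and cod $G\colon\mathbb B\to\mathbb D$ (oplax) the pairs of natural transformations $\phi_i\colon G_iH_i\to K_iF_i$ ($i=0,1$) compatible with dom, cod such that $\mathsf e^K_{Fx}\circ1_{\phi_x}\circ\mathsf e^G_{Hx}=K\mathsf e^F_x\circ\phi_{1_x}\circ G\mathsf e^H_x$ and $\mathsf m^K\circ(\phi_s\cdot\phi_r)\circ\mathsf m^G=K\mathsf m^F\circ\phi_{s\cdot r}\circ G\mathsf m^H$; composition by pasting. **Conjoint.** In a double category, a conjoint of a vertical $f\colon a\to b$ is a horizontal $r\colon b\nrightarrow a$ with 2-cells $\eta\colon1_a\to r$ (dom $f$, cod $\mathrm{id}_a$) and $\epsilon\colon r\to1_b$ (dom $\mathrm{id}_b$, cod $f$) with $\epsilon\circ\eta=1_f$ and $\eta\cdot\epsilon=\mathrm{id}_r$ (up to unitors). **The pseudodouble categories and functors.** $\mathsf{Span}(\mathcal V)$: 0-cells and vertical 1-cells are those of $\mathcal V$; horizontal 1-cells are spans $X\xleftarrow{l_p}M_p\xrightarrow{r_p}Y$, composed by pullback, 2-cells are morphisms of spans. $\mathcal V\text{-}\mathsf{Mat}$: 0-cells sets, vertical 1-cells functions, horizontal 1-cells families $p(x,y)\in\mathcal V$, 2-cells over $(f,g)$ families $p(x,y)\to q(fx,gy)$, units $1_X(x,x')=[x=x']\ast\mathbf 1$, composition $(q\cdot p)(x,z)=\sum_yq(y,z)\times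 p(x,y)$. $-\ast\mathbf 1$ is $X\mapsto X\ast\mathbf 1$ on 0-cells and sends a matrix $p$ to the span $X\ast\mathbf 1\leftarrow\sum_{x,y}p(x,y)\to Y\ast\mathbf 1$ with the evident legs; its oplax structure is given by the canonical maps $\sum_{x,x'}[x=x']\ast\mathbf 1\to X\ast\mathbf 1$ and $\sum_{x,y,z}q(y,z)\times p(x,y)\to M_{p\ast\mathbf 1}\times_{Y\ast\mathbf 1}M_{q\ast\mathbf 1}$ (induced by product projections). $\mathcal V(\mathbf 1,-)$ is $V\mapsto\mathcal V(\mathbf 1,V)$ on 0-cells and sends a span $s\colon V\nrightarrow W$ to the matrix whose $(v,w)$ entry is the pullback of $\langle l_s,r_s\rangle\colon M_s\to V\times W$ along $\langle v,w\rangle\colon\mathbf 1\to V\times W$. *)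

theory Defs
  imports "HOL-Library.FuncSet"
begin

unbundle cardinal_syntax

section \<open>Categories and functors\<close>

text \<open>\<open>g \<cdot>\<^bsub>C\<^esub> f\<close> is the composite of \<open>f\<close> followed by \<open>g\<close>. The equations of all the structures
  below are only required inside the carriers \<open>Ob\<close> and \<open>Ar\<close>.\<close>

record ('o, 'a) cat =
  Ob :: "'o set"
  Ar :: "'a set"
  src :: "'a \<Rightarrow> 'o"
  tgt :: "'a \<Rightarrow> 'o"
  idt :: "'o \<Rightarrow> 'a"
  cmp :: "'a \<Rightarrow> 'a \<Rightarrow> 'a"  (infixl "\<cdot>\<index>" 70)

definition hom :: "('o, 'a, 'm) cat_scheme \<Rightarrow> 'o \<Rightarrow> 'o \<Rightarrow> 'a set" where
  "hom C a b = {f \<in> Ar C. src C f = a \<and> tgt C f = b}"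

locale category =
  fixes C :: "('o, 'a, 'm) cat_scheme"
  assumes src_Ob: "f \<in> Ar C \<Longrightarrow> src C f \<in> Ob C"
    and tgt_Ob: "f \<in> Ar C \<Longrightarrow> tgt C f \<in> Ob C"
    and idt_hom: "a \<in> Ob C \<Longrightarrow> idt C a \<in> hom C a a"
    and cmp_hom: "\<lbrakk>f \<in> hom C a b; g \<in> hom C b c\<rbrakk> \<Longrightarrow> g \<cdot>\<^bsub>C\<^esub> f \<in> hom C a c"
    and cmp_idt_left: "f \<in> hom C a b \<Longrightarrow> idt C b \<cdot>\<^bsub>C\<^esub> f = f"
    and cmp_idt_right: "f \<in> hom C a b \<Longrightarrow> f \<cdot>\<^bsub>C\<^esub> idt C a = f"
    and cmp_assoc: "\<lbrakk>f \<in> hom C a b; g \<in> hom C b c; h \<in> hom C c d\<rbrakk>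
          \<Longrightarrow> (h \<cdot>\<^bsub>C\<^esub> g) \<cdot>\<^bsub>C\<^esub> f = h \<cdot>\<^bsub>C\<^esub> (g \<cdot>\<^bsub>C\<^esub> f)"

definition iso_in :: "('o, 'a, 'm) cat_scheme \<Rightarrow> 'a \<Rightarrow> bool" where
  "iso_in C f \<longleftrightarrow> f \<in> Ar C \<and>
     (\<exists>g \<in> hom C (tgt C f) (src C f). g \<cdot>\<^bsub>C\<^esub> f = idt C (src C f) \<and> f \<cdot>\<^bsub>C\<^esub> g = idt C (tgt C f))"

locale cat_functor = C: category C + D: category D
  for C :: "('o1, 'a1, 'm1) cat_scheme" and D :: "('o2, 'a2, 'm2) cat_scheme" +
  fixes Fo :: "'o1 \<Rightarrow> 'o2" and Fa :: "'a1 \<Rightarrow> 'a2"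
  assumes map_Ob: "a \<in> Ob C \<Longrightarrow> Fo a \<in> Ob D"
    and map_hom: "f \<in> hom C a b \<Longrightarrow> Fa f \<in> hom D (Fo a) (Fo b)"
    and map_idt: "a \<in> Ob C \<Longrightarrow> Fa (idt C a) = idt D (Fo a)"
    and map_cmp: "\<lbrakk>f \<in> hom C a b; g \<in> hom C b c\<rbrakk> \<Longrightarrow> Fa (g \<cdot>\<^bsub>C\<^esub> f) = Fa g \<cdot>\<^bsub>D\<^esub> Fa f"


section \<open>Limits and coproducts\<close>

definition is_cone ::
    "('o, 'a, 'm) cat_scheme \<Rightarrow> ('j, 'k, 'n) cat_scheme \<Rightarrow> ('j \<Rightarrow> 'o) \<Rightarrow> ('k \<Rightarrow> 'a)
      \<Rightarrow> 'o \<Rightarrow> ('j \<Rightarrow> 'a) \<Rightarrow> bool" where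
  "is_cone C J Do Da L \<pi> \<longleftrightarrow> L \<in> Ob C \<and> (\<forall>j \<in> Ob J. \<pi> j \<in> hom C L (Do j)) \<and>
     (\<forall>u \<in> Ar J. Da u \<cdot>\<^bsub>C\<^esub> \<pi> (src J u) = \<pi> (tgt J u))"

definition is_limit ::
    "('o, 'a, 'm) cat_scheme \<Rightarrow> ('j, 'k, 'n) cat_scheme \<Rightarrow> ('j \<Rightarrow> 'o) \<Rightarrow> ('k \<Rightarrow> 'a)
      \<Rightarrow> 'o \<Rightarrow> ('j \<Rightarrow> 'a) \<Rightarrow> bool" where
  "is_limit C J Do Da L \<pi> \<longleftrightarrow> is_cone C J Do Da L \<pi> \<and>
     (\<forall>M \<mu>. is_cone C J Do Da M \<mu> \<longrightarrow>
        (\<exists>!h. h \<in> hom C M L \<and> (\<forall>j \<in> Ob J. \<pi> j \<cdot>\<^bsub>C\<^esub> h = \<mu> j)))"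

text \<open>Every finite category is isomorphic to one whose objects and arrows are natural numbers.\<close>

definition has_finite_limits :: "('o, 'a, 'm) cat_scheme \<Rightarrow> bool" where
  "has_finite_limits C \<longleftrightarrow>
     (\<forall>(J :: (nat, nat) cat) Do Da. finite (Ob J) \<and> finite (Ar J) \<and> cat_functor J C Do Da
        \<longrightarrow> (\<exists>L \<pi>. is_limit C J Do Da L \<pi>))"

definition is_terminal :: "('o, 'a, 'm) cat_scheme \<Rightarrow> 'o \<Rightarrow> bool" where
  "is_terminal C t \<longleftrightarrow> t \<in> Ob C \<and> (\<forall>a \<in> Ob C. \<exists>!h. h \<in> hom C a t)"

definition is_product :: "('o, 'a, 'm) cat_scheme \<Rightarrow> 'o \<Rightarrow> 'o \<Rightarrow> 'a \<Rightarrow> 'a \<Rightarrow> bool" where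
  "is_product C a b p q \<longleftrightarrow>
     p \<in> hom C (src C p) a \<and> q \<in> hom C (src C p) b \<and>
     (\<forall>c f g. f \<in> hom C c a \<and> g \<in> hom C c b \<longrightarrow>
        (\<exists>!h. h \<in> hom C c (src C p) \<and> p \<cdot>\<^bsub>C\<^esub> h = f \<and> q \<cdot>\<^bsub>C\<^esub> h = g))"

definition is_pullback :: "('o, 'a, 'm) cat_scheme \<Rightarrow> 'a \<Rightarrow> 'a \<Rightarrow> 'a \<Rightarrow> 'a \<Rightarrow> bool" where
  "is_pullback C f g p q \<longleftrightarrow>
     f \<in> Ar C \<and> g \<in> Ar C \<and> tgt C f = tgt C g \<and>
     p \<in> hom C (src C p) (src C f) \<and> q \<in> hom C (src C p) (src C g) \<and> f \<cdot>\<^bsub>C\<^esub> p = g \<cdot>\<^bsub>C\<^esub> q \<and>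
     (\<forall>c u v. u \<in> hom C c (src C f) \<and> v \<in> hom C c (src C g) \<and> f \<cdot>\<^bsub>C\<^esub> u = g \<cdot>\<^bsub>C\<^esub> v \<longrightarrow>
        (\<exists>!h. h \<in> hom C c (src C p) \<and> p \<cdot>\<^bsub>C\<^esub> h = u \<and> q \<cdot>\<^bsub>C\<^esub> h = v))"

text \<open>A coproduct cocone is a pair of its vertex and its family of injections.\<close>

definition is_coproduct ::
    "('o, 'a, 'm) cat_scheme \<Rightarrow> 'i set \<Rightarrow> ('i \<Rightarrow> 'o) \<Rightarrow> 'o \<times> ('i \<Rightarrow> 'a) \<Rightarrow> bool" where
  "is_coproduct C I F c \<longleftrightarrow> fst c \<in> Ob C \<and> (\<forall>i \<in> I. snd c i \<in> hom C (F i) (fst c)) \<and>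
     (\<forall>d \<in> Ob C. \<forall>k. (\<forall>i \<in> I. k i \<in> hom C (F i) d) \<longrightarrow>
        (\<exists>!h. h \<in> hom C (fst c) d \<and> (\<forall>i \<in> I. h \<cdot>\<^bsub>C\<^esub> snd c i = k i)))"

text \<open>Chosen pullbacks and coproducts, and the maps given by their universal properties. In
  \<open>is_coproduct C I F\<close> only the values of \<open>F\<close> on \<open>I\<close> matter, hence also in \<open>cop C I F\<close>.\<close>

definition pb :: "('o, 'a, 'm) cat_scheme \<Rightarrow> 'a \<Rightarrow> 'a \<Rightarrow> 'a \<times> 'a" where
  "pb C f g = (SOME p. is_pullback C f g (fst p) (snd p))"

abbreviation "pb1 C f g \<equiv> fst (pb C f g)"
abbreviation "pb2 C f g \<equiv> snd (pb C f g)"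
abbreviation "pbo C f g \<equiv> src C (pb1 C f g)"

definition pbtup :: "('o, 'a, 'm) cat_scheme \<Rightarrow> 'a \<Rightarrow> 'a \<Rightarrow> 'a \<Rightarrow> 'a \<Rightarrow> 'a" where
  "pbtup C f g u v =
     (THE h. h \<in> hom C (src C u) (pbo C f g) \<and> pb1 C f g \<cdot>\<^bsub>C\<^esub> h = u \<and> pb2 C f g \<cdot>\<^bsub>C\<^esub> h = v)"

definition cop :: "('o, 'a, 'm) cat_scheme \<Rightarrow> 'i set \<Rightarrow> ('i \<Rightarrow> 'o) \<Rightarrow> 'o \<times> ('i \<Rightarrow> 'a)" where
  "cop C I F = (SOME c. is_coproduct C I F c)"

definition cotuple ::
    "('o, 'a, 'm) cat_scheme \<Rightarrow> 'i set \<Rightarrow> 'o \<times> ('i \<Rightarrow> 'a) \<Rightarrow> 'o \<Rightarrow> ('i \<Rightarrow> 'a) \<Rightarrow> 'a" where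
  "cotuple C I c d k = (THE h. h \<in> hom C (fst c) d \<and> (\<forall>i \<in> I. h \<cdot>\<^bsub>C\<^esub> snd c i = k i))"

definition the_arrow :: "('o, 'a, 'm) cat_scheme \<Rightarrow> 'o \<Rightarrow> 'o \<Rightarrow> 'a" where
  "the_arrow C a b = (THE h. h \<in> hom C a b)"


section \<open>Distributive cartesian monoidal categories\<close>

text \<open>The cartesian monoidal structure is a specified terminal object and specified binary
  products, the latter given by their projections.\<close>

record ('o, 'a) cart_cat = "('o, 'a) cat" +
  one :: 'o
  prj1 :: "'o \<Rightarrow> 'o \<Rightarrow> 'a"
  prj2 :: "'o \<Rightarrow> 'o \<Rightarrow> 'a"

definition prd :: "('o, 'a) cart_cat \<Rightarrow> 'o \<Rightarrow> 'o \<Rightarrow> 'o" where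
  "prd V a b = src V (prj1 V a b)"

definition tup :: "('o, 'a) cart_cat \<Rightarrow> 'a \<Rightarrow> 'a \<Rightarrow> 'a" where
  "tup V f g = (THE h. h \<in> hom V (src V f) (prd V (tgt V f) (tgt V g)) \<and>
     prj1 V (tgt V f) (tgt V g) \<cdot>\<^bsub>V\<^esub> h = f \<and> prj2 V (tgt V f) (tgt V g) \<cdot>\<^bsub>V\<^esub> h = g)"

definition pmap :: "('o, 'a) cart_cat \<Rightarrow> 'a \<Rightarrow> 'a \<Rightarrow> 'a" where
  "pmap V f g = tup V (f \<cdot>\<^bsub>V\<^esub> prj1 V (src V f) (src V g)) (g \<cdot>\<^bsub>V\<^esub> prj2 V (src V f) (src V g))"

definition pasc :: "('o, 'a) cart_cat \<Rightarrow> 'o \<Rightarrow> 'o \<Rightarrow> 'o \<Rightarrow> 'a" where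
  "pasc V a b c = tup V (prj1 V a b \<cdot>\<^bsub>V\<^esub> prj1 V (prd V a b) c)
     (tup V (prj2 V a b \<cdot>\<^bsub>V\<^esub> prj1 V (prd V a b) c) (prj2 V (prd V a b) c))"

locale cartesian_category = category V
  for V :: "('o, 'a) cart_cat" +
  assumes one_terminal: "is_terminal V (one V)"
    and prj_product: "\<lbrakk>a \<in> Ob V; b \<in> Ob V\<rbrakk> \<Longrightarrow> is_product V a b (prj1 V a b) (prj2 V a b)"

text \<open>The universe of small sets consists of the sets \<open>X :: 'a set\<close> with \<open>|X| <o \<kappa>\<close>, for an infinite
  regular cardinal \<open>\<kappa>\<close> (an inaccessible one in the case of a Grothendieck universe). Note that with
  all the sets of type \<open>'a set\<close> in place of those of size below \<open>\<kappa>\<close>, the existence of coproducts would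
  force \<open>V\<close> to be a preorder. The elements of small sets have the type \<open>'a\<close> of the arrows of \<open>V\<close>, so
  that \<open>hom V a b\<close> is itself a small set; no generality is lost, as \<open>Ar V\<close> may be a proper subset of an
  arbitrarily large type.\<close>

locale distributive_category = cartesian_category V
  for \<kappa> :: "'k rel" and V :: "('o, 'a) cart_cat" +
  assumes locally_small: "\<lbrakk>a \<in> Ob V; b \<in> Ob V\<rbrakk> \<Longrightarrow> |hom V a b| <o \<kappa>"
    and small_coproducts: "\<And>(I :: 'a set) F. \<lbrakk>|I| <o \<kappa>; F \<in> I \<rightarrow> Ob V\<rbrakk> \<Longrightarrow> \<exists>c. is_coproduct V I F c"
    and product_preserves_right:
      "\<And>(I :: 'a set) F c a. \<lbrakk>|I| <o \<kappa>; F \<in> I \<rightarrow> Ob V; is_coproduct V I F c; a \<in> Ob V\<rbrakk>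
         \<Longrightarrow> is_coproduct V I (\<lambda>i. prd V a (F i)) (prd V a (fst c), \<lambda>i. pmap V (idt V a) (snd c i))"
    and product_preserves_left:
      "\<And>(I :: 'a set) F c a. \<lbrakk>|I| <o \<kappa>; F \<in> I \<rightarrow> Ob V; is_coproduct V I F c; a \<in> Ob V\<rbrakk>
         \<Longrightarrow> is_coproduct V I (\<lambda>i. prd V (F i) a) (prd V (fst c) a, \<lambda>i. pmap V (snd c i) (idt V a))"


section \<open>Pseudodouble categories\<close>

text \<open>\<open>vert D\<close> and \<open>sqs D\<close> are the categories $D_0$ of 0-cells and vertical 1-cells, and $D_1$ of
  horizontal 1-cells and 2-cells. The functors dom and cod are \<open>(hdom D, cdom D)\<close> and
  \<open>(hcod D, ccod D)\<close>, the units are \<open>(hunit D, cunit D)\<close>, and horizontal composition, in the order of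
  composition of functions, is \<open>s \<odot>\<^bsub>D\<^esub> r\<close> for horizontal 1-cells and \<open>\<psi> \<star>\<^bsub>D\<^esub> \<phi>\<close> for 2-cells.\<close>

record ('o, 'v, 'h, 'c) psdbl =
  vert :: "('o, 'v) cat"
  sqs :: "('h, 'c) cat"
  hdom :: "'h \<Rightarrow> 'o"
  cdom :: "'c \<Rightarrow> 'v"
  hcod :: "'h \<Rightarrow> 'o"
  ccod :: "'c \<Rightarrow> 'v"
  hunit :: "'o \<Rightarrow> 'h"
  cunit :: "'v \<Rightarrow> 'c"
  hcmp :: "'h \<Rightarrow> 'h \<Rightarrow> 'h"  (infixl "\<odot>\<index>" 72)
  ccmp :: "'c \<Rightarrow> 'c \<Rightarrow> 'c"  (infixl "\<star>\<index>" 72)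
  lun :: "'h \<Rightarrow> 'c"
  run :: "'h \<Rightarrow> 'c"
  asc :: "'h \<Rightarrow> 'h \<Rightarrow> 'h \<Rightarrow> 'c"

text \<open>2-cells with dom and cod identities\<close>

definition globular :: "('o, 'v, 'h, 'c) psdbl \<Rightarrow> 'h \<Rightarrow> 'h \<Rightarrow> 'c \<Rightarrow> bool" where
  "globular D r s \<theta> \<longleftrightarrow> \<theta> \<in> hom (sqs D) r s \<and>
     cdom D \<theta> = idt (vert D) (hdom D r) \<and> ccod D \<theta> = idt (vert D) (hcod D r)"

locale pseudodouble_category =
  vert: category "vert D" + sqs: category "sqs D" +
  dom: cat_functor "sqs D" "vert D" "hdom D" "cdom D" +
  cod: cat_functor "sqs D" "vert D" "hcod D" "ccod D" +
  unit: cat_functor "vert D" "sqs D" "hunit D" "cunit D"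
  for D :: "('o, 'v, 'h, 'c) psdbl" +
  assumes hdom_hunit: "x \<in> Ob (vert D) \<Longrightarrow> hdom D (hunit D x) = x"
    and hcod_hunit: "x \<in> Ob (vert D) \<Longrightarrow> hcod D (hunit D x) = x"
    and cdom_cunit: "f \<in> Ar (vert D) \<Longrightarrow> cdom D (cunit D f) = f"
    and ccod_cunit: "f \<in> Ar (vert D) \<Longrightarrow> ccod D (cunit D f) = f"
    and hcmp_Ob: "\<lbrakk>r \<in> Ob (sqs D); s \<in> Ob (sqs D); hdom D s = hcod D r\<rbrakk>
      \<Longrightarrow> s \<odot>\<^bsub>D\<^esub> r \<in> Ob (sqs D) \<and> hdom D (s \<odot>\<^bsub>D\<^esub> r) = hdom D r \<and> hcod D (s \<odot>\<^bsub>D\<^esub> r) = hcod D s"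
    and ccmp_hom: "\<lbrakk>\<phi> \<in> hom (sqs D) r r'; \<psi> \<in> hom (sqs D) s s'; cdom D \<psi> = ccod D \<phi>\<rbrakk>
      \<Longrightarrow> \<psi> \<star>\<^bsub>D\<^esub> \<phi> \<in> hom (sqs D) (s \<odot>\<^bsub>D\<^esub> r) (s' \<odot>\<^bsub>D\<^esub> r') \<and>
          cdom D (\<psi> \<star>\<^bsub>D\<^esub> \<phi>) = cdom D \<phi> \<and> ccod D (\<psi> \<star>\<^bsub>D\<^esub> \<phi>) = ccod D \<psi>"
    and ccmp_idt: "\<lbrakk>r \<in> Ob (sqs D); s \<in> Ob (sqs D); hdom D s = hcod D r\<rbrakk>
      \<Longrightarrow> idt (sqs D) s \<star>\<^bsub>D\<^esub> idt (sqs D) r = idt (sqs D) (s \<odot>\<^bsub>D\<^esub> r)"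
    and ccmp_cmp: "\<lbrakk>\<phi> \<in> hom (sqs D) r r'; \<phi>' \<in> hom (sqs D) r' r''; \<psi> \<in> hom (sqs D) s s';
        \<psi>' \<in> hom (sqs D) s' s''; cdom D \<psi> = ccod D \<phi>; cdom D \<psi>' = ccod D \<phi>'\<rbrakk>
      \<Longrightarrow> (\<psi>' \<cdot>\<^bsub>sqs D\<^esub> \<psi>) \<star>\<^bsub>D\<^esub> (\<phi>' \<cdot>\<^bsub>sqs D\<^esub> \<phi>) = (\<psi>' \<star>\<^bsub>D\<^esub> \<phi>') \<cdot>\<^bsub>sqs D\<^esub> (\<psi> \<star>\<^bsub>D\<^esub> \<phi>)"
    and lun_iso: "r \<in> Ob (sqs D)
      \<Longrightarrow> globular D (hunit D (hcod D r) \<odot>\<^bsub>D\<^esub> r) r (lun D r) \<and> iso_in (sqs D) (lun D r)"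
    and lun_natural: "\<phi> \<in> hom (sqs D) r r'
      \<Longrightarrow> \<phi> \<cdot>\<^bsub>sqs D\<^esub> lun D r = lun D r' \<cdot>\<^bsub>sqs D\<^esub> (cunit D (ccod D \<phi>) \<star>\<^bsub>D\<^esub> \<phi>)"
    and run_iso: "r \<in> Ob (sqs D)
      \<Longrightarrow> globular D (r \<odot>\<^bsub>D\<^esub> hunit D (hdom D r)) r (run D r) \<and> iso_in (sqs D) (run D r)"
    and run_natural: "\<phi> \<in> hom (sqs D) r r'
      \<Longrightarrow> \<phi> \<cdot>\<^bsub>sqs D\<^esub> run D r = run D r' \<cdot>\<^bsub>sqs D\<^esub> (\<phi> \<star>\<^bsub>D\<^esub> cunit D (cdom D \<phi>))"
    and asc_iso: "\<lbrakk>r \<in> Ob (sqs D); s \<in> Ob (sqs D); t \<in> Ob (sqs D);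
        hdom D s = hcod D r; hdom D t = hcod D s\<rbrakk>
      \<Longrightarrow> globular D ((t \<odot>\<^bsub>D\<^esub> s) \<odot>\<^bsub>D\<^esub> r) (t \<odot>\<^bsub>D\<^esub> (s \<odot>\<^bsub>D\<^esub> r)) (asc D t s r) \<and>
          iso_in (sqs D) (asc D t s r)"
    and asc_natural: "\<lbrakk>\<phi> \<in> hom (sqs D) r r'; \<psi> \<in> hom (sqs D) s s'; \<chi> \<in> hom (sqs D) t t';
        cdom D \<psi> = ccod D \<phi>; cdom D \<chi> = ccod D \<psi>\<rbrakk>
      \<Longrightarrow> (\<chi> \<star>\<^bsub>D\<^esub> (\<psi> \<star>\<^bsub>D\<^esub> \<phi>)) \<cdot>\<^bsub>sqs D\<^esub> asc D t s r = asc D t' s' r' \<cdot>\<^bsub>sqs D\<^esub> ((\<chi> \<star>\<^bsub>D\<^esub> \<psi>) \<star>\<^bsub>D\<^esub> \<phi>)"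
    and triangle: "\<lbrakk>r \<in> Ob (sqs D); s \<in> Ob (sqs D); hdom D s = hcod D r\<rbrakk>
      \<Longrightarrow> (idt (sqs D) s \<star>\<^bsub>D\<^esub> lun D r) \<cdot>\<^bsub>sqs D\<^esub> asc D s (hunit D (hdom D s)) r
          = run D s \<star>\<^bsub>D\<^esub> idt (sqs D) r"
    and pentagon: "\<lbrakk>q \<in> Ob (sqs D); r \<in> Ob (sqs D); s \<in> Ob (sqs D); t \<in> Ob (sqs D);
        hdom D r = hcod D q; hdom D s = hcod D r; hdom D t = hcod D s\<rbrakk>
      \<Longrightarrow> asc D t s (r \<odot>\<^bsub>D\<^esub> q) \<cdot>\<^bsub>sqs D\<^esub> asc D (t \<odot>\<^bsub>D\<^esub> s) r q
          = (idt (sqs D) t \<star>\<^bsub>D\<^esub> asc D s r q) \<cdot>\<^bsub>sqs D\<^esub> asc D t (s \<odot>\<^bsub>D\<^esub> r) q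
            \<cdot>\<^bsub>sqs D\<^esub> (asc D t s r \<star>\<^bsub>D\<^esub> idt (sqs D) q)"


section \<open>Lax and oplax functors\<close>

text \<open>The same data serve for lax and oplax functors: \<open>ecell\<close> and \<open>mcell\<close> are the comparison cells for
  units and composition, whose direction is fixed by the two locales. The first four fields are the
  actions on 0-cells, vertical 1-cells, horizontal 1-cells and 2-cells.\<close>

record ('o1, 'v1, 'h1, 'c1, 'o2, 'v2, 'h2, 'c2) psfun =
  omap :: "'o1 \<Rightarrow> 'o2"
  vmap :: "'v1 \<Rightarrow> 'v2"
  hmap :: "'h1 \<Rightarrow> 'h2"
  cmap :: "'c1 \<Rightarrow> 'c2"
  ecell :: "'o1 \<Rightarrow> 'c2"
  mcell :: "'h1 \<Rightarrow> 'h1 \<Rightarrow> 'c2"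

locale double_map =
  A: pseudodouble_category A + B: pseudodouble_category B +
  F0: cat_functor "vert A" "vert B" "omap F" "vmap F" +
  F1: cat_functor "sqs A" "sqs B" "hmap F" "cmap F"
  for A :: "('o1, 'v1, 'h1, 'c1) psdbl" and B :: "('o2, 'v2, 'h2, 'c2) psdbl"
    and F :: "('o1, 'v1, 'h1, 'c1, 'o2, 'v2, 'h2, 'c2) psfun" +
  assumes hdom_hmap: "r \<in> Ob (sqs A) \<Longrightarrow> hdom B (hmap F r) = omap F (hdom A r)"
    and hcod_hmap: "r \<in> Ob (sqs A) \<Longrightarrow> hcod B (hmap F r) = omap F (hcod A r)"
    and cdom_cmap: "\<phi> \<in> Ar (sqs A) \<Longrightarrow> cdom B (cmap F \<phi>) = vmap F (cdom A \<phi>)"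
    and ccod_cmap: "\<phi> \<in> Ar (sqs A) \<Longrightarrow> ccod B (cmap F \<phi>) = vmap F (ccod A \<phi>)"

locale lax_functor = double_map A B F
  for A :: "('o1, 'v1, 'h1, 'c1) psdbl" and B :: "('o2, 'v2, 'h2, 'c2) psdbl"
    and F :: "('o1, 'v1, 'h1, 'c1, 'o2, 'v2, 'h2, 'c2) psfun" +
  assumes ecell_globular: "x \<in> Ob (vert A)
      \<Longrightarrow> globular B (hunit B (omap F x)) (hmap F (hunit A x)) (ecell F x)"
    and ecell_natural: "f \<in> hom (vert A) x y
      \<Longrightarrow> cmap F (cunit A f) \<cdot>\<^bsub>sqs B\<^esub> ecell F x = ecell F y \<cdot>\<^bsub>sqs B\<^esub> cunit B (vmap F f)"
    and mcell_globular: "\<lbrakk>r \<in> Ob (sqs A); s \<in> Ob (sqs A); hdom A s = hcod A r\<rbrakk>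
      \<Longrightarrow> globular B (hmap F s \<odot>\<^bsub>B\<^esub> hmap F r) (hmap F (s \<odot>\<^bsub>A\<^esub> r)) (mcell F s r)"
    and mcell_natural:
      "\<lbrakk>\<phi> \<in> hom (sqs A) r r'; \<psi> \<in> hom (sqs A) s s'; cdom A \<psi> = ccod A \<phi>\<rbrakk>
      \<Longrightarrow> cmap F (\<psi> \<star>\<^bsub>A\<^esub> \<phi>) \<cdot>\<^bsub>sqs B\<^esub> mcell F s r = mcell F s' r' \<cdot>\<^bsub>sqs B\<^esub> (cmap F \<psi> \<star>\<^bsub>B\<^esub> cmap F \<phi>)"
    and coherence_lun: "r \<in> Ob (sqs A)
      \<Longrightarrow> cmap F (lun A r) \<cdot>\<^bsub>sqs B\<^esub> mcell F (hunit A (hcod A r)) r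
            \<cdot>\<^bsub>sqs B\<^esub> (ecell F (hcod A r) \<star>\<^bsub>B\<^esub> idt (sqs B) (hmap F r))
          = lun B (hmap F r)"
    and coherence_run: "r \<in> Ob (sqs A)
      \<Longrightarrow> cmap F (run A r) \<cdot>\<^bsub>sqs B\<^esub> mcell F r (hunit A (hdom A r))
            \<cdot>\<^bsub>sqs B\<^esub> (idt (sqs B) (hmap F r) \<star>\<^bsub>B\<^esub> ecell F (hdom A r))
          = run B (hmap F r)"
    and coherence_asc: "\<lbrakk>r \<in> Ob (sqs A); s \<in> Ob (sqs A); t \<in> Ob (sqs A);
        hdom A s = hcod A r; hdom A t = hcod A s\<rbrakk>
      \<Longrightarrow> cmap F (asc A t s r) \<cdot>\<^bsub>sqs B\<^esub> mcell F (t \<odot>\<^bsub>A\<^esub> s) r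
            \<cdot>\<^bsub>sqs B\<^esub> (mcell F t s \<star>\<^bsub>B\<^esub> idt (sqs B) (hmap F r))
          = mcell F t (s \<odot>\<^bsub>A\<^esub> r) \<cdot>\<^bsub>sqs B\<^esub> (idt (sqs B) (hmap F t) \<star>\<^bsub>B\<^esub> mcell F s r)
            \<cdot>\<^bsub>sqs B\<^esub> asc B (hmap F t) (hmap F s) (hmap F r)"

locale oplax_functor = double_map A B F
  for A :: "('o1, 'v1, 'h1, 'c1) psdbl" and B :: "('o2, 'v2, 'h2, 'c2) psdbl"
    and F :: "('o1, 'v1, 'h1, 'c1, 'o2, 'v2, 'h2, 'c2) psfun" +
  assumes ecell_globular: "x \<in> Ob (vert A)
      \<Longrightarrow> globular B (hmap F (hunit A x)) (hunit B (omap F x)) (ecell F x)"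
    and ecell_natural: "f \<in> hom (vert A) x y
      \<Longrightarrow> cunit B (vmap F f) \<cdot>\<^bsub>sqs B\<^esub> ecell F x = ecell F y \<cdot>\<^bsub>sqs B\<^esub> cmap F (cunit A f)"
    and mcell_globular: "\<lbrakk>r \<in> Ob (sqs A); s \<in> Ob (sqs A); hdom A s = hcod A r\<rbrakk>
      \<Longrightarrow> globular B (hmap F (s \<odot>\<^bsub>A\<^esub> r)) (hmap F s \<odot>\<^bsub>B\<^esub> hmap F r) (mcell F s r)"
    and mcell_natural:
      "\<lbrakk>\<phi> \<in> hom (sqs A) r r'; \<psi> \<in> hom (sqs A) s s'; cdom A \<psi> = ccod A \<phi>\<rbrakk>
      \<Longrightarrow> (cmap F \<psi> \<star>\<^bsub>B\<^esub> cmap F \<phi>) \<cdot>\<^bsub>sqs B\<^esub> mcell F s r = mcell F s' r' \<cdot>\<^bsub>sqs B\<^esub> cmap F (\<psi> \<star>\<^bsub>A\<^esub> \<phi>)"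
    and coherence_lun: "r \<in> Ob (sqs A)
      \<Longrightarrow> lun B (hmap F r) \<cdot>\<^bsub>sqs B\<^esub> (ecell F (hcod A r) \<star>\<^bsub>B\<^esub> idt (sqs B) (hmap F r))
            \<cdot>\<^bsub>sqs B\<^esub> mcell F (hunit A (hcod A r)) r
          = cmap F (lun A r)"
    and coherence_run: "r \<in> Ob (sqs A)
      \<Longrightarrow> run B (hmap F r) \<cdot>\<^bsub>sqs B\<^esub> (idt (sqs B) (hmap F r) \<star>\<^bsub>B\<^esub> ecell F (hdom A r))
            \<cdot>\<^bsub>sqs B\<^esub> mcell F r (hunit A (hdom A r))
          = cmap F (run A r)"
    and coherence_asc: "\<lbrakk>r \<in> Ob (sqs A); s \<in> Ob (sqs A); t \<in> Ob (sqs A);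
        hdom A s = hcod A r; hdom A t = hcod A s\<rbrakk>
      \<Longrightarrow> asc B (hmap F t) (hmap F s) (hmap F r)
            \<cdot>\<^bsub>sqs B\<^esub> (mcell F t s \<star>\<^bsub>B\<^esub> idt (sqs B) (hmap F r)) \<cdot>\<^bsub>sqs B\<^esub> mcell F (t \<odot>\<^bsub>A\<^esub> s) r
          = (idt (sqs B) (hmap F t) \<star>\<^bsub>B\<^esub> mcell F s r) \<cdot>\<^bsub>sqs B\<^esub> mcell F t (s \<odot>\<^bsub>A\<^esub> r)
            \<cdot>\<^bsub>sqs B\<^esub> cmap F (asc A t s r)"

definition identity_psfun ::
    "('o, 'v, 'h, 'c) psdbl \<Rightarrow> ('o, 'v, 'h, 'c, 'o, 'v, 'h, 'c) psfun" where
  "identity_psfun A =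
     \<lparr>omap = \<lambda>x. x, vmap = \<lambda>f. f, hmap = \<lambda>r. r, cmap = \<lambda>\<phi>. \<phi>,
      ecell = \<lambda>x. idt (sqs A) (hunit A x), mcell = \<lambda>s r. idt (sqs A) (s \<odot>\<^bsub>A\<^esub> r)\<rparr>"


section \<open>The double category of pseudodouble categories\<close>

text \<open>The 0-cells are the pseudodouble categories, the vertical 1-cells the oplax functors, and the
  horizontal 1-cells the lax functors. The 2-cells and their two compositions are polymorphic in
  the types of the pseudodouble categories involved. In \<open>psdb_cell A B C D H K F G \<phi>\<close>, the 2-cell
  \<open>\<phi> : H \<rightarrow> K\<close> has horizontal source \<open>H : A \<rightarrow> B\<close> and target \<open>K : C \<rightarrow> D\<close>, vertical dom \<open>F : A \<rightarrow> C\<close> and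
  vertical cod \<open>G : B \<rightarrow> D\<close>.\<close>

record ('o, 'h, 'v, 'c) transf =
  tr0 :: "'o \<Rightarrow> 'v"
  tr1 :: "'h \<Rightarrow> 'c"

locale psdb_cell =
  H: lax_functor A B H + K: lax_functor C D K + F: oplax_functor A C F + G: oplax_functor B D G
  for A :: "('o1, 'v1, 'h1, 'c1) psdbl" and B :: "('o2, 'v2, 'h2, 'c2) psdbl"
    and C :: "('o3, 'v3, 'h3, 'c3) psdbl" and D :: "('o4, 'v4, 'h4, 'c4) psdbl"
    and H :: "('o1, 'v1, 'h1, 'c1, 'o2, 'v2, 'h2, 'c2) psfun"
    and K :: "('o3, 'v3, 'h3, 'c3, 'o4, 'v4, 'h4, 'c4) psfun"
    and F :: "('o1, 'v1, 'h1, 'c1, 'o3, 'v3, 'h3, 'c3) psfun"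
    and G :: "('o2, 'v2, 'h2, 'c2, 'o4, 'v4, 'h4, 'c4) psfun" +
  fixes \<phi> :: "('o1, 'h1, 'v4, 'c4) transf"
  assumes tr0_hom: "x \<in> Ob (vert A)
      \<Longrightarrow> tr0 \<phi> x \<in> hom (vert D) (omap G (omap H x)) (omap K (omap F x))"
    and tr0_natural: "f \<in> hom (vert A) x y
      \<Longrightarrow> tr0 \<phi> y \<cdot>\<^bsub>vert D\<^esub> vmap G (vmap H f) = vmap K (vmap F f) \<cdot>\<^bsub>vert D\<^esub> tr0 \<phi> x"
    and tr1_hom: "r \<in> Ob (sqs A)
      \<Longrightarrow> tr1 \<phi> r \<in> hom (sqs D) (hmap G (hmap H r)) (hmap K (hmap F r))"
    and tr1_natural: "\<theta> \<in> hom (sqs A) r s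
      \<Longrightarrow> tr1 \<phi> s \<cdot>\<^bsub>sqs D\<^esub> cmap G (cmap H \<theta>) = cmap K (cmap F \<theta>) \<cdot>\<^bsub>sqs D\<^esub> tr1 \<phi> r"
    and cdom_tr1: "r \<in> Ob (sqs A) \<Longrightarrow> cdom D (tr1 \<phi> r) = tr0 \<phi> (hdom A r)"
    and ccod_tr1: "r \<in> Ob (sqs A) \<Longrightarrow> ccod D (tr1 \<phi> r) = tr0 \<phi> (hcod A r)"
    and compat_ecell: "x \<in> Ob (vert A)
      \<Longrightarrow> ecell K (omap F x) \<cdot>\<^bsub>sqs D\<^esub> cunit D (tr0 \<phi> x) \<cdot>\<^bsub>sqs D\<^esub> ecell G (omap H x)
          = cmap K (ecell F x) \<cdot>\<^bsub>sqs D\<^esub> tr1 \<phi> (hunit A x) \<cdot>\<^bsub>sqs D\<^esub> cmap G (ecell H x)"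
    and compat_mcell: "\<lbrakk>r \<in> Ob (sqs A); s \<in> Ob (sqs A); hdom A s = hcod A r\<rbrakk>
      \<Longrightarrow> mcell K (hmap F s) (hmap F r) \<cdot>\<^bsub>sqs D\<^esub> (tr1 \<phi> s \<star>\<^bsub>D\<^esub> tr1 \<phi> r)
            \<cdot>\<^bsub>sqs D\<^esub> mcell G (hmap H s) (hmap H r)
          = cmap K (mcell F s r) \<cdot>\<^bsub>sqs D\<^esub> tr1 \<phi> (s \<odot>\<^bsub>A\<^esub> r) \<cdot>\<^bsub>sqs D\<^esub> cmap G (mcell H s r)"

text \<open>Pasting \<open>\<psi> \<circ> \<phi>\<close> of \<open>\<phi> : H \<rightarrow> K\<close> (dom \<open>F\<close>, cod \<open>G\<close>) and \<open>\<psi> : K \<rightarrow> L\<close> (dom \<open>F'\<close>, cod \<open>G'\<close>), with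
  \<open>G'\<close> ending in \<open>D\<close>: the components are \<open>G'GHx \<rightarrow> G'KFx \<rightarrow> LF'Fx\<close>.\<close>

definition psdb_vcmp ::
    "('o4, 'v4, 'h4, 'c4) psdbl \<Rightarrow> ('o1, 'v1, 'h1, 'c1, 'o2, 'v2, 'h2, 'c2) psfun
      \<Rightarrow> ('o3, 'v3, 'h3, 'c3, 'o4, 'v4, 'h4, 'c4) psfun \<Rightarrow> ('o2, 'h2, 'v4, 'c4) transf
      \<Rightarrow> ('o1, 'h1, 'v3, 'c3) transf \<Rightarrow> ('o1, 'h1, 'v4, 'c4) transf" where
  "psdb_vcmp D F G' \<psi> \<phi> =
     \<lparr>tr0 = \<lambda>x. tr0 \<psi> (omap F x) \<cdot>\<^bsub>vert D\<^esub> vmap G' (tr0 \<phi> x),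
      tr1 = \<lambda>r. tr1 \<psi> (hmap F r) \<cdot>\<^bsub>sqs D\<^esub> cmap G' (tr1 \<phi> r)\<rparr>"

text \<open>Pasting \<open>\<psi> \<cdot> \<phi>\<close> of \<open>\<phi> : H \<rightarrow> K\<close> (dom \<open>F\<close>, cod \<open>G\<close>) and \<open>\<psi> : H' \<rightarrow> K'\<close> (dom \<open>G\<close>, cod \<open>G'\<close>), with
  \<open>K'\<close> ending in \<open>D\<close>: the components are \<open>G'H'Hx \<rightarrow> K'GHx \<rightarrow> K'KFx\<close>.\<close>

definition psdb_hcmp ::
    "('o4, 'v4, 'h4, 'c4) psdbl \<Rightarrow> ('o1, 'v1, 'h1, 'c1, 'o2, 'v2, 'h2, 'c2) psfun
      \<Rightarrow> ('o3, 'v3, 'h3, 'c3, 'o4, 'v4, 'h4, 'c4) psfun \<Rightarrow> ('o2, 'h2, 'v4, 'c4) transf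
      \<Rightarrow> ('o1, 'h1, 'v3, 'c3) transf \<Rightarrow> ('o1, 'h1, 'v4, 'c4) transf" where
  "psdb_hcmp D H K' \<psi> \<phi> =
     \<lparr>tr0 = \<lambda>x. vmap K' (tr0 \<phi> x) \<cdot>\<^bsub>vert D\<^esub> tr0 \<psi> (omap H x),
      tr1 = \<lambda>r. cmap K' (tr1 \<phi> r) \<cdot>\<^bsub>sqs D\<^esub> tr1 \<psi> (hmap H r)\<rparr>"

text \<open>The components of the horizontal identity 2-cell $1_F$ of an oplax \<open>F\<close> and those of the vertical
  identity 2-cell $id_F$ of a lax \<open>F\<close> are given by the same formula, where \<open>B\<close> is the codomain.\<close>

definition psdb_identity ::
    "('o2, 'v2, 'h2, 'c2) psdbl \<Rightarrow> ('o1, 'v1, 'h1, 'c1, 'o2, 'v2, 'h2, 'c2) psfun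
      \<Rightarrow> ('o1, 'h1, 'v2, 'c2) transf" where
  "psdb_identity B F =
     \<lparr>tr0 = \<lambda>x. idt (vert B) (omap F x), tr1 = \<lambda>r. idt (sqs B) (hmap F r)\<rparr>"

definition transf_eq ::
    "('o1, 'v1, 'h1, 'c1) psdbl \<Rightarrow> ('o1, 'h1, 'v2, 'c2) transf \<Rightarrow> ('o1, 'h1, 'v2, 'c2) transf
      \<Rightarrow> bool" where
  "transf_eq A \<phi> \<psi> \<longleftrightarrow> (\<forall>x \<in> Ob (vert A). tr0 \<phi> x = tr0 \<psi> x) \<and> (\<forall>r \<in> Ob (sqs A). tr1 \<phi> r = tr1 \<psi> r)"

text \<open>The lax functor \<open>R : B \<rightarrow> A\<close> is a conjoint of the oplax functor \<open>F : A \<rightarrow> B\<close>. The unitors are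
  identities since this double category is strict.\<close>

definition is_conjoint ::
    "('o1, 'v1, 'h1, 'c1) psdbl \<Rightarrow> ('o2, 'v2, 'h2, 'c2) psdbl
      \<Rightarrow> ('o1, 'v1, 'h1, 'c1, 'o2, 'v2, 'h2, 'c2) psfun
      \<Rightarrow> ('o2, 'v2, 'h2, 'c2, 'o1, 'v1, 'h1, 'c1) psfun \<Rightarrow> bool" where
  "is_conjoint A B F R \<longleftrightarrow> oplax_functor A B F \<and> lax_functor B A R \<and>
     (\<exists>\<eta> \<epsilon>.
        psdb_cell A A B A (identity_psfun A) R F (identity_psfun A) \<eta> \<and>
        psdb_cell B A B B R (identity_psfun B) (identity_psfun B) F \<epsilon> \<and>
        transf_eq A (psdb_vcmp B F F \<epsilon> \<eta>) (psdb_identity B F) \<and>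
        transf_eq B (psdb_hcmp A R R \<eta> \<epsilon>) (psdb_identity A R))"


section \<open>Spans\<close>

text \<open>2-cells of the pseudodouble categories of spans and of matrices: source and target horizontal
  1-cell, dom and cod vertical 1-cell, and the remaining data.\<close>

record ('h, 'v, 'm) cell =
  csrc :: 'h
  ctgt :: 'h
  cleft :: 'v
  cright :: 'v
  cmor :: 'm

record 'a span =
  lleg :: 'a
  rleg :: 'a

definition apex :: "('o, 'a, 'm) cat_scheme \<Rightarrow> 'a span \<Rightarrow> 'o" where
  "apex V p = src V (lleg p)"

definition span_sqs :: "('o, 'a) cart_cat \<Rightarrow> ('a span, ('a span, 'a, 'a) cell) cat" where
  "span_sqs V =
     \<lparr>Ob = {p. lleg p \<in> Ar V \<and> rleg p \<in> Ar V \<and> src V (rleg p) = src V (lleg p)},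
      Ar = {\<phi>. {lleg (csrc \<phi>), rleg (csrc \<phi>), lleg (ctgt \<phi>), rleg (ctgt \<phi>)} \<subseteq> Ar V \<and>
             src V (rleg (csrc \<phi>)) = src V (lleg (csrc \<phi>)) \<and>
             src V (rleg (ctgt \<phi>)) = src V (lleg (ctgt \<phi>)) \<and>
             cleft \<phi> \<in> hom V (tgt V (lleg (csrc \<phi>))) (tgt V (lleg (ctgt \<phi>))) \<and>
             cright \<phi> \<in> hom V (tgt V (rleg (csrc \<phi>))) (tgt V (rleg (ctgt \<phi>))) \<and>
             cmor \<phi> \<in> hom V (apex V (csrc \<phi>)) (apex V (ctgt \<phi>)) \<and>
             lleg (ctgt \<phi>) \<cdot>\<^bsub>V\<^esub> cmor \<phi> = cleft \<phi> \<cdot>\<^bsub>V\<^esub> lleg (csrc \<phi>) \<and>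
             rleg (ctgt \<phi>) \<cdot>\<^bsub>V\<^esub> cmor \<phi> = cright \<phi> \<cdot>\<^bsub>V\<^esub> rleg (csrc \<phi>)},
      src = csrc,
      tgt = ctgt,
      idt = \<lambda>p. \<lparr>csrc = p, ctgt = p, cleft = idt V (tgt V (lleg p)),
                  cright = idt V (tgt V (rleg p)), cmor = idt V (apex V p)\<rparr>,
      cmp = \<lambda>\<psi> \<phi>. \<lparr>csrc = csrc \<phi>, ctgt = ctgt \<psi>, cleft = cleft \<psi> \<cdot>\<^bsub>V\<^esub> cleft \<phi>,
                    cright = cright \<psi> \<cdot>\<^bsub>V\<^esub> cright \<phi>, cmor = cmor \<psi> \<cdot>\<^bsub>V\<^esub> cmor \<phi>\<rparr>\<rparr>"

definition span_cmp :: "('o, 'a) cart_cat \<Rightarrow> 'a span \<Rightarrow> 'a span \<Rightarrow> 'a span" where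
  "span_cmp V q p =
     \<lparr>lleg = lleg p \<cdot>\<^bsub>V\<^esub> pb1 V (rleg p) (lleg q), rleg = rleg q \<cdot>\<^bsub>V\<^esub> pb2 V (rleg p) (lleg q)\<rparr>"

definition span_unit :: "('o, 'a) cart_cat \<Rightarrow> 'o \<Rightarrow> 'a span" where
  "span_unit V x = \<lparr>lleg = idt V x, rleg = idt V x\<rparr>"

definition Span :: "('o, 'a) cart_cat \<Rightarrow> ('o, 'a, 'a span, ('a span, 'a, 'a) cell) psdbl" where
  "Span V =
     \<lparr>vert = cat.truncate V,
      sqs = span_sqs V,
      hdom = \<lambda>p. tgt V (lleg p),
      cdom = cleft,
      hcod = \<lambda>p. tgt V (rleg p),
      ccod = cright,
      hunit = span_unit V,
      cunit = \<lambda>f. \<lparr>csrc = span_unit V (src V f), ctgt = span_unit V (tgt V f),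
                    cleft = f, cright = f, cmor = f\<rparr>,
      hcmp = span_cmp V,
      ccmp = \<lambda>\<psi> \<phi>. \<lparr>csrc = span_cmp V (csrc \<psi>) (csrc \<phi>), ctgt = span_cmp V (ctgt \<psi>) (ctgt \<phi>),
        cleft = cleft \<phi>, cright = cright \<psi>,
        cmor = pbtup V (rleg (ctgt \<phi>)) (lleg (ctgt \<psi>))
          (cmor \<phi> \<cdot>\<^bsub>V\<^esub> pb1 V (rleg (csrc \<phi>)) (lleg (csrc \<psi>)))
          (cmor \<psi> \<cdot>\<^bsub>V\<^esub> pb2 V (rleg (csrc \<phi>)) (lleg (csrc \<psi>)))\<rparr>,
      lun = \<lambda>p. \<lparr>csrc = span_cmp V (span_unit V (tgt V (rleg p))) p, ctgt = p,
        cleft = idt V (tgt V (lleg p)), cright = idt V (tgt V (rleg p)),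
        cmor = pb1 V (rleg p) (idt V (tgt V (rleg p)))\<rparr>,
      run = \<lambda>p. \<lparr>csrc = span_cmp V p (span_unit V (tgt V (lleg p))), ctgt = p,
        cleft = idt V (tgt V (lleg p)), cright = idt V (tgt V (rleg p)),
        cmor = pb2 V (idt V (tgt V (lleg p))) (lleg p)\<rparr>,
      asc = \<lambda>t s r. \<lparr>csrc = span_cmp V (span_cmp V t s) r, ctgt = span_cmp V t (span_cmp V s r),
        cleft = idt V (tgt V (lleg r)), cright = idt V (tgt V (rleg t)),
        cmor =
          (let u = pb1 V (rleg r) (lleg (span_cmp V t s));
               v = pb2 V (rleg r) (lleg (span_cmp V t s))
           in pbtup V (rleg (span_cmp V s r)) (lleg t)
                (pbtup V (rleg r) (lleg s) u (pb1 V (rleg s) (lleg t) \<cdot>\<^bsub>V\<^esub> v))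
                (pb2 V (rleg s) (lleg t) \<cdot>\<^bsub>V\<^esub> v))\<rparr>\<rparr>"


section \<open>Matrices\<close>

text \<open>Functions and families are extensional: they take the value \<open>undefined\<close> outside their index
  sets.\<close>

record 'u setmap =
  ssrc :: "'u set"
  stgt :: "'u set"
  sapp :: "'u \<Rightarrow> 'u"

definition Sets :: "'k rel \<Rightarrow> ('u set, 'u setmap) cat" where
  "Sets \<kappa> =
     \<lparr>Ob = {X. |X| <o \<kappa>},
      Ar = {f. |ssrc f| <o \<kappa> \<and> |stgt f| <o \<kappa> \<and> sapp f \<in> ssrc f \<rightarrow>\<^sub>E stgt f},
      src = ssrc,
      tgt = stgt,
      idt = \<lambda>X. \<lparr>ssrc = X, stgt = X, sapp = \<lambda>x\<in>X. x\<rparr>,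
      cmp = \<lambda>g f. \<lparr>ssrc = ssrc f, stgt = stgt g, sapp = \<lambda>x\<in>ssrc f. sapp g (sapp f x)\<rparr>\<rparr>"

record ('u, 'o) matrix =
  mdom :: "'u set"
  mcod :: "'u set"
  ment :: "'u \<Rightarrow> 'u \<Rightarrow> 'o"

definition matrices :: "'k rel \<Rightarrow> ('o, 'a) cart_cat \<Rightarrow> ('a, 'o) matrix set" where
  "matrices \<kappa> V =
     {p. |mdom p| <o \<kappa> \<and> |mcod p| <o \<kappa> \<and> ment p \<in> mdom p \<rightarrow>\<^sub>E (mcod p \<rightarrow>\<^sub>E Ob V)}"

definition mat_sqs ::
    "'k rel \<Rightarrow> ('o, 'a) cart_cat
      \<Rightarrow> (('a, 'o) matrix, (('a, 'o) matrix, 'a setmap, 'a \<Rightarrow> 'a \<Rightarrow> 'a) cell) cat" where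
  "mat_sqs \<kappa> V =
     \<lparr>Ob = matrices \<kappa> V,
      Ar = {\<phi>. csrc \<phi> \<in> matrices \<kappa> V \<and> ctgt \<phi> \<in> matrices \<kappa> V \<and>
             cleft \<phi> \<in> hom (Sets \<kappa>) (mdom (csrc \<phi>)) (mdom (ctgt \<phi>)) \<and>
             cright \<phi> \<in> hom (Sets \<kappa>) (mcod (csrc \<phi>)) (mcod (ctgt \<phi>)) \<and>
             cmor \<phi> \<in> (\<Pi>\<^sub>E x\<in>mdom (csrc \<phi>). \<Pi>\<^sub>E y\<in>mcod (csrc \<phi>).
               hom V (ment (csrc \<phi>) x y) (ment (ctgt \<phi>) (sapp (cleft \<phi>) x) (sapp (cright \<phi>) y)))},
      src = csrc,
      tgt = ctgt,
      idt = \<lambda>p. \<lparr>csrc = p, ctgt = p, cleft = idt (Sets \<kappa>) (mdom p), cright = idt (Sets \<kappa>) (mcod p),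
                  cmor = \<lambda>x\<in>mdom p. \<lambda>y\<in>mcod p. idt V (ment p x y)\<rparr>,
      cmp = \<lambda>\<psi> \<phi>. \<lparr>csrc = csrc \<phi>, ctgt = ctgt \<psi>,
        cleft = cleft \<psi> \<cdot>\<^bsub>Sets \<kappa>\<^esub> cleft \<phi>, cright = cright \<psi> \<cdot>\<^bsub>Sets \<kappa>\<^esub> cright \<phi>,
        cmor = \<lambda>x\<in>mdom (csrc \<phi>). \<lambda>y\<in>mcod (csrc \<phi>).
          cmor \<psi> (sapp (cleft \<phi>) x) (sapp (cright \<phi>) y) \<cdot>\<^bsub>V\<^esub> cmor \<phi> x y\<rparr>\<rparr>"

text \<open>The coproduct of copies of \<open>one V\<close> indexed by \<open>X\<close>; the truth value of \<open>P\<close> is regarded as the set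
  \<open>truth P\<close> with at most one element.\<close>

abbreviation "copower V X \<equiv> cop V X (\<lambda>_. one V)"

definition truth :: "bool \<Rightarrow> unit set" where
  "truth P = {u. P}"

definition mat_unit :: "('o, 'a) cart_cat \<Rightarrow> 'a set \<Rightarrow> ('a, 'o) matrix" where
  "mat_unit V X =
     \<lparr>mdom = X, mcod = X, ment = \<lambda>x\<in>X. \<lambda>x'\<in>X. fst (copower V (truth (x = x')))\<rparr>"

text \<open>\<open>mat_sum V q p x z\<close> is the coproduct over \<open>y\<close> of the products \<open>q(y,z) \<times> p(x,y)\<close>.\<close>

definition mat_sum ::
    "('o, 'a) cart_cat \<Rightarrow> ('a, 'o) matrix \<Rightarrow> ('a, 'o) matrix \<Rightarrow> 'a \<Rightarrow> 'a \<Rightarrow> 'o \<times> ('a \<Rightarrow> 'a)" where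
  "mat_sum V q p x z = cop V (mcod p) (\<lambda>y. prd V (ment q y z) (ment p x y))"

definition mat_cmp ::
    "('o, 'a) cart_cat \<Rightarrow> ('a, 'o) matrix \<Rightarrow> ('a, 'o) matrix \<Rightarrow> ('a, 'o) matrix" where
  "mat_cmp V q p =
     \<lparr>mdom = mdom p, mcod = mcod q, ment = \<lambda>x\<in>mdom p. \<lambda>z\<in>mcod q. fst (mat_sum V q p x z)\<rparr>"

text \<open>In the unitors, the summands other than the one with \<open>y = z\<close> (respectively \<open>y = x\<close>) are initial. The
  associator is defined by means of the injections \<open>i y \<times> id\<close> which exhibit the product of the
  coproduct \<open>(t \<odot> s)(x,z)\<close> with \<open>r(w,x)\<close> as a coproduct.\<close>

definition Mat ::
    "'k rel \<Rightarrow> ('o, 'a) cart_cat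
      \<Rightarrow> ('a set, 'a setmap, ('a, 'o) matrix, (('a, 'o) matrix, 'a setmap, 'a \<Rightarrow> 'a \<Rightarrow> 'a) cell) psdbl"
  where
  "Mat \<kappa> V =
     \<lparr>vert = Sets \<kappa>,
      sqs = mat_sqs \<kappa> V,
      hdom = mdom,
      cdom = cleft,
      hcod = mcod,
      ccod = cright,
      hunit = mat_unit V,
      cunit = \<lambda>f. \<lparr>csrc = mat_unit V (ssrc f), ctgt = mat_unit V (stgt f), cleft = f, cright = f,
        cmor = \<lambda>x\<in>ssrc f. \<lambda>x'\<in>ssrc f.
          (let c = copower V (truth (x = x')); d = copower V (truth (sapp f x = sapp f x'))
           in cotuple V (truth (x = x')) c (fst d) (snd d))\<rparr>,
      hcmp = mat_cmp V,
      ccmp = \<lambda>\<psi> \<phi>. \<lparr>csrc = mat_cmp V (csrc \<psi>) (csrc \<phi>), ctgt = mat_cmp V (ctgt \<psi>) (ctgt \<phi>),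
        cleft = cleft \<phi>, cright = cright \<psi>,
        cmor = \<lambda>x\<in>mdom (csrc \<phi>). \<lambda>z\<in>mcod (csrc \<psi>).
          (let c = mat_sum V (csrc \<psi>) (csrc \<phi>) x z;
               d = mat_sum V (ctgt \<psi>) (ctgt \<phi>) (sapp (cleft \<phi>) x) (sapp (cright \<psi>) z)
           in cotuple V (mcod (csrc \<phi>)) c (fst d)
                (\<lambda>y. snd d (sapp (cright \<phi>) y) \<cdot>\<^bsub>V\<^esub> pmap V (cmor \<psi> y z) (cmor \<phi> x y)))\<rparr>,
      lun = \<lambda>p. \<lparr>csrc = mat_cmp V (mat_unit V (mcod p)) p, ctgt = p,
        cleft = idt (Sets \<kappa>) (mdom p), cright = idt (Sets \<kappa>) (mcod p),
        cmor = \<lambda>x\<in>mdom p. \<lambda>z\<in>mcod p.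
          (let e = (\<lambda>y. ment (mat_unit V (mcod p)) y z)
           in cotuple V (mcod p) (mat_sum V (mat_unit V (mcod p)) p x z) (ment p x z)
                (\<lambda>y. if y = z then prj2 V (e y) (ment p x y)
                     else the_arrow V (prd V (e y) (ment p x y)) (ment p x z)))\<rparr>,
      run = \<lambda>p. \<lparr>csrc = mat_cmp V p (mat_unit V (mdom p)), ctgt = p,
        cleft = idt (Sets \<kappa>) (mdom p), cright = idt (Sets \<kappa>) (mcod p),
        cmor = \<lambda>x\<in>mdom p. \<lambda>z\<in>mcod p.
          (let e = (\<lambda>y. ment (mat_unit V (mdom p)) x y)
           in cotuple V (mdom p) (mat_sum V p (mat_unit V (mdom p)) x z) (ment p x z)
                (\<lambda>y. if y = x then prj1 V (ment p y z) (e y)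
                     else the_arrow V (prd V (ment p y z) (e y)) (ment p x z)))\<rparr>,
      asc = \<lambda>t s r. \<lparr>csrc = mat_cmp V (mat_cmp V t s) r, ctgt = mat_cmp V t (mat_cmp V s r),
        cleft = idt (Sets \<kappa>) (mdom r), cright = idt (Sets \<kappa>) (mcod t),
        cmor = \<lambda>w\<in>mdom r. \<lambda>z\<in>mcod t.
          (let d = mat_sum V t (mat_cmp V s r) w z
           in cotuple V (mcod r) (mat_sum V (mat_cmp V t s) r w z) (fst d)
                (\<lambda>x. let c = mat_sum V t s x z
                     in cotuple V (mcod s)
                          (prd V (fst c) (ment r w x),
                           \<lambda>y. pmap V (snd c y) (idt V (ment r w x)))
                          (fst d)
                          (\<lambda>y. snd d y \<cdot>\<^bsub>V\<^esub> pmap V (idt V (ment t y z)) (snd (mat_sum V s r w y) x)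
                                 \<cdot>\<^bsub>V\<^esub> pasc V (ment t y z) (ment s x y) (ment r w x))))\<rparr>\<rparr>"


section \<open>The two functors\<close>

definition mat_total :: "('o, 'a) cart_cat \<Rightarrow> ('a, 'o) matrix \<Rightarrow> 'o \<times> ('a \<times> 'a \<Rightarrow> 'a)" where
  "mat_total V p = cop V (mdom p \<times> mcod p) (\<lambda>(x, y). ment p x y)"

definition star_span :: "('o, 'a) cart_cat \<Rightarrow> ('a, 'o) matrix \<Rightarrow> 'a span" where
  "star_span V p =
     \<lparr>lleg = cotuple V (mdom p \<times> mcod p) (mat_total V p) (fst (copower V (mdom p)))
        (\<lambda>(x, y). snd (copower V (mdom p)) x \<cdot>\<^bsub>V\<^esub> the_arrow V (ment p x y) (one V)),
      rleg = cotuple V (mdom p \<times> mcod p) (mat_total V p) (fst (copower V (mcod p)))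
        (\<lambda>(x, y). snd (copower V (mcod p)) y \<cdot>\<^bsub>V\<^esub> the_arrow V (ment p x y) (one V))\<rparr>"

text \<open>The oplax functor \<open>- * 1\<close> from \<open>Mat \<kappa> V\<close> to \<open>Span V\<close>\<close>

definition star ::
    "('o, 'a) cart_cat
      \<Rightarrow> ('a set, 'a setmap, ('a, 'o) matrix, (('a, 'o) matrix, 'a setmap, 'a \<Rightarrow> 'a \<Rightarrow> 'a) cell,
          'o, 'a, 'a span, ('a span, 'a, 'a) cell) psfun" where
  "star V =
     (let vm = (\<lambda>f. cotuple V (ssrc f) (copower V (ssrc f)) (fst (copower V (stgt f)))
                  (\<lambda>x. snd (copower V (stgt f)) (sapp f x)))
      in
     \<lparr>omap = \<lambda>X. fst (copower V X),
      vmap = vm,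
      hmap = star_span V,
      cmap = \<lambda>\<phi>. \<lparr>csrc = star_span V (csrc \<phi>), ctgt = star_span V (ctgt \<phi>),
        cleft = vm (cleft \<phi>), cright = vm (cright \<phi>),
        cmor = cotuple V (mdom (csrc \<phi>) \<times> mcod (csrc \<phi>)) (mat_total V (csrc \<phi>)) (fst (mat_total V (ctgt \<phi>)))
          (\<lambda>(x, y). snd (mat_total V (ctgt \<phi>)) (sapp (cleft \<phi>) x, sapp (cright \<phi>) y) \<cdot>\<^bsub>V\<^esub> cmor \<phi> x y)\<rparr>,
      ecell = \<lambda>X. \<lparr>csrc = star_span V (mat_unit V X), ctgt = span_unit V (fst (copower V X)),
        cleft = idt V (fst (copower V X)), cright = idt V (fst (copower V X)),
        cmor = cotuple V (X \<times> X) (mat_total V (mat_unit V X)) (fst (copower V X))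
          (\<lambda>(x, x'). cotuple V (truth (x = x')) (copower V (truth (x = x'))) (fst (copower V X))
                      (\<lambda>_. snd (copower V X) x))\<rparr>,
      mcell = \<lambda>q p. \<lparr>csrc = star_span V (mat_cmp V q p),
        ctgt = span_cmp V (star_span V q) (star_span V p),
        cleft = idt V (fst (copower V (mdom p))), cright = idt V (fst (copower V (mcod q))),
        cmor =
          (let l = rleg (star_span V p); l' = lleg (star_span V q)
           in cotuple V (mdom p \<times> mcod q) (mat_total V (mat_cmp V q p)) (pbo V l l')
                (\<lambda>(x, z). cotuple V (mcod p) (mat_sum V q p x z) (pbo V l l')
                  (\<lambda>y. pbtup V l l'
                    (snd (mat_total V p) (x, y) \<cdot>\<^bsub>V\<^esub> prj2 V (ment q y z) (ment p x y))
                    (snd (mat_total V q) (y, z) \<cdot>\<^bsub>V\<^esub> prj1 V (ment q y z) (ment p x y)))))\<rparr>\<rparr>)"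

text \<open>The pullback of \<open>\<langle>l, r\<rangle> : M \<rightarrow> V \<times> W\<close> along \<open>\<langle>v, w\<rangle> : 1 \<rightarrow> V \<times> W\<close>; \<open>fibre_incl\<close> is its projection
  to \<open>M\<close>, and \<open>fibre_tup\<close> the map into it induced by a map into \<open>M\<close>.\<close>

definition fibre_incl :: "('o, 'a) cart_cat \<Rightarrow> 'a span \<Rightarrow> 'a \<Rightarrow> 'a \<Rightarrow> 'a" where
  "fibre_incl V s v w = pb1 V (tup V (lleg s) (rleg s)) (tup V v w)"

definition fibre_tup :: "('o, 'a) cart_cat \<Rightarrow> 'a span \<Rightarrow> 'a \<Rightarrow> 'a \<Rightarrow> 'a \<Rightarrow> 'a" where
  "fibre_tup V s v w m =
     pbtup V (tup V (lleg s) (rleg s)) (tup V v w) m (the_arrow V (src V m) (one V))"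

abbreviation points :: "('o, 'a) cart_cat \<Rightarrow> 'o \<Rightarrow> 'a set" where
  "points V a \<equiv> hom V (one V) a"

definition points_mat :: "('o, 'a) cart_cat \<Rightarrow> 'a span \<Rightarrow> ('a, 'o) matrix" where
  "points_mat V s =
     \<lparr>mdom = points V (tgt V (lleg s)), mcod = points V (tgt V (rleg s)),
      ment = \<lambda>v\<in>points V (tgt V (lleg s)). \<lambda>w\<in>points V (tgt V (rleg s)). src V (fibre_incl V s v w)\<rparr>"

text \<open>The lax functor \<open>V(1,-)\<close> from \<open>Span V\<close> to \<open>Mat \<kappa> V\<close>, with comparison cells induced by the
  universal properties of the coproducts and pullbacks involved\<close>

definition global_points ::
    "('o, 'a) cart_cat
      \<Rightarrow> ('o, 'a, 'a span, ('a span, 'a, 'a) cell,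
          'a set, 'a setmap, ('a, 'o) matrix,
          (('a, 'o) matrix, 'a setmap, 'a \<Rightarrow> 'a \<Rightarrow> 'a) cell) psfun" where
  "global_points V =
     (let vm = (\<lambda>f. \<lparr>ssrc = points V (src V f), stgt = points V (tgt V f),
                      sapp = \<lambda>v\<in>points V (src V f). f \<cdot>\<^bsub>V\<^esub> v\<rparr>);
          idp = (\<lambda>a. \<lparr>ssrc = points V a, stgt = points V a, sapp = \<lambda>v\<in>points V a. v\<rparr>)
      in
     \<lparr>omap = points V,
      vmap = vm,
      hmap = points_mat V,
      cmap = \<lambda>\<phi>. \<lparr>csrc = points_mat V (csrc \<phi>), ctgt = points_mat V (ctgt \<phi>),
        cleft = vm (cleft \<phi>), cright = vm (cright \<phi>),
        cmor = \<lambda>v\<in>points V (tgt V (lleg (csrc \<phi>))). \<lambda>w\<in>points V (tgt V (rleg (csrc \<phi>))).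
          fibre_tup V (ctgt \<phi>) (cleft \<phi> \<cdot>\<^bsub>V\<^esub> v) (cright \<phi> \<cdot>\<^bsub>V\<^esub> w)
            (cmor \<phi> \<cdot>\<^bsub>V\<^esub> fibre_incl V (csrc \<phi>) v w)\<rparr>,
      ecell = \<lambda>a. \<lparr>csrc = mat_unit V (points V a), ctgt = points_mat V (span_unit V a),
        cleft = idp a, cright = idp a,
        cmor = \<lambda>v\<in>points V a. \<lambda>w\<in>points V a.
          cotuple V (truth (v = w)) (copower V (truth (v = w)))
            (src V (fibre_incl V (span_unit V a) v w))
            (\<lambda>_. fibre_tup V (span_unit V a) v w v)\<rparr>,
      mcell = \<lambda>t s. \<lparr>csrc = mat_cmp V (points_mat V t) (points_mat V s),
        ctgt = points_mat V (span_cmp V t s),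
        cleft = idp (tgt V (lleg s)), cright = idp (tgt V (rleg t)),
        cmor = \<lambda>v\<in>points V (tgt V (lleg s)). \<lambda>w\<in>points V (tgt V (rleg t)).
          cotuple V (points V (tgt V (rleg s))) (mat_sum V (points_mat V t) (points_mat V s) v w)
            (src V (fibre_incl V (span_cmp V t s) v w))
            (\<lambda>u. let a = src V (fibre_incl V t u w); b = src V (fibre_incl V s v u)
                 in fibre_tup V (span_cmp V t s) v w
                      (pbtup V (rleg s) (lleg t)
                        (fibre_incl V s v u \<cdot>\<^bsub>V\<^esub> prj2 V a b)
                        (fibre_incl V t u w \<cdot>\<^bsub>V\<^esub> prj1 V a b)))\<rparr>\<rparr>)"

end

theory Submission
  imports Defs
begin

text \<open>Equations between maps out of a matrix composite, or out of the total object of a matrix, can be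
  tested on the summands, and equations between maps into a pullback or into a fibre can be tested on
  the projections. All the structural cells of both pseudodouble categories and all the comparison
  cells are determined by their values on summands and their projections, so each coherence condition
  reduces to an evaluation. Distributivity enters through the composites of matrices, where it exhibits
  iterated sums as sums of iterated products, and through the strictness of the initial object, which
  disposes of the off-diagonal summands of the unit matrices. The unit of the conjunction sends \<open>x\<close> to
  the injection at \<open>x\<close>, and the counit sends the summand at a point \<open>v\<close> to its target by \<open>v\<close>.\<close>

section \<open>Categories\<close>

text \<open>All structure is built from chosen pullbacks and coproducts, so horizontal composition
  is not strict and a cell can be used only through its universal property. The obstacle is that a
  coherence axiom compares long composites, inside which each cell has to be evaluated on a summand
  or through a projection. Hence composites are kept right-nested, most evaluation rules also exist
  with a further arrow composed on the right, and their parameters are often tied by equations in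
  the premises, so that they still match after simplification. The comparison cells of both functors
  are given by explicit formulas, so the lax structure is verified directly and not transported from
  the oplax one; that the two families of cells are mates is what the compatibility of the unit and
  the counit with them expresses. Smallness is felt at two places: sets of points must be small for
  distributivity to apply to sums over them, and the empty set must be small to provide an initial
  object at all.\<close>

lemma in_hom: "f \<in> hom C a b \<longleftrightarrow> f \<in> Ar C \<and> src C f = a \<and> tgt C f = b"
  by (simp add: hom_def)

context category
begin

lemma src_Ob' [simp]: "f \<in> Ar C \<Longrightarrow> src C f \<in> Ob C"
  and tgt_Ob' [simp]: "f \<in> Ar C \<Longrightarrow> tgt C f \<in> Ob C"
  by (simp_all add: src_Ob tgt_Ob)

lemma idt_simps [simp]:
  assumes "a \<in> Ob C"
  shows "idt C a \<in> Ar C" "src C (idt C a) = a" "tgt C (idt C a) = a"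
  using idt_hom[OF assms] by (auto simp: in_hom)

lemma cmp_simps [simp]:
  assumes "f \<in> Ar C" "g \<in> Ar C" "tgt C f = src C g"
  shows "g \<cdot>\<^bsub>C\<^esub> f \<in> Ar C" "src C (g \<cdot>\<^bsub>C\<^esub> f) = src C f" "tgt C (g \<cdot>\<^bsub>C\<^esub> f) = tgt C g"
  using cmp_hom[of f "src C f" "src C g" g "tgt C g"] assms by (auto simp: in_hom)

lemma cmp_assoc' [simp]:
  "\<lbrakk>f \<in> Ar C; g \<in> Ar C; h \<in> Ar C; tgt C f = src C g; tgt C g = src C h\<rbrakk>
     \<Longrightarrow> h \<cdot>\<^bsub>C\<^esub> g \<cdot>\<^bsub>C\<^esub> f = h \<cdot>\<^bsub>C\<^esub> (g \<cdot>\<^bsub>C\<^esub> f)"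
  by (rule cmp_assoc) (auto simp: in_hom)

lemma idt_cmp [simp]: "\<lbrakk>f \<in> Ar C; tgt C f = b\<rbrakk> \<Longrightarrow> idt C b \<cdot>\<^bsub>C\<^esub> f = f"
  and cmp_idt [simp]: "\<lbrakk>f \<in> Ar C; src C f = a\<rbrakk> \<Longrightarrow> f \<cdot>\<^bsub>C\<^esub> idt C a = f"
  by (auto intro: cmp_idt_left cmp_idt_right simp: in_hom)

text \<open>In right-nested form, an equation for a composite of two arrows no longer matches as
  soon as something is precomposed. Passing a rule through \<open>THEN extend_cmp\<close> gives its
  version with an arbitrary tail \<open>k\<close>.\<close>

lemma extend_cmp:
  assumes "g \<cdot>\<^bsub>C\<^esub> f = h" "f \<in> Ar C" "g \<in> Ar C" "tgt C f = src C g" "k \<in> Ar C" "tgt C k = src C f"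
  shows "g \<cdot>\<^bsub>C\<^esub> (f \<cdot>\<^bsub>C\<^esub> k) = h \<cdot>\<^bsub>C\<^esub> k"
  using assms cmp_assoc'[of k f g] by simp

section \<open>Coproduct cocones and the arrows out of them\<close>

lemma coprod_cotuple:
  assumes "is_coproduct C I F c" "d \<in> Ob C"
    and k: "\<And>i. i \<in> I \<Longrightarrow> k i \<in> Ar C \<and> src C (k i) = F i \<and> tgt C (k i) = d"
  shows "cotuple C I c d k \<in> Ar C" "src C (cotuple C I c d k) = fst c"
    "tgt C (cotuple C I c d k) = d" "i \<in> I \<Longrightarrow> cotuple C I c d k \<cdot>\<^bsub>C\<^esub> snd c i = k i"
proof -
  have "\<exists>!h. h \<in> hom C (fst c) d \<and> (\<forall>i\<in>I. h \<cdot>\<^bsub>C\<^esub> snd c i = k i)"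
    using assms unfolding is_coproduct_def in_hom by blast
  from theI'[OF this] show "cotuple C I c d k \<in> Ar C" "src C (cotuple C I c d k) = fst c"
    "tgt C (cotuple C I c d k) = d" "i \<in> I \<Longrightarrow> cotuple C I c d k \<cdot>\<^bsub>C\<^esub> snd c i = k i"
    unfolding cotuple_def in_hom by auto
qed

lemma coprod_inj:
  assumes "is_coproduct C I F c"
  shows "fst c \<in> Ob C" "i \<in> I \<Longrightarrow> snd c i \<in> Ar C" "i \<in> I \<Longrightarrow> src C (snd c i) = F i"
    "i \<in> I \<Longrightarrow> tgt C (snd c i) = fst c"
  using assms unfolding is_coproduct_def in_hom by blast+

lemma coprod_ext:
  assumes c: "is_coproduct C I F c" and h: "h \<in> Ar C" "h' \<in> Ar C" "src C h = fst c" "src C h' = fst c"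
    "tgt C h = tgt C h'" and eq: "\<And>i. i \<in> I \<Longrightarrow> h \<cdot>\<^bsub>C\<^esub> snd c i = h' \<cdot>\<^bsub>C\<^esub> snd c i"
  shows "h = h'"
proof -
  \<comment> \<open>Uniqueness is applied to the cocone that \<open>h'\<close> itself
    induces.\<close>
  have k: "h' \<cdot>\<^bsub>C\<^esub> snd c i \<in> hom C (F i) (tgt C h')" if "i \<in> I" for i
    using coprod_inj[OF c] h that by (simp add: in_hom)
  have "tgt C h' \<in> Ob C"
    using h by simp
  from c[unfolded is_coproduct_def, THEN conjunct2, THEN conjunct2, rule_format, OF this k]
  show ?thesis
  proof (rule ex1E)
    fix x assume "\<forall>y. y \<in> hom C (fst c) (tgt C h') \<and> (\<forall>i\<in>I. y \<cdot>\<^bsub>C\<^esub> snd c i = h' \<cdot>\<^bsub>C\<^esub> snd c i) \<longrightarrow> y = x"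
    then have "h = x" "h' = x"
      using h eq by (simp_all add: in_hom)
    then show ?thesis by simp
  qed
qed

lemma coprodI:
  assumes "fst c \<in> Ob C" "\<And>i. i \<in> I \<Longrightarrow> snd c i \<in> Ar C \<and> src C (snd c i) = F i \<and> tgt C (snd c i) = fst c"
    and ex: "\<And>d k. \<lbrakk>d \<in> Ob C; \<forall>i\<in>I. k i \<in> Ar C \<and> src C (k i) = F i \<and> tgt C (k i) = d\<rbrakk>
      \<Longrightarrow> \<exists>h. h \<in> Ar C \<and> src C h = fst c \<and> tgt C h = d \<and> (\<forall>i\<in>I. h \<cdot>\<^bsub>C\<^esub> snd c i = k i)"
    and uniq: "\<And>h h'. \<lbrakk>h \<in> Ar C; h' \<in> Ar C; src C h = fst c; src C h' = fst c; tgt C h = tgt C h';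
      \<forall>i\<in>I. h \<cdot>\<^bsub>C\<^esub> snd c i = h' \<cdot>\<^bsub>C\<^esub> snd c i\<rbrakk> \<Longrightarrow> h = h'"
  shows "is_coproduct C I F c"
  unfolding is_coproduct_def
proof (intro conjI ballI allI impI)
  fix d k assume d: "d \<in> Ob C" "\<forall>i\<in>I. k i \<in> hom C (F i) d"
  then obtain h where h: "h \<in> hom C (fst c) d \<and> (\<forall>i\<in>I. h \<cdot>\<^bsub>C\<^esub> snd c i = k i)"
    using ex[of d k] by (auto simp: in_hom)
  show "\<exists>!h. h \<in> hom C (fst c) d \<and> (\<forall>i\<in>I. h \<cdot>\<^bsub>C\<^esub> snd c i = k i)"
  proof (rule ex1I[of _ h], rule h, rule uniq)
    fix h' assume "h' \<in> hom C (fst c) d \<and> (\<forall>i\<in>I. h' \<cdot>\<^bsub>C\<^esub> snd c i = k i)"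
    with h show "\<forall>i\<in>I. h' \<cdot>\<^bsub>C\<^esub> snd c i = h \<cdot>\<^bsub>C\<^esub> snd c i" by simp
  qed (use h in \<open>simp_all add: in_hom\<close>)
qed (use assms in \<open>auto simp: in_hom\<close>)

text \<open>Coproducts are assumed only for index sets of type \<open>'a set\<close>, whereas the
  entries of a unit matrix are sums over subsets of \<open>unit\<close>. The one-element case is
  therefore made by hand.\<close>

lemma coprod_unit:
  assumes "a \<in> Ob C"
  shows "is_coproduct C {i} (\<lambda>_. a) (a, \<lambda>_. idt C a)"
proof (rule coprodI, goal_cases)
  case (3 d k)
  then show ?case by (intro exI[of _ "k i"]) auto
qed (use assms in auto)

text \<open>The arrow induced on the iterated coproduct is the cotuple of the cotuples along the
  rows, and uniqueness is that of the outer coproduct followed by that of each row.\<close>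

lemma coprod_sigma:
  assumes c: "\<And>x. x \<in> X \<Longrightarrow> is_coproduct C Y (\<lambda>y. F x y) (c x)"
    and e: "is_coproduct C X (\<lambda>x. fst (c x)) e"
  shows "is_coproduct C (X \<times> Y) (\<lambda>(x, y). F x y) (fst e, \<lambda>(x, y). snd e x \<cdot>\<^bsub>C\<^esub> snd (c x) y)"
proof (rule coprodI, goal_cases)
  case 1
  show ?case using coprod_inj[OF e] by simp
next
  case (2 i)
  then show ?case using coprod_inj[OF e] coprod_inj[OF c] by auto
next
  case (3 d k)
  let ?k = "\<lambda>x. cotuple C Y (c x) d (\<lambda>y. k (x, y))"
  have k: "?k x \<in> Ar C \<and> src C (?k x) = fst (c x) \<and> tgt C (?k x) = d" if "x \<in> X" for x
    using coprod_cotuple[OF c[OF that] 3(1), of "\<lambda>y. k (x, y)"] 3(2) that by auto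
  have k': "?k x \<cdot>\<^bsub>C\<^esub> snd (c x) y = k (x, y)" if "x \<in> X" "y \<in> Y" for x y
    using coprod_cotuple(4)[OF c[OF that(1)] 3(1), of "\<lambda>y. k (x, y)"] 3(2) that by auto
  note * = coprod_cotuple[OF e 3(1), of ?k, OF k]
  have "cotuple C X e d ?k \<cdot>\<^bsub>C\<^esub> (snd e x \<cdot>\<^bsub>C\<^esub> snd (c x) y) = k (x, y)" if "x \<in> X" "y \<in> Y" for x y
    using that coprod_inj[OF e] coprod_inj[OF c[OF that(1)]] *
    by (subst extend_cmp[OF *(4)]) (auto simp: k')
  with * show ?case
    by (intro exI[of _ "cotuple C X e d ?k"]) auto
next
  case (4 h h')
  then have h: "h \<in> Ar C" "h' \<in> Ar C" "src C h = fst e" "src C h' = fst e" "tgt C h = tgt C h'"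
    by auto
  show ?case
  proof (rule coprod_ext[OF e h])
    fix x assume x: "x \<in> X"
    show "h \<cdot>\<^bsub>C\<^esub> snd e x = h' \<cdot>\<^bsub>C\<^esub> snd e x"
    proof (rule coprod_ext[OF c[OF x]])
      fix y assume y: "y \<in> Y"
      show "h \<cdot>\<^bsub>C\<^esub> snd e x \<cdot>\<^bsub>C\<^esub> snd (c x) y = h' \<cdot>\<^bsub>C\<^esub> snd e x \<cdot>\<^bsub>C\<^esub> snd (c x) y"
        using x y h 4(6) coprod_inj[OF e] coprod_inj[OF c[OF x]] by auto
    qed (use x h coprod_inj[OF e] in simp_all)
  qed
qed

end


section \<open>Finite limits\<close>

text \<open>\<open>has_finite_limits\<close> speaks of shapes made of natural numbers. Here 0, 1 and
  2 serve both as objects and as their identities, and 3 and 4 are the arrows 0 -> 2 and 1 -> 2. The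
  last two are never composable with each other, so one factor of a composite is always an identity;
  the test \<open>v \<le> 2\<close> finds out which.\<close>

definition cospan_shape :: "(nat, nat) cat" where
  "cospan_shape = \<lparr>Ob = {0, 1, 2}, Ar = {0, 1, 2, 3, 4},
     src = (\<lambda>u. if u = 3 then 0 else if u = 4 then 1 else u),
     tgt = (\<lambda>u. if u = 3 \<or> u = 4 then 2 else u),
     idt = (\<lambda>j. j), cmp = (\<lambda>v u. if v \<le> 2 then u else v)\<rparr>"

lemma cospan_simps [simp]:
  "Ob cospan_shape = {0, 1, 2}" "Ar cospan_shape = {0, 1, 2, 3, 4}" "idt cospan_shape j = j"
  "src cospan_shape u = (if u = 3 then 0 else if u = 4 then 1 else u)"
  "tgt cospan_shape u = (if u = 3 \<or> u = 4 then 2 else u)"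
  "v \<cdot>\<^bsub>cospan_shape\<^esub> u = (if v \<le> 2 then u else v)"
  by (simp_all add: cospan_shape_def)

lemma cospan_finite: "finite (Ob cospan_shape) \<and> finite (Ar cospan_shape)"
  by simp

lemma category_cospan: "category cospan_shape"
proof
  fix a b c d f g h assume "f \<in> hom cospan_shape a b" "g \<in> hom cospan_shape b c"
  then show "g \<cdot>\<^bsub>cospan_shape\<^esub> f \<in> hom cospan_shape a c"
    by (auto simp: in_hom split: if_splits)
  show "h \<cdot>\<^bsub>cospan_shape\<^esub> g \<cdot>\<^bsub>cospan_shape\<^esub> f = h \<cdot>\<^bsub>cospan_shape\<^esub> (g \<cdot>\<^bsub>cospan_shape\<^esub> f)"
    by simp
qed (auto simp: in_hom split: if_splits)

lemma (in category) pullback_exists: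
  assumes lim: "has_finite_limits C" and f: "f \<in> Ar C" "g \<in> Ar C" "tgt C f = tgt C g"
  shows "\<exists>p q. is_pullback C f g p q"
proof -
  interpret J: category cospan_shape by (rule category_cospan)
  let ?Do = "\<lambda>j::nat. if j = 0 then src C f else if j = 1 then src C g else tgt C f"
  let ?Da = "\<lambda>u::nat. if u = 3 then f else if u = 4 then g else idt C (?Do u)"
  have func: "cat_functor cospan_shape C ?Do ?Da"
    using f by unfold_locales (auto simp: in_hom split: if_splits)
  obtain L \<pi> where L: "is_limit C cospan_shape ?Do ?Da L \<pi>"
    using lim[unfolded has_finite_limits_def, rule_format, of cospan_shape ?Do ?Da] cospan_finite func
    by auto
  then have cone: "L \<in> Ob C" "\<pi> 0 \<in> Ar C" "src C (\<pi> 0) = L" "tgt C (\<pi> 0) = src C f"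
    "\<pi> (Suc 0) \<in> Ar C" "src C (\<pi> (Suc 0)) = L" "tgt C (\<pi> (Suc 0)) = src C g"
    "f \<cdot>\<^bsub>C\<^esub> \<pi> 0 = \<pi> 2" "g \<cdot>\<^bsub>C\<^esub> \<pi> (Suc 0) = \<pi> 2"
    by (auto simp: is_limit_def is_cone_def in_hom)
  have *: "\<exists>!h. h \<in> hom C c L \<and> \<pi> 0 \<cdot>\<^bsub>C\<^esub> h = u \<and> \<pi> (Suc 0) \<cdot>\<^bsub>C\<^esub> h = v"
    if uv: "u \<in> hom C c (src C f)" "v \<in> hom C c (src C g)" "f \<cdot>\<^bsub>C\<^esub> u = g \<cdot>\<^bsub>C\<^esub> v" for c u v
  proof -
    let ?\<mu> = "\<lambda>j::nat. if j = 0 then u else if j = 1 then v else f \<cdot>\<^bsub>C\<^esub> u"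
    have "is_cone C cospan_shape ?Do ?Da c ?\<mu>"
      using uv f src_Ob[of u] by (auto simp: is_cone_def in_hom)
    then have ex1: "\<exists>!h. h \<in> hom C c L \<and> (\<forall>j \<in> {0, 1, 2}. \<pi> j \<cdot>\<^bsub>C\<^esub> h = ?\<mu> j)"
      using L[unfolded is_limit_def, THEN conjunct2, rule_format, of c ?\<mu>] by (simp only: cospan_simps)
    \<comment> \<open>The component at 2 is forced by the one at 0, so the universal property with
      three components is equivalent to that of a pullback with two.\<close>
    have "\<pi> 2 \<cdot>\<^bsub>C\<^esub> h = f \<cdot>\<^bsub>C\<^esub> (\<pi> 0 \<cdot>\<^bsub>C\<^esub> h)" if "h \<in> hom C c L" for h
      using extend_cmp[OF cone(8), of h] cone f that by (simp add: in_hom)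
    then have "(h \<in> hom C c L \<and> (\<forall>j \<in> {0, 1, 2}. \<pi> j \<cdot>\<^bsub>C\<^esub> h = ?\<mu> j)) =
        (h \<in> hom C c L \<and> \<pi> 0 \<cdot>\<^bsub>C\<^esub> h = u \<and> \<pi> (Suc 0) \<cdot>\<^bsub>C\<^esub> h = v)" for h
      by auto
    with ex1 show ?thesis by (simp only:)
  qed
  have "is_pullback C f g (\<pi> 0) (\<pi> (Suc 0))"
    unfolding is_pullback_def cone(3)
  proof (intro conjI allI impI, goal_cases)
    case (7 c u v)
    then show ?case by (intro *) simp_all
  qed (use f cone in \<open>simp_all add: in_hom\<close>)
  then show ?thesis by blast
qed


section \<open>Distributive categories with finite limits\<close>

text \<open>Infiniteness of \<open>\<kappa>\<close> enters through the smallness of the empty index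
  set.\<close>

locale distributive_lex = distributive_category \<kappa> V
  for \<kappa> :: "'k rel" and V :: "('o, 'a) cart_cat" +
  assumes infinite_card: "Cinfinite \<kappa>" and finite_limits: "has_finite_limits V"
begin

abbreviation cmpV :: "'a \<Rightarrow> 'a \<Rightarrow> 'a"  (infixr "\<bullet>" 70) where
  "g \<bullet> f \<equiv> g \<cdot>\<^bsub>V\<^esub> f"

abbreviation bang :: "'o \<Rightarrow> 'a" where
  "bang a \<equiv> the_arrow V a (one V)"

section \<open>The terminal object and binary products\<close>

lemma one_Ob [simp]: "one V \<in> Ob V"
  using one_terminal by (simp add: is_terminal_def)

lemma bang_unique: "a \<in> Ob V \<Longrightarrow> \<exists>!h. h \<in> hom V a (one V)"
  using one_terminal by (simp add: is_terminal_def)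

lemma bang_simps [simp]:
  assumes "a \<in> Ob V"
  shows "bang a \<in> Ar V" "src V (bang a) = a" "tgt V (bang a) = one V"
  using theI'[OF bang_unique[OF assms]] by (simp_all add: the_arrow_def in_hom)

lemma eq_bang:
  assumes "f \<in> Ar V" "tgt V f = one V"
  shows "f = bang (src V f)"
  using the1_equality[OF bang_unique, of "src V f" f] assms by (simp add: the_arrow_def in_hom)

lemma bang_cmp [simp]: "\<lbrakk>f \<in> Ar V; tgt V f = a\<rbrakk> \<Longrightarrow> bang a \<bullet> f = bang (src V f)"
  using eq_bang[of "bang a \<bullet> f"] by auto

lemma bang_one [simp]: "bang (one V) = idt V (one V)"
  using eq_bang[of "idt V (one V)"] by simp

lemma src_prj1 [simp]: "src V (prj1 V a b) = prd V a b"
  by (simp add: prd_def)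

lemma prj_simps [simp]:
  assumes "a \<in> Ob V" "b \<in> Ob V"
  shows "prj1 V a b \<in> Ar V" "tgt V (prj1 V a b) = a" "prj2 V a b \<in> Ar V"
    "src V (prj2 V a b) = prd V a b" "tgt V (prj2 V a b) = b" "prd V a b \<in> Ob V"
  using prj_product[OF assms] src_Ob'[of "prj1 V a b"] by (auto simp: is_product_def in_hom)

lemma tup_unique:
  assumes "f \<in> Ar V" "g \<in> Ar V" "src V f = src V g"
  shows "\<exists>!h. h \<in> hom V (src V f) (prd V (tgt V f) (tgt V g)) \<and>
     prj1 V (tgt V f) (tgt V g) \<bullet> h = f \<and> prj2 V (tgt V f) (tgt V g) \<bullet> h = g"
proof -
  have "is_product V (tgt V f) (tgt V g) (prj1 V (tgt V f) (tgt V g)) (prj2 V (tgt V f) (tgt V g))"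
    using assms by (intro prj_product) auto
  from this[unfolded is_product_def, THEN conjunct2, THEN conjunct2, rule_format, of f "src V f" g]
  show ?thesis
    using assms by (simp add: in_hom)
qed

lemma tup_simps [simp]:
  assumes "f \<in> Ar V" "g \<in> Ar V" "src V f = src V g"
  shows "tup V f g \<in> Ar V" "src V (tup V f g) = src V f"
    "tgt V (tup V f g) = prd V (tgt V f) (tgt V g)"
    "\<lbrakk>tgt V f = a; tgt V g = b\<rbrakk> \<Longrightarrow> prj1 V a b \<bullet> tup V f g = f"
    "\<lbrakk>tgt V f = a; tgt V g = b\<rbrakk> \<Longrightarrow> prj2 V a b \<bullet> tup V f g = g"
  using theI'[OF tup_unique[OF assms]] by (auto simp: tup_def in_hom)

lemma prd_ext:
  assumes h: "h \<in> Ar V" "k \<in> Ar V" "src V h = src V k" "tgt V h = prd V a b" "tgt V k = prd V a b"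
    and ab: "a \<in> Ob V" "b \<in> Ob V"
    and eq: "prj1 V a b \<bullet> h = prj1 V a b \<bullet> k" "prj2 V a b \<bullet> h = prj2 V a b \<bullet> k"
  shows "h = k"
proof (rule ex1E[OF tup_unique[of "prj1 V a b \<bullet> h" "prj2 V a b \<bullet> h"]])
  fix x assume *: "\<forall>y. y \<in> hom V (src V (prj1 V a b \<bullet> h))
      (prd V (tgt V (prj1 V a b \<bullet> h)) (tgt V (prj2 V a b \<bullet> h))) \<and>
     prj1 V (tgt V (prj1 V a b \<bullet> h)) (tgt V (prj2 V a b \<bullet> h)) \<bullet> y = prj1 V a b \<bullet> h \<and>
     prj2 V (tgt V (prj1 V a b \<bullet> h)) (tgt V (prj2 V a b \<bullet> h)) \<bullet> y = prj2 V a b \<bullet> h \<longrightarrow> y = x"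
  from *[rule_format, of h] *[rule_format, of k] show ?thesis
    using h ab eq by (simp add: in_hom)
qed (use h ab in auto)

lemma prj_tup_cmp [simp]:
  assumes "f \<in> Ar V" "g \<in> Ar V" "src V f = src V g" "h \<in> Ar V" "tgt V h = src V f"
    "tgt V f = a" "tgt V g = b"
  shows "prj1 V a b \<bullet> (tup V f g \<bullet> h) = f \<bullet> h" "prj2 V a b \<bullet> (tup V f g \<bullet> h) = g \<bullet> h"
  using assms by (subst extend_cmp[OF tup_simps(4)] extend_cmp[OF tup_simps(5)]; auto)+

text \<open>Tuples absorb what is precomposed with them. Together with the evaluation of projections
  on tuples this gives arrows into products a normal form, and makes \<open>tup V f g\<close> usable
  as a generalized element of a product.\<close>

lemma tup_cmp [simp]:
  assumes "f \<in> Ar V" "g \<in> Ar V" "src V f = src V g" "h \<in> Ar V" "tgt V h = src V f"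
  shows "tup V f g \<bullet> h = tup V (f \<bullet> h) (g \<bullet> h)"
  by (rule prd_ext[of _ _ "tgt V f" "tgt V g"]) (use assms in auto)

lemma tup_eta [simp]: "\<lbrakk>h \<in> Ar V; tgt V h = prd V a b; a \<in> Ob V; b \<in> Ob V\<rbrakk>
    \<Longrightarrow> tup V (prj1 V a b \<bullet> h) (prj2 V a b \<bullet> h) = h"
  by (rule prd_ext[of _ _ a b]) auto

lemma tup_prj [simp]: "\<lbrakk>a \<in> Ob V; b \<in> Ob V\<rbrakk> \<Longrightarrow> tup V (prj1 V a b) (prj2 V a b) = idt V (prd V a b)"
  by (rule prd_ext[of _ _ a b]) auto

section \<open>Chosen pullbacks\<close>

lemma pb_exists:
  assumes "f \<in> Ar V" "g \<in> Ar V" "tgt V f = tgt V g"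
  shows "is_pullback V f g (pb1 V f g) (pb2 V f g)"
proof -
  obtain p q where "is_pullback V f g p q"
    using pullback_exists[OF finite_limits assms] by blast
  then have "is_pullback V f g (fst (p, q)) (snd (p, q))"
    by simp
  then show ?thesis
    unfolding pb_def by (rule someI)
qed

lemma pb_simps [simp]:
  assumes "f \<in> Ar V" "g \<in> Ar V" "tgt V f = tgt V g"
  shows "pb1 V f g \<in> Ar V" "tgt V (pb1 V f g) = src V f" "pb2 V f g \<in> Ar V"
    "src V (pb2 V f g) = pbo V f g" "tgt V (pb2 V f g) = src V g"
  using pb_exists[OF assms] unfolding is_pullback_def in_hom by simp_all

text \<open>As a rewrite rule this replaces the path along the first projection by the one along the
  second, so that both ways around a square meet in one form.\<close>

lemma pb_square [simp]:
  assumes "f \<in> Ar V" "g \<in> Ar V" "tgt V f = tgt V g"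
  shows "f \<bullet> pb1 V f g = g \<bullet> pb2 V f g"
  using pb_exists[OF assms] unfolding is_pullback_def by simp

lemmas pb_square' [simp] = pb_square[THEN extend_cmp]

text \<open>Composites are normalised to right-nested form, in which the simplifier no longer recognises the
  pullback square along a composite; hence this restatement.\<close>

lemma pb_square_cmp [simp]:
  assumes "f \<in> Ar V" "f' \<in> Ar V" "g \<in> Ar V" "tgt V f' = src V f" "tgt V f = tgt V g"
  shows "f \<bullet> f' \<bullet> pb1 V (f \<bullet> f') g = g \<bullet> pb2 V (f \<bullet> f') g"
    "\<lbrakk>k \<in> Ar V; tgt V k = pbo V (f \<bullet> f') g\<rbrakk>
      \<Longrightarrow> f \<bullet> f' \<bullet> pb1 V (f \<bullet> f') g \<bullet> k = g \<bullet> pb2 V (f \<bullet> f') g \<bullet> k"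
  using pb_square[of "f \<bullet> f'" g] pb_square'[of "f \<bullet> f'" g k] assms
  by (simp_all del: pb_square pb_square')

lemma pbtup_unique:
  assumes "f \<in> Ar V" "g \<in> Ar V" "tgt V f = tgt V g" "u \<in> Ar V" "v \<in> Ar V" "src V u = src V v"
    "tgt V u = src V f" "tgt V v = src V g" "f \<bullet> u = g \<bullet> v"
  shows "\<exists>!h. h \<in> hom V (src V u) (pbo V f g) \<and> pb1 V f g \<bullet> h = u \<and> pb2 V f g \<bullet> h = v"
proof -
  have "\<forall>c u v. u \<in> hom V c (src V f) \<and> v \<in> hom V c (src V g) \<and> f \<bullet> u = g \<bullet> v \<longrightarrow>
        (\<exists>!h. h \<in> hom V c (pbo V f g) \<and> pb1 V f g \<bullet> h = u \<and> pb2 V f g \<bullet> h = v)"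
    using pb_exists[OF assms(1-3)] by (simp add: is_pullback_def)
  from this[rule_format, of u "src V u" v] show ?thesis
    using assms by (simp add: in_hom)
qed

lemma pbtup_simps [simp]:
  assumes "f \<in> Ar V" "g \<in> Ar V" "tgt V f = tgt V g" "u \<in> Ar V" "v \<in> Ar V" "src V u = src V v"
    "tgt V u = src V f" "tgt V v = src V g" "f \<bullet> u = g \<bullet> v"
  shows "pbtup V f g u v \<in> Ar V" "src V (pbtup V f g u v) = src V u"
    "tgt V (pbtup V f g u v) = pbo V f g"
    "pb1 V f g \<bullet> pbtup V f g u v = u" "pb2 V f g \<bullet> pbtup V f g u v = v"
  using theI'[OF pbtup_unique[OF assms]] by (simp_all add: pbtup_def in_hom)

lemma pb_ext:
  assumes fg: "f \<in> Ar V" "g \<in> Ar V" "tgt V f = tgt V g"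
    and h: "h \<in> Ar V" "k \<in> Ar V" "src V h = src V k" "tgt V h = pbo V f g" "tgt V k = pbo V f g"
    and eq: "pb1 V f g \<bullet> h = pb1 V f g \<bullet> k" "pb2 V f g \<bullet> h = pb2 V f g \<bullet> k"
  shows "h = k"
proof (rule ex1E[OF pbtup_unique[OF fg, of "pb1 V f g \<bullet> h" "pb2 V f g \<bullet> h"]])
  fix x assume *: "\<forall>y. y \<in> hom V (src V (pb1 V f g \<bullet> h)) (pbo V f g) \<and>
     pb1 V f g \<bullet> y = pb1 V f g \<bullet> h \<and> pb2 V f g \<bullet> y = pb2 V f g \<bullet> h \<longrightarrow> y = x"
  from *[rule_format, of h] *[rule_format, of k] show ?thesis
    using h fg eq by (simp add: in_hom)
qed (use h fg in auto)

lemma pbtup_cmp [simp]: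
  assumes "f \<in> Ar V" "g \<in> Ar V" "tgt V f = tgt V g" "u \<in> Ar V" "v \<in> Ar V" "src V u = src V v"
    "tgt V u = src V f" "tgt V v = src V g" "f \<bullet> u = g \<bullet> v" "k \<in> Ar V" "tgt V k = src V u"
  shows "pb1 V f g \<bullet> pbtup V f g u v \<bullet> k = u \<bullet> k" "pb2 V f g \<bullet> pbtup V f g u v \<bullet> k = v \<bullet> k"
  using assms by (simp_all add: extend_cmp[OF pbtup_simps(4)] extend_cmp[OF pbtup_simps(5)])


subsection \<open>Coproducts\<close>

lemma coprod_cop: "is_coproduct V I F c \<Longrightarrow> is_coproduct V I F (cop V I F)"
  unfolding cop_def by (rule someI)

lemma cop_coproduct:
  fixes X :: "'a set"
  assumes "|X| <o \<kappa>" "\<And>x. x \<in> X \<Longrightarrow> F x \<in> Ob V"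
  shows "is_coproduct V X F (cop V X F)"
proof -
  obtain c where "is_coproduct V X F c"
    using small_coproducts[of X F] assms by blast
  then show ?thesis by (rule coprod_cop)
qed

section \<open>The initial object and sums over truth values\<close>

lemma small_empty: "|{} :: 'b set| <o \<kappa>"
  using infinite_card
  by (intro finite_ordLess_infinite) (auto simp: cinfinite_def Field_card_of card_of_well_order_on card_order_on_well_order_on)

lemma copower_coproduct: "|X :: 'a set| <o \<kappa> \<Longrightarrow> is_coproduct V X (\<lambda>_. one V) (copower V X)"
  by (rule cop_coproduct) simp_all

lemmas copower_simps [simp] =
  coprod_inj[OF copower_coproduct] coprod_cotuple[OF copower_coproduct]

lemmas copower_ext = coprod_ext[OF copower_coproduct]

lemmas copower_cotuple_cmp [simp] = coprod_cotuple(4)[OF copower_coproduct, THEN extend_cmp]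

lemma truth_simps [simp]: "truth True = {()}" "truth False = {}"
  by (auto simp: truth_def)

text \<open>The chosen coproduct of one copy of \<open>one V\<close> need not be
  \<open>one V\<close> itself. Its injection \<open>pt\<close> is the comparison, with inverse the
  arrow to the terminal object.\<close>

abbreviation pt :: 'a where
  "pt \<equiv> snd (copower V {()}) ()"

text \<open>Small coproducts provide an empty coproduct only with indices of type \<open>'a\<close>.
  As there are no injections to speak of, its vertex serves for the empty set of any index type and
  for any families \<open>F\<close> and \<open>G\<close>.\<close>

lemma empty_coproduct: "is_coproduct V {} F (cop V {} G)"
proof -
  have "is_coproduct V ({} :: 'a set) (\<lambda>_. one V) (copower V {})"
    by (rule copower_coproduct[OF small_empty])
  then have "is_coproduct V {} G (fst (copower V ({} :: 'a set)), undefined)"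
    by (auto simp: is_coproduct_def)
  then have "is_coproduct V {} G (cop V {} G)"
    by (rule coprod_cop)
  then show ?thesis
    by (auto simp: is_coproduct_def)
qed

lemma truth_coproduct: "is_coproduct V (truth P) (\<lambda>_. one V) (copower V (truth P))"
  using empty_coproduct coprod_cop[OF coprod_unit[OF one_Ob]] by (cases P) simp_all

lemma copower_truth_Ob [simp]: "fst (copower V (truth P)) \<in> Ob V"
  by (rule coprod_inj(1)[OF truth_coproduct])

lemma copower_empty_Ob [simp]: "fst (copower V ({} :: unit set)) \<in> Ob V"
  using copower_truth_Ob[of False] by simp

lemma pt_simps [simp]: "pt \<in> Ar V" "src V pt = one V" "tgt V pt = fst (copower V {()})"
  "fst (copower V {()}) \<in> Ob V"
  using coprod_inj(2-4)[OF truth_coproduct[of True], of "()"] coprod_inj(1)[OF truth_coproduct[of True]]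
  by simp_all

lemma truth_cotuple [simp]:
  assumes "d \<in> Ob V" "P \<Longrightarrow> k () \<in> Ar V \<and> src V (k ()) = one V \<and> tgt V (k ()) = d"
  shows "cotuple V (truth P) (copower V (truth P)) d k \<in> Ar V"
    "src V (cotuple V (truth P) (copower V (truth P)) d k) = fst (copower V (truth P))"
    "tgt V (cotuple V (truth P) (copower V (truth P)) d k) = d"
  using coprod_cotuple(1,2,3)[OF truth_coproduct[of P] assms(1), where k = k] assms(2)
  by (auto simp: truth_def)

lemma pt_cotuple [simp]:
  assumes "d \<in> Ob V" "k () \<in> Ar V \<and> src V (k ()) = one V \<and> tgt V (k ()) = d"
  shows "cotuple V {()} (copower V {()}) d k \<bullet> pt = k ()"
  using coprod_cotuple(4)[OF truth_coproduct[of True] assms(1), where k = k] assms(2) by simp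

text \<open>The diagonal entries of unit matrices are terminal, hence a generalized element of such
  an entry carries no information and may be replaced by \<open>pt\<close>.\<close>

lemma eq_pt_bang:
  assumes "f \<in> Ar V" "tgt V f = fst (copower V {()})"
  shows "f = pt \<bullet> bang (src V f)"
proof -
  let ?E = "fst (copower V {()})"
  have "idt V ?E = pt \<bullet> bang ?E"
    by (rule coprod_ext[OF truth_coproduct[of True]]) auto
  then have "idt V ?E \<bullet> f = (pt \<bullet> bang ?E) \<bullet> f"
    by simp
  then show ?thesis
    using assms by simp
qed

text \<open>Initial objects are strict, because multiplying the empty coproduct by \<open>c\<close> yields the empty
  coproduct, of which \<open>c\<close> is a retract as soon as it has an arrow to the initial object.\<close>

lemma strict_initial:
  assumes f: "f \<in> Ar V" "tgt V f = fst (copower V {} :: 'o \<times> (unit \<Rightarrow> 'a))"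
    and h: "h \<in> Ar V" "k \<in> Ar V" "src V h = src V f" "src V k = src V f" "tgt V h = tgt V k"
  shows "h = k"
proof -
  let ?c = "copower V {} :: 'o \<times> (unit \<Rightarrow> 'a)" and ?a = "src V f"
  have c: "is_coproduct V ({} :: 'a set) (\<lambda>_. one V) (fst ?c, \<lambda>_. idt V (one V))"
    using empty_coproduct[of "\<lambda>_. one V" "\<lambda>_. one V"] by (auto simp: is_coproduct_def)
  have fc: "fst ?c \<in> Ob V"
    using tgt_Ob'[OF f(1)] f(2) by simp
  have d: "is_coproduct V ({} :: 'a set) (\<lambda>i. prd V ?a (one V))
      (prd V ?a (fst ?c), \<lambda>i. pmap V (idt V ?a) (idt V (one V)))"
    using product_preserves_right[OF small_empty _ c, of ?a] f by simp
  have "h \<bullet> prj1 V ?a (fst ?c) = k \<bullet> prj1 V ?a (fst ?c)"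
    by (rule coprod_ext[OF d]) (use f fc h in auto)
  then have "(h \<bullet> prj1 V ?a (fst ?c)) \<bullet> tup V (idt V ?a) f = (k \<bullet> prj1 V ?a (fst ?c)) \<bullet> tup V (idt V ?a) f"
    by simp
  then show ?thesis
    using f fc h by simp
qed

text \<open>The unitors of matrices use \<open>the_arrow\<close> on off-diagonal summands. This
  definite description is meaningful because an object that maps to the initial object is itself
  initial.\<close>

lemma strict_initial_arrow:
  assumes f: "f \<in> Ar V" "tgt V f = fst (copower V {} :: 'o \<times> (unit \<Rightarrow> 'a))" and b: "b \<in> Ob V"
  shows "the_arrow V (src V f) b \<in> Ar V" "src V (the_arrow V (src V f) b) = src V f"
    "tgt V (the_arrow V (src V f) b) = b"
proof -
  let ?c = "copower V {} :: 'o \<times> (unit \<Rightarrow> 'a)"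
  \<comment> \<open>The family over the empty set is a dummy; any value in place of
    \<open>idt V b\<close> would do.\<close>
  note g = coprod_cotuple(1-3)[OF empty_coproduct[of "\<lambda>_. one V"] b, of "\<lambda>_ :: unit. idt V b"]
  let ?h = "cotuple V {} ?c b (\<lambda>_. idt V b) \<bullet> f"
  have h: "?h \<in> hom V (src V f) b"
    using f b g by (simp add: in_hom)
  moreover have "k = ?h" if "k \<in> hom V (src V f) b" for k
    using that h by (intro strict_initial[OF f]) (auto simp: in_hom)
  ultimately have "\<exists>!h. h \<in> hom V (src V f) b"
    by (intro ex1I[of _ ?h])
  from theI'[OF this] show "the_arrow V (src V f) b \<in> Ar V" "src V (the_arrow V (src V f) b) = src V f"
    "tgt V (the_arrow V (src V f) b) = b"
    by (simp_all add: the_arrow_def in_hom)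
qed

text \<open>Maps out of a sum of products are tested on generalized elements: an injection composed with
  \<open>tup V f g\<close> for arbitrary \<open>f\<close> and \<open>g\<close>. With the cells characterised by their action on such
  elements, the coherence conditions become rewriting problems.\<close>

context
  fixes I :: "'a set" and F :: "'a \<Rightarrow> 'o" and c :: "'o \<times> ('a \<Rightarrow> 'a)" and b :: 'o
  assumes small: "|I| <o \<kappa>" and c: "is_coproduct V I F c" and F: "\<And>i. i \<in> I \<Longrightarrow> F i \<in> Ob V" and b: "b \<in> Ob V"
begin

lemma dist_left: "is_coproduct V I (\<lambda>i. prd V (F i) b) (prd V (fst c) b, \<lambda>i. pmap V (snd c i) (idt V b))"
  using product_preserves_left[OF small _ c b] F by auto

lemma dist_right: "is_coproduct V I (\<lambda>i. prd V b (F i)) (prd V b (fst c), \<lambda>i. pmap V (idt V b) (snd c i))"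
  using product_preserves_right[OF small _ c b] F by auto

text \<open>When \<open>f\<close> and \<open>g\<close> are the two projections, the tuple is the
  injection \<open>pmap V (snd c i) (idt V b)\<close> of the coproduct given by distributivity, so
  the premise does test all injections.\<close>

lemma dist_ext_left:
  assumes h: "h \<in> Ar V" "k \<in> Ar V" "src V h = prd V (fst c) b" "src V k = prd V (fst c) b"
    "tgt V h = tgt V k"
    and eq: "\<And>i f g. \<lbrakk>i \<in> I; f \<in> Ar V; g \<in> Ar V; src V f = src V g; tgt V f = F i; tgt V g = b\<rbrakk>
      \<Longrightarrow> h \<bullet> tup V (snd c i \<bullet> f) g = k \<bullet> tup V (snd c i \<bullet> f) g"
  shows "h = k"
  by (rule coprod_ext[OF dist_left])
    (use h b coprod_inj[OF c] F eq[of _ "prj1 V (F _) b" "prj2 V (F _) b"] in \<open>simp_all add: pmap_def\<close>)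

lemma dist_ext_right:
  assumes h: "h \<in> Ar V" "k \<in> Ar V" "src V h = prd V b (fst c)" "src V k = prd V b (fst c)"
    "tgt V h = tgt V k"
    and eq: "\<And>i f g. \<lbrakk>i \<in> I; f \<in> Ar V; g \<in> Ar V; src V f = src V g; tgt V f = b; tgt V g = F i\<rbrakk>
      \<Longrightarrow> h \<bullet> tup V f (snd c i \<bullet> g) = k \<bullet> tup V f (snd c i \<bullet> g)"
  shows "h = k"
  by (rule coprod_ext[OF dist_right])
    (use h b coprod_inj[OF c] F eq[of _ "prj1 V b (F _)" "prj2 V b (F _)"] in \<open>simp_all add: pmap_def\<close>)

text \<open>The defining equation of the cotuple concerns the injection
  \<open>pmap V (snd c i) (idt V b)\<close>. Composing it with \<open>tup V f g\<close> turns it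
  into a rule for generalized elements, the form needed to evaluate the associator of
  matrices.\<close>

lemma dist_cotuple_left:
  assumes "d \<in> Ob V" "\<And>i. i \<in> I \<Longrightarrow> k i \<in> Ar V \<and> src V (k i) = prd V (F i) b \<and> tgt V (k i) = d"
  shows "cotuple V I (prd V (fst c) b, \<lambda>i. pmap V (snd c i) (idt V b)) d k \<in> Ar V"
    "src V (cotuple V I (prd V (fst c) b, \<lambda>i. pmap V (snd c i) (idt V b)) d k) = prd V (fst c) b" "tgt V (cotuple V I (prd V (fst c) b, \<lambda>i. pmap V (snd c i) (idt V b)) d k) = d"
    "\<lbrakk>i \<in> I; f \<in> Ar V; g \<in> Ar V; src V f = src V g; tgt V f = F i; tgt V g = b\<rbrakk>
      \<Longrightarrow> cotuple V I (prd V (fst c) b, \<lambda>i. pmap V (snd c i) (idt V b)) d k \<bullet> tup V (snd c i \<bullet> f) g = k i \<bullet> tup V f g"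
proof -
  let ?h = "cotuple V I (prd V (fst c) b, \<lambda>i. pmap V (snd c i) (idt V b)) d k"
  note * = coprod_cotuple[OF dist_left assms(1), where k = k, OF assms(2)]
  show h: "?h \<in> Ar V" "src V ?h = prd V (fst c) b" "tgt V ?h = d"
    using *(1-3) by simp_all
  assume i: "i \<in> I" "f \<in> Ar V" "g \<in> Ar V" "src V f = src V g" "tgt V f = F i" "tgt V g = b"
  have "?h \<bullet> pmap V (snd c i) (idt V b) = k i"
    using *(4)[OF _ i(1)] by simp
  then have "?h \<bullet> pmap V (snd c i) (idt V b) \<bullet> tup V f g = k i \<bullet> tup V f g"
    by (rule extend_cmp) (use i coprod_inj[OF c] F b h in \<open>simp_all add: pmap_def\<close>)
  then show "?h \<bullet> tup V (snd c i \<bullet> f) g = k i \<bullet> tup V f g"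
    using i coprod_inj[OF c] F b h by (simp add: pmap_def)
qed

lemma dist_cotuple_right:
  assumes "d \<in> Ob V" "\<And>i. i \<in> I \<Longrightarrow> k i \<in> Ar V \<and> src V (k i) = prd V b (F i) \<and> tgt V (k i) = d"
  shows "cotuple V I (prd V b (fst c), \<lambda>i. pmap V (idt V b) (snd c i)) d k \<in> Ar V"
    "src V (cotuple V I (prd V b (fst c), \<lambda>i. pmap V (idt V b) (snd c i)) d k) = prd V b (fst c)" "tgt V (cotuple V I (prd V b (fst c), \<lambda>i. pmap V (idt V b) (snd c i)) d k) = d"
    "\<lbrakk>i \<in> I; f \<in> Ar V; g \<in> Ar V; src V f = src V g; tgt V f = b; tgt V g = F i\<rbrakk>
      \<Longrightarrow> cotuple V I (prd V b (fst c), \<lambda>i. pmap V (idt V b) (snd c i)) d k \<bullet> tup V f (snd c i \<bullet> g) = k i \<bullet> tup V f g"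
proof -
  let ?h = "cotuple V I (prd V b (fst c), \<lambda>i. pmap V (idt V b) (snd c i)) d k"
  note * = coprod_cotuple[OF dist_right assms(1), where k = k, OF assms(2)]
  show h: "?h \<in> Ar V" "src V ?h = prd V b (fst c)" "tgt V ?h = d"
    using *(1-3) by simp_all
  assume i: "i \<in> I" "f \<in> Ar V" "g \<in> Ar V" "src V f = src V g" "tgt V f = b" "tgt V g = F i"
  have "?h \<bullet> pmap V (idt V b) (snd c i) = k i"
    using *(4)[OF _ i(1)] by simp
  then have "?h \<bullet> pmap V (idt V b) (snd c i) \<bullet> tup V f g = k i \<bullet> tup V f g"
    by (rule extend_cmp) (use i coprod_inj[OF c] F b h in \<open>simp_all add: pmap_def\<close>)
  then show "?h \<bullet> tup V f (snd c i \<bullet> g) = k i \<bullet> tup V f g"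
    using i coprod_inj[OF c] F b h by (simp add: pmap_def)
qed

end

end


section \<open>Spans\<close>

lemma cell_eqI:
  fixes \<phi> \<psi> :: "('h, 'v, 'm) cell"
  assumes "csrc \<phi> = csrc \<psi>" "ctgt \<phi> = ctgt \<psi>" "cleft \<phi> = cleft \<psi>" "cright \<phi> = cright \<psi>" "cmor \<phi> = cmor \<psi>"
  shows "\<phi> = \<psi>"
  using assms by simp

lemma truncate_simps [simp]:
  "Ob (cat.truncate V) = Ob V" "Ar (cat.truncate V) = Ar V" "src (cat.truncate V) = src V"
  "tgt (cat.truncate V) = tgt V" "idt (cat.truncate V) = idt V" "cmp (cat.truncate V) = cmp V"
  by (simp_all add: cat.truncate_def)

lemma hom_truncate [simp]: "hom (cat.truncate V) = hom V"
  by (simp add: hom_def fun_eq_iff)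

lemma (in category) category_truncate: "category (cat.truncate C)"
  by unfold_locales
    (simp_all add: cat.truncate_def hom_def src_Ob tgt_Ob)

lemma Span_simps [simp]:
  "vert (Span V) = cat.truncate V" "sqs (Span V) = span_sqs V"
  "hdom (Span V) = (\<lambda>p. tgt V (lleg p))" "hcod (Span V) = (\<lambda>p. tgt V (rleg p))"
  "cdom (Span V) = cleft" "ccod (Span V) = cright"
  "hunit (Span V) = span_unit V" "hcmp (Span V) = span_cmp V"
  by (simp_all add: Span_def)

lemma span_simps [simp]:
  "lleg (span_unit V a) = idt V a" "rleg (span_unit V a) = idt V a"
  "lleg (span_cmp V q p) = lleg p \<cdot>\<^bsub>V\<^esub> pb1 V (rleg p) (lleg q)"
  "rleg (span_cmp V q p) = rleg q \<cdot>\<^bsub>V\<^esub> pb2 V (rleg p) (lleg q)"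
  by (simp_all add: span_unit_def span_cmp_def)

lemma span_sqs_simps [simp]:
  "p \<in> Ob (span_sqs V) \<longleftrightarrow> lleg p \<in> Ar V \<and> rleg p \<in> Ar V \<and> src V (rleg p) = src V (lleg p)"
  "src (span_sqs V) = csrc" "tgt (span_sqs V) = ctgt"
  "csrc (idt (span_sqs V) p) = p" "ctgt (idt (span_sqs V) p) = p"
  "cleft (idt (span_sqs V) p) = idt V (tgt V (lleg p))"
  "cright (idt (span_sqs V) p) = idt V (tgt V (rleg p))"
  "cmor (idt (span_sqs V) p) = idt V (src V (lleg p))"
  "csrc (\<psi> \<cdot>\<^bsub>span_sqs V\<^esub> \<phi>) = csrc \<phi>" "ctgt (\<psi> \<cdot>\<^bsub>span_sqs V\<^esub> \<phi>) = ctgt \<psi>"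
  "cleft (\<psi> \<cdot>\<^bsub>span_sqs V\<^esub> \<phi>) = cleft \<psi> \<cdot>\<^bsub>V\<^esub> cleft \<phi>"
  "cright (\<psi> \<cdot>\<^bsub>span_sqs V\<^esub> \<phi>) = cright \<psi> \<cdot>\<^bsub>V\<^esub> cright \<phi>"
  "cmor (\<psi> \<cdot>\<^bsub>span_sqs V\<^esub> \<phi>) = cmor \<psi> \<cdot>\<^bsub>V\<^esub> cmor \<phi>"
  by (simp_all add: span_sqs_def apex_def)

lemma span_cell_simps [simp]:
  "csrc (cunit (Span V) f) = span_unit V (src V f)" "ctgt (cunit (Span V) f) = span_unit V (tgt V f)"
  "cleft (cunit (Span V) f) = f" "cright (cunit (Span V) f) = f" "cmor (cunit (Span V) f) = f"
  "csrc (\<psi> \<star>\<^bsub>Span V\<^esub> \<phi>) = span_cmp V (csrc \<psi>) (csrc \<phi>)"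
  "ctgt (\<psi> \<star>\<^bsub>Span V\<^esub> \<phi>) = span_cmp V (ctgt \<psi>) (ctgt \<phi>)"
  "cleft (\<psi> \<star>\<^bsub>Span V\<^esub> \<phi>) = cleft \<phi>" "cright (\<psi> \<star>\<^bsub>Span V\<^esub> \<phi>) = cright \<psi>"
  "csrc (lun (Span V) p) = span_cmp V (span_unit V (tgt V (rleg p))) p" "ctgt (lun (Span V) p) = p"
  "cleft (lun (Span V) p) = idt V (tgt V (lleg p))" "cright (lun (Span V) p) = idt V (tgt V (rleg p))"
  "cmor (lun (Span V) p) = pb1 V (rleg p) (idt V (tgt V (rleg p)))"
  "csrc (run (Span V) p) = span_cmp V p (span_unit V (tgt V (lleg p)))" "ctgt (run (Span V) p) = p"
  "cleft (run (Span V) p) = idt V (tgt V (lleg p))" "cright (run (Span V) p) = idt V (tgt V (rleg p))"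
  "cmor (run (Span V) p) = pb2 V (idt V (tgt V (lleg p))) (lleg p)"
  "csrc (asc (Span V) t s r) = span_cmp V (span_cmp V t s) r"
  "ctgt (asc (Span V) t s r) = span_cmp V t (span_cmp V s r)"
  "cleft (asc (Span V) t s r) = idt V (tgt V (lleg r))"
  "cright (asc (Span V) t s r) = idt V (tgt V (rleg t))"
  by (simp_all add: Span_def)

context distributive_lex
begin

section \<open>The category of spans and their morphisms\<close>

lemma span_cellI:
  assumes "csrc \<phi> \<in> Ob (span_sqs V)" "ctgt \<phi> \<in> Ob (span_sqs V)"
    "cleft \<phi> \<in> Ar V" "src V (cleft \<phi>) = tgt V (lleg (csrc \<phi>))" "tgt V (cleft \<phi>) = tgt V (lleg (ctgt \<phi>))"
    "cright \<phi> \<in> Ar V" "src V (cright \<phi>) = tgt V (rleg (csrc \<phi>))" "tgt V (cright \<phi>) = tgt V (rleg (ctgt \<phi>))"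
    "cmor \<phi> \<in> Ar V" "src V (cmor \<phi>) = src V (lleg (csrc \<phi>))" "tgt V (cmor \<phi>) = src V (lleg (ctgt \<phi>))"
    "lleg (ctgt \<phi>) \<bullet> cmor \<phi> = cleft \<phi> \<bullet> lleg (csrc \<phi>)" "rleg (ctgt \<phi>) \<bullet> cmor \<phi> = cright \<phi> \<bullet> rleg (csrc \<phi>)"
  shows "\<phi> \<in> Ar (span_sqs V)"
  using assms by (simp add: span_sqs_def in_hom apex_def)

text \<open>The target is a variable tied by an equation because \<open>ctgt \<phi>\<close> itself
  has often been simplified away where the rule is to apply. Many rules below have equational
  premises for the same reason.\<close>

lemma span_cell_leg:
  assumes "\<phi> \<in> Ar (span_sqs V)" "ctgt \<phi> = q"
  shows "lleg q \<bullet> cmor \<phi> = cleft \<phi> \<bullet> lleg (csrc \<phi>)" "rleg q \<bullet> cmor \<phi> = cright \<phi> \<bullet> rleg (csrc \<phi>)"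
  using assms by (auto simp add: span_sqs_def)

lemma span_cell [simp]:
  assumes "\<phi> \<in> Ar (span_sqs V)"
  shows "cleft \<phi> \<in> Ar V" "src V (cleft \<phi>) = tgt V (lleg (csrc \<phi>))" "tgt V (cleft \<phi>) = tgt V (lleg (ctgt \<phi>))"
    "cright \<phi> \<in> Ar V" "src V (cright \<phi>) = tgt V (rleg (csrc \<phi>))" "tgt V (cright \<phi>) = tgt V (rleg (ctgt \<phi>))"
    "cmor \<phi> \<in> Ar V" "src V (cmor \<phi>) = src V (lleg (csrc \<phi>))" "tgt V (cmor \<phi>) = src V (lleg (ctgt \<phi>))"
    "lleg (csrc \<phi>) \<in> Ar V" "rleg (csrc \<phi>) \<in> Ar V" "src V (rleg (csrc \<phi>)) = src V (lleg (csrc \<phi>))"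
    "lleg (ctgt \<phi>) \<in> Ar V" "rleg (ctgt \<phi>) \<in> Ar V" "src V (rleg (ctgt \<phi>)) = src V (lleg (ctgt \<phi>))"
  using assms by (simp_all add: span_sqs_def in_hom apex_def)

lemmas span_cell_leg' [simp] = span_cell_leg span_cell_leg[THEN extend_cmp]

text \<open>Horizontal composability is a condition on the vertical boundaries of cells, while the
  pullbacks involved need the feet of the spans to agree; typing converts the one into the
  other.\<close>

lemma span_cell_match:
  assumes "\<phi> \<in> Ar (span_sqs V)" "\<psi> \<in> Ar (span_sqs V)" "cleft \<psi> = cright \<phi>"
  shows "tgt V (lleg (csrc \<psi>)) = tgt V (rleg (csrc \<phi>))" "tgt V (lleg (ctgt \<psi>)) = tgt V (rleg (ctgt \<phi>))"
  using span_cell(2,3)[OF assms(2)] span_cell(5,6)[OF assms(1)] assms(3) by simp_all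

lemma span_cmp_cell [simp]:
  assumes "\<phi> \<in> Ar (span_sqs V)" "\<psi> \<in> Ar (span_sqs V)" "csrc \<psi> = ctgt \<phi>"
  shows "\<psi> \<cdot>\<^bsub>span_sqs V\<^esub> \<phi> \<in> Ar (span_sqs V)"
proof -
  have "tgt V (cleft \<phi>) = src V (cleft \<psi>)" "tgt V (cright \<phi>) = src V (cright \<psi>)"
    using assms by simp_all
  then show ?thesis
    by (intro span_cellI) (use assms in simp_all)
qed

lemma span_idt_cell [simp]: "p \<in> Ob (span_sqs V) \<Longrightarrow> idt (span_sqs V) p \<in> Ar (span_sqs V)"
  by (intro span_cellI) simp_all

lemma span_category: "category (span_sqs V)"
proof (unfold_locales, goal_cases)
  case (1 f) then show ?case by simp
next
  case (2 f) then show ?case by simp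
next
  case (3 a) then show ?case by (simp add: in_hom del: span_sqs_simps(1))
next
  case (4 f a b g c) then show ?case by (simp add: in_hom)
next
  case (5 f a b) then show ?case by (intro cell_eqI) (auto simp: in_hom)
next
  case (6 f a b) then show ?case by (intro cell_eqI) (auto simp: in_hom)
next
  case (7 f a b g c h d) then show ?case by (intro cell_eqI) (auto simp: in_hom)
qed

section \<open>Units, horizontal composites and the associator of spans\<close>

lemma span_cunit_cell [simp]: "f \<in> Ar V \<Longrightarrow> cunit (Span V) f \<in> Ar (span_sqs V)"
  by (intro span_cellI) simp_all

lemma cmor_ccmp_span:
  "cmor (\<psi> \<star>\<^bsub>Span V\<^esub> \<phi>) = pbtup V (rleg (ctgt \<phi>)) (lleg (ctgt \<psi>))
          (cmor \<phi> \<bullet> pb1 V (rleg (csrc \<phi>)) (lleg (csrc \<psi>)))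
          (cmor \<psi> \<bullet> pb2 V (rleg (csrc \<phi>)) (lleg (csrc \<psi>)))"
  by (simp add: Span_def)

text \<open>The defining pair lies in the pullback because \<open>cright \<phi>\<close> and
  \<open>cleft \<psi>\<close> are the same arrow between the middle feet. Afterwards only its two
  projections are used.\<close>

lemma ccmp_span_cell:
  assumes "\<phi> \<in> Ar (span_sqs V)" "\<psi> \<in> Ar (span_sqs V)" "cleft \<psi> = cright \<phi>"
  shows "\<psi> \<star>\<^bsub>Span V\<^esub> \<phi> \<in> Ar (span_sqs V)"
    "\<lbrakk>a = rleg (ctgt \<phi>); b = lleg (ctgt \<psi>)\<rbrakk>
      \<Longrightarrow> pb1 V a b \<bullet> cmor (\<psi> \<star>\<^bsub>Span V\<^esub> \<phi>) = cmor \<phi> \<bullet> pb1 V (rleg (csrc \<phi>)) (lleg (csrc \<psi>))"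
    "\<lbrakk>a = rleg (ctgt \<phi>); b = lleg (ctgt \<psi>)\<rbrakk>
      \<Longrightarrow> pb2 V a b \<bullet> cmor (\<psi> \<star>\<^bsub>Span V\<^esub> \<phi>) = cmor \<psi> \<bullet> pb2 V (rleg (csrc \<phi>)) (lleg (csrc \<psi>))"
proof -
  note m [simp] = span_cell_match[OF assms]
  let ?M = "cmor (\<psi> \<star>\<^bsub>Span V\<^esub> \<phi>)"
  let ?a = "rleg (ctgt \<phi>)" and ?b = "lleg (ctgt \<psi>)"
  have *: "?M \<in> Ar V" "src V ?M = pbo V (rleg (csrc \<phi>)) (lleg (csrc \<psi>))" "tgt V ?M = pbo V ?a ?b"
    "pb1 V ?a ?b \<bullet> ?M = cmor \<phi> \<bullet> pb1 V (rleg (csrc \<phi>)) (lleg (csrc \<psi>))"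
    "pb2 V ?a ?b \<bullet> ?M = cmor \<psi> \<bullet> pb2 V (rleg (csrc \<phi>)) (lleg (csrc \<psi>))"
    unfolding cmor_ccmp_span using assms by simp_all
  show "\<psi> \<star>\<^bsub>Span V\<^esub> \<phi> \<in> Ar (span_sqs V)"
    by (intro span_cellI) (use assms * in simp_all)
  show "\<lbrakk>a = rleg (ctgt \<phi>); b = lleg (ctgt \<psi>)\<rbrakk>
      \<Longrightarrow> pb1 V a b \<bullet> ?M = cmor \<phi> \<bullet> pb1 V (rleg (csrc \<phi>)) (lleg (csrc \<psi>))"
    "\<lbrakk>a = rleg (ctgt \<phi>); b = lleg (ctgt \<psi>)\<rbrakk>
      \<Longrightarrow> pb2 V a b \<bullet> ?M = cmor \<psi> \<bullet> pb2 V (rleg (csrc \<phi>)) (lleg (csrc \<psi>))"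
    using * by simp_all
qed

lemmas ccmp_span_simps [simp] = ccmp_span_cell ccmp_span_cell(2,3)[THEN extend_cmp]

text \<open>An arrow into the iterated pullback is determined by its components in the apices of
  \<open>r\<close>, \<open>s\<close> and \<open>t\<close>. The three equations give these components
  of the associator and replace its definition from here on.\<close>

lemma asc_span_cell:
  assumes r: "r \<in> Ob (span_sqs V)" and s: "s \<in> Ob (span_sqs V)" and t: "t \<in> Ob (span_sqs V)"
    and sr: "tgt V (lleg s) = tgt V (rleg r)" and ts: "tgt V (lleg t) = tgt V (rleg s)"
  defines "A \<equiv> cmor (asc (Span V) t s r)"
  shows "asc (Span V) t s r \<in> Ar (span_sqs V)"
    "\<lbrakk>a = rleg r; b = lleg s; c = rleg (span_cmp V s r); d = lleg t\<rbrakk>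
      \<Longrightarrow> pb1 V a b \<bullet> pb1 V c d \<bullet> A = pb1 V (rleg r) (lleg (span_cmp V t s))"
    "\<lbrakk>a = rleg r; b = lleg s; c = rleg (span_cmp V s r); d = lleg t\<rbrakk>
      \<Longrightarrow> pb2 V a b \<bullet> pb1 V c d \<bullet> A = pb1 V (rleg s) (lleg t) \<bullet> pb2 V (rleg r) (lleg (span_cmp V t s))"
    "\<lbrakk>c = rleg (span_cmp V s r); d = lleg t\<rbrakk>
      \<Longrightarrow> pb2 V c d \<bullet> A = pb2 V (rleg s) (lleg t) \<bullet> pb2 V (rleg r) (lleg (span_cmp V t s))"
proof -
  note [simp] = r[simplified] s[simplified] t[simplified] sr ts
  define u v where "u = pb1 V (rleg r) (lleg (span_cmp V t s))" and "v = pb2 V (rleg r) (lleg (span_cmp V t s))"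
  have uv [simp]: "u \<in> Ar V" "v \<in> Ar V" "src V v = src V u" "tgt V u = src V (lleg r)"
    "tgt V v = pbo V (rleg s) (lleg t)" "rleg r \<bullet> u = lleg s \<bullet> pb1 V (rleg s) (lleg t) \<bullet> v"
    by (simp_all add: u_def v_def)
  define w where "w = pbtup V (rleg r) (lleg s) u (pb1 V (rleg s) (lleg t) \<bullet> v)"
  have w [simp]: "w \<in> Ar V" "src V w = src V u" "tgt V w = pbo V (rleg r) (lleg s)"
    "pb1 V (rleg r) (lleg s) \<bullet> w = u" "pb2 V (rleg r) (lleg s) \<bullet> w = pb1 V (rleg s) (lleg t) \<bullet> v"
    unfolding w_def by simp_all
  have A: "A = pbtup V (rleg (span_cmp V s r)) (lleg t) w (pb2 V (rleg s) (lleg t) \<bullet> v)"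
    by (simp add: A_def Span_def Let_def w_def u_def v_def)
  have *: "A \<in> Ar V" "src V A = src V u" "tgt V A = pbo V (rleg (span_cmp V s r)) (lleg t)"
    "pb1 V (rleg (span_cmp V s r)) (lleg t) \<bullet> A = w"
    "pb2 V (rleg (span_cmp V s r)) (lleg t) \<bullet> A = pb2 V (rleg s) (lleg t) \<bullet> v"
    unfolding A by simp_all
  show "asc (Span V) t s r \<in> Ar (span_sqs V)"
    by (intro span_cellI) (use * in \<open>simp_all flip: A_def add: u_def v_def\<close>)
  show "\<lbrakk>a = rleg r; b = lleg s; c = rleg (span_cmp V s r); d = lleg t\<rbrakk>
      \<Longrightarrow> pb1 V a b \<bullet> pb1 V c d \<bullet> A = pb1 V (rleg r) (lleg (span_cmp V t s))"
    "\<lbrakk>a = rleg r; b = lleg s; c = rleg (span_cmp V s r); d = lleg t\<rbrakk>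
      \<Longrightarrow> pb2 V a b \<bullet> pb1 V c d \<bullet> A = pb1 V (rleg s) (lleg t) \<bullet> pb2 V (rleg r) (lleg (span_cmp V t s))"
    "\<lbrakk>c = rleg (span_cmp V s r); d = lleg t\<rbrakk>
      \<Longrightarrow> pb2 V c d \<bullet> A = pb2 V (rleg s) (lleg t) \<bullet> pb2 V (rleg r) (lleg (span_cmp V t s))"
    using * by (simp_all add: u_def v_def)
qed

lemma (in category) extend_cmp_cmp:
  assumes "g \<cdot>\<^bsub>C\<^esub> (f \<cdot>\<^bsub>C\<^esub> e) = h" "e \<in> Ar C" "f \<in> Ar C" "g \<in> Ar C" "tgt C e = src C f" "tgt C f = src C g"
    "k \<in> Ar C" "tgt C k = src C e"
  shows "g \<cdot>\<^bsub>C\<^esub> (f \<cdot>\<^bsub>C\<^esub> (e \<cdot>\<^bsub>C\<^esub> k)) = h \<cdot>\<^bsub>C\<^esub> k"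
  using assms extend_cmp[of g "f \<cdot>\<^bsub>C\<^esub> e" h k] by simp

lemmas asc_span_simps [simp] = asc_span_cell
  asc_span_cell(2,3)[THEN extend_cmp_cmp] asc_span_cell(4)[THEN extend_cmp]

text \<open>Only the apex needs an inverse: since \<open>cmor \<phi> \<bullet> g\<close> cancels,
  compatibility of \<open>g\<close> with the legs follows from that of
  \<open>cmor \<phi>\<close>.\<close>

lemma span_iso:
  assumes "\<phi> \<in> Ar (span_sqs V)" "cleft \<phi> = idt V (tgt V (lleg (csrc \<phi>)))" "cright \<phi> = idt V (tgt V (rleg (csrc \<phi>)))"
    and g: "g \<in> Ar V" "g \<bullet> cmor \<phi> = idt V (src V (lleg (csrc \<phi>)))" "cmor \<phi> \<bullet> g = idt V (src V (lleg (ctgt \<phi>)))"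
    "src V g = src V (lleg (ctgt \<phi>))" "tgt V g = src V (lleg (csrc \<phi>))"
  shows "iso_in (span_sqs V) \<phi>"
proof -
  let ?g = "\<lparr>csrc = ctgt \<phi>, ctgt = csrc \<phi>, cleft = cleft \<phi>, cright = cright \<phi>, cmor = g\<rparr>"
  have legs: "tgt V (lleg (ctgt \<phi>)) = tgt V (lleg (csrc \<phi>))" "tgt V (rleg (ctgt \<phi>)) = tgt V (rleg (csrc \<phi>))"
    using span_cell(3,6)[OF assms(1)] assms by simp_all
  have "lleg (ctgt \<phi>) \<bullet> cmor \<phi> \<bullet> g = lleg (csrc \<phi>) \<bullet> g" "rleg (ctgt \<phi>) \<bullet> cmor \<phi> \<bullet> g = rleg (csrc \<phi>) \<bullet> g"
    using assms(1-5,7,8) by simp_all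
  then have "lleg (csrc \<phi>) \<bullet> g = lleg (ctgt \<phi>)" "rleg (csrc \<phi>) \<bullet> g = rleg (ctgt \<phi>)"
    unfolding assms(6) using assms(1) by simp_all
  then have "?g \<in> Ar (span_sqs V)"
    by (intro span_cellI) (use assms legs in simp_all)
  moreover have "?g \<cdot>\<^bsub>span_sqs V\<^esub> \<phi> = idt (span_sqs V) (csrc \<phi>)" "\<phi> \<cdot>\<^bsub>span_sqs V\<^esub> ?g = idt (span_sqs V) (ctgt \<phi>)"
    by (rule cell_eqI; use assms legs in simp)+
  ultimately show ?thesis
    using assms(1) unfolding iso_in_def by (intro conjI bexI[of _ ?g]) (simp_all add: in_hom)
qed

section \<open>The structural functors of spans and the invertibility of unitors and
  associator\<close>

lemma span_dom: "cat_functor (span_sqs V) (cat.truncate V) (\<lambda>p. tgt V (lleg p)) cleft"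
  by (intro cat_functor.intro cat_functor_axioms.intro span_category category_truncate) (auto simp: in_hom)

lemma span_cod: "cat_functor (span_sqs V) (cat.truncate V) (\<lambda>p. tgt V (rleg p)) cright"
  by (intro cat_functor.intro cat_functor_axioms.intro span_category category_truncate) (auto simp: in_hom)

lemma span_unit_functor: "cat_functor (cat.truncate V) (span_sqs V) (span_unit V) (cunit (Span V))"
  by (intro cat_functor.intro cat_functor_axioms.intro span_category category_truncate)
    (auto simp: in_hom intro!: cell_eqI)

lemma span_lun_cell [simp]: "p \<in> Ob (span_sqs V) \<Longrightarrow> lun (Span V) p \<in> Ar (span_sqs V)"
  and span_run_cell [simp]: "p \<in> Ob (span_sqs V) \<Longrightarrow> run (Span V) p \<in> Ar (span_sqs V)"
  by (intro span_cellI; simp)+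

lemma span_lun_iso:
  assumes "p \<in> Ob (span_sqs V)"
  shows "iso_in (span_sqs V) (lun (Span V) p)"
proof -
  have p [simp]: "lleg p \<in> Ar V" "rleg p \<in> Ar V" "src V (rleg p) = src V (lleg p)"
    using assms by simp_all
  show ?thesis
    by (rule span_iso[where g = "pbtup V (rleg p) (idt V (tgt V (rleg p))) (idt V (src V (lleg p))) (rleg p)"])
      (simp_all, rule pb_ext[of "rleg p" "idt V (tgt V (rleg p))"], simp_all)
qed

lemma span_run_iso:
  assumes "p \<in> Ob (span_sqs V)"
  shows "iso_in (span_sqs V) (run (Span V) p)"
proof -
  have p [simp]: "lleg p \<in> Ar V" "rleg p \<in> Ar V" "src V (rleg p) = src V (lleg p)"
    using assms by simp_all
  \<comment> \<open>The identity leg disappears from the square under simplification, which leaves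
    \<open>pb_square\<close> nothing to match. The reduced square is supplied instead, directed to
    the first projection.\<close>
  have [simp]: "lleg p \<bullet> pb2 V (idt V (tgt V (lleg p))) (lleg p) = pb1 V (idt V (tgt V (lleg p))) (lleg p)"
    using pb_square[of "idt V (tgt V (lleg p))" "lleg p"] by (simp del: pb_square)
  show ?thesis
    by (rule span_iso[where g = "pbtup V (idt V (tgt V (lleg p))) (lleg p) (lleg p) (idt V (src V (lleg p)))"])
      (simp_all, rule pb_ext[of "idt V (tgt V (lleg p))" "lleg p"], simp_all)
qed

lemma span_asc_iso:
  assumes r: "r \<in> Ob (span_sqs V)" and s: "s \<in> Ob (span_sqs V)" and t: "t \<in> Ob (span_sqs V)"
    and sr: "tgt V (lleg s) = tgt V (rleg r)" and ts: "tgt V (lleg t) = tgt V (rleg s)"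
  shows "iso_in (span_sqs V) (asc (Span V) t s r)"
proof -
  note [simp] = r[simplified] s[simplified] t[simplified] sr ts
  let ?u = "pb1 V (rleg (span_cmp V s r)) (lleg t)" and ?v = "pb2 V (rleg (span_cmp V s r)) (lleg t)"
  let ?A = "cmor (asc (Span V) t s r)"
  \<comment> \<open>\<open>w\<close> is the pair of the components in the apices of \<open>s\<close>
    and \<open>t\<close>, and \<open>g\<close> adds the one in the apex of \<open>r\<close>. The
    inverse thus consists of the same three components in the other bracketing.\<close>
  define w where "w = pbtup V (rleg s) (lleg t) (pb2 V (rleg r) (lleg s) \<bullet> ?u) ?v"
  have w [simp]: "w \<in> Ar V" "src V w = src V ?u" "tgt V w = pbo V (rleg s) (lleg t)"
    "pb1 V (rleg s) (lleg t) \<bullet> w = pb2 V (rleg r) (lleg s) \<bullet> ?u" "pb2 V (rleg s) (lleg t) \<bullet> w = ?v"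
    unfolding w_def by simp_all
  note w' [simp] = w(4,5)[THEN extend_cmp]
  define g where "g = pbtup V (rleg r) (lleg (span_cmp V t s)) (pb1 V (rleg r) (lleg s) \<bullet> ?u) w"
  have g [simp]: "g \<in> Ar V" "src V g = src V ?u" "tgt V g = pbo V (rleg r) (lleg (span_cmp V t s))"
    "pb1 V (rleg r) (lleg (span_cmp V t s)) \<bullet> g = pb1 V (rleg r) (lleg s) \<bullet> ?u"
    "pb2 V (rleg r) (lleg (span_cmp V t s)) \<bullet> g = w"
    unfolding g_def by simp_all
  note g' [simp] = g(4,5)[THEN extend_cmp] g[simplified] g(4,5)[THEN extend_cmp, simplified]
  have A [simp]: "?A \<in> Ar V" "src V ?A = pbo V (rleg r) (lleg (span_cmp V t s))"
    "tgt V ?A = pbo V (rleg (span_cmp V s r)) (lleg t)"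
    by simp_all
  have wA: "w \<bullet> ?A = pb2 V (rleg r) (lleg (span_cmp V t s))"
    by (rule pb_ext[of "rleg s" "lleg t"]) simp_all
  have "g \<bullet> ?A = idt V (pbo V (rleg r) (lleg (span_cmp V t s)))"
    by (rule pb_ext[of "rleg r" "lleg (span_cmp V t s)"]) (use wA in simp_all)
  moreover have uAg: "?u \<bullet> ?A \<bullet> g = ?u"
    by (rule pb_ext[of "rleg r" "lleg s"]) simp_all
  have "?A \<bullet> g = idt V (pbo V (rleg (span_cmp V s r)) (lleg t))"
    by (rule pb_ext[of "rleg (span_cmp V s r)" "lleg t"]) (use uAg in simp_all)
  ultimately show ?thesis
    by (intro span_iso[where g = g]) simp_all
qed

theorem Span_pseudodouble: "pseudodouble_category (Span V)"
proof (intro pseudodouble_category.intro pseudodouble_category_axioms.intro, unfold Span_simps, goal_cases)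
  case 1 show ?case by (rule category_truncate)
next
  case 2 show ?case by (rule span_category)
next
  case 3 show ?case by (rule span_dom)
next
  case 4 show ?case by (rule span_cod)
next
  case 5 show ?case by (rule span_unit_functor)
next
  case (11 \<phi> r r' \<psi> s s') then show ?case by (auto simp: in_hom)
next
  case (12 r s)
  then show ?case
    by (intro cell_eqI; simp?) (rule pb_ext[of "rleg r" "lleg s"]; simp)
next
  case (13 \<phi> r r' \<phi>' r'' \<psi> s s' \<psi>' s'')
  then have c: "\<phi> \<in> Ar (span_sqs V)" "\<psi> \<in> Ar (span_sqs V)" "\<phi>' \<in> Ar (span_sqs V)" "\<psi>' \<in> Ar (span_sqs V)"
    "csrc \<phi>' = ctgt \<phi>" "csrc \<psi>' = ctgt \<psi>" "cleft \<psi> = cright \<phi>" "cleft \<psi>' = cright \<phi>'"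
    by (auto simp: in_hom)
  note [simp] = c span_cell_match[OF c(1,2,7)] span_cell_match(2)[OF c(3,4,8)]
  show ?case
    by (rule cell_eqI; simp?) (rule pb_ext[of "rleg (ctgt \<phi>')" "lleg (ctgt \<psi>')"]; simp)
next
  case (14 r)
  then show ?case by (auto simp: globular_def in_hom span_lun_iso)
next
  case (15 \<phi> r r')
  then show ?case by (intro cell_eqI) (auto simp: in_hom)
next
  case (16 r)
  then show ?case by (auto simp: globular_def in_hom span_run_iso)
next
  case (17 \<phi> r r')
  then show ?case by (intro cell_eqI) (auto simp: in_hom)
next
  case (18 r s t)
  then show ?case by (auto simp: globular_def in_hom span_asc_iso)
next
  case (19 \<phi> r r' \<psi> s s' \<chi> t t')
  then have c: "\<phi> \<in> Ar (span_sqs V)" "\<psi> \<in> Ar (span_sqs V)" "\<chi> \<in> Ar (span_sqs V)"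
    "r = csrc \<phi>" "s = csrc \<psi>" "t = csrc \<chi>" "r' = ctgt \<phi>" "s' = ctgt \<psi>" "t' = ctgt \<chi>"
    "cleft \<psi> = cright \<phi>" "cleft \<chi> = cright \<psi>"
    by (auto simp: in_hom)
  note [simp] = c span_cell_match[OF c(1,2,10)] span_cell_match[OF c(2,3,11)]
  \<comment> \<open>The first component of the outer pullback lies itself in a pullback, so it is
    compared separately.\<close>
  have "pb1 V (rleg (span_cmp V s' r')) (lleg t') \<bullet> cmor (\<chi> \<star>\<^bsub>Span V\<^esub> (\<psi> \<star>\<^bsub>Span V\<^esub> \<phi>)) \<bullet> cmor (asc (Span V) t s r)
     = pb1 V (rleg (span_cmp V s' r')) (lleg t') \<bullet> cmor (asc (Span V) t' s' r') \<bullet> cmor (\<chi> \<star>\<^bsub>Span V\<^esub> \<psi> \<star>\<^bsub>Span V\<^esub> \<phi>)"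
    by (rule pb_ext[of "rleg r'" "lleg s'"]) simp_all
  then show ?case
    by (intro cell_eqI; simp?) (rule pb_ext[of "rleg (span_cmp V s' r')" "lleg t'"]; simp)
next
  case (20 r s)
  then have [simp]: "lleg r \<in> Ar V" "rleg r \<in> Ar V" "src V (rleg r) = src V (lleg r)"
    "lleg s \<in> Ar V" "rleg s \<in> Ar V" "src V (rleg s) = src V (lleg s)" "tgt V (lleg s) = tgt V (rleg r)"
    by simp_all
  show ?case
    by (rule cell_eqI; simp?) (rule pb_ext[of "rleg r" "lleg s"]; simp)
next
  case (21 q r s t)
  then have [simp]: "lleg q \<in> Ar V" "rleg q \<in> Ar V" "src V (rleg q) = src V (lleg q)"
    "lleg r \<in> Ar V" "rleg r \<in> Ar V" "src V (rleg r) = src V (lleg r)" "tgt V (lleg r) = tgt V (rleg q)"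
    "lleg s \<in> Ar V" "rleg s \<in> Ar V" "src V (rleg s) = src V (lleg s)" "tgt V (lleg s) = tgt V (rleg r)"
    "lleg t \<in> Ar V" "rleg t \<in> Ar V" "src V (rleg t) = src V (lleg t)" "tgt V (lleg t) = tgt V (rleg s)"
    by simp_all
  show ?case
    \<comment> \<open>The target is a threefold iterated pullback; one use of \<open>pb_ext\<close>
      per level reduces the pentagon to components in the apices of \<open>q\<close>,
      \<open>r\<close>, \<open>s\<close> and \<open>t\<close>.\<close>
    by ((rule cell_eqI; simp?), (rule pb_ext[of "rleg (span_cmp V s (span_cmp V r q))" "lleg t"]; simp?),
        (rule pb_ext[of "rleg (span_cmp V r q)" "lleg s"]; simp?), (rule pb_ext[of "rleg q" "lleg r"]; simp))
qed simp_all

end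


section \<open>Matrices\<close>

lemma Sets_simps [simp]:
  "X \<in> Ob (Sets \<kappa>) \<longleftrightarrow> |X| <o \<kappa>" "src (Sets \<kappa>) = ssrc" "tgt (Sets \<kappa>) = stgt"
  "ssrc (idt (Sets \<kappa>) X) = X" "stgt (idt (Sets \<kappa>) X) = X" "x \<in> X \<Longrightarrow> sapp (idt (Sets \<kappa>) X) x = x"
  "ssrc (g \<cdot>\<^bsub>Sets \<kappa>\<^esub> f) = ssrc f" "stgt (g \<cdot>\<^bsub>Sets \<kappa>\<^esub> f) = stgt g"
  "x \<in> ssrc f \<Longrightarrow> sapp (g \<cdot>\<^bsub>Sets \<kappa>\<^esub> f) x = sapp g (sapp f x)"
  by (simp_all add: Sets_def)

lemma SetsI:
  assumes "|ssrc f| <o \<kappa>" "|stgt f| <o \<kappa>" "\<And>x. x \<in> ssrc f \<Longrightarrow> sapp f x \<in> stgt f" "sapp f \<in> extensional (ssrc f)"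
  shows "f \<in> Ar (Sets \<kappa>)"
  using assms by (simp add: Sets_def PiE_iff)

lemma Sets_small:
  assumes "f \<in> Ar (Sets \<kappa>)"
  shows "ssrc f = X \<Longrightarrow> |X| <o \<kappa>" "stgt f = X \<Longrightarrow> |X| <o \<kappa>"
  using assms by (simp_all add: Sets_def)

lemma sapp_in: "\<lbrakk>f \<in> Ar (Sets \<kappa>); x \<in> ssrc f; stgt f = Y\<rbrakk> \<Longrightarrow> sapp f x \<in> Y"
  by (simp add: Sets_def PiE_iff)

lemma setmap_eqI:
  assumes "f \<in> Ar (Sets \<kappa>)" "g \<in> Ar (Sets \<kappa>)" "ssrc f = ssrc g" "stgt f = stgt g"
    "\<And>x. x \<in> ssrc f \<Longrightarrow> sapp f x = sapp g x"
  shows "f = g"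
proof -
  have "sapp f = sapp g"
    by (rule extensionalityI[of _ "ssrc f"]) (use assms in \<open>simp_all add: Sets_def PiE_iff\<close>)
  with assms show ?thesis by simp
qed

lemma Sets_category: "category (Sets \<kappa>)"
proof -
  have i: "idt (Sets \<kappa>) X \<in> Ar (Sets \<kappa>)" if "|X| <o \<kappa>" for X :: "'a set"
    by (rule SetsI) (use that in \<open>simp_all add: Sets_def\<close>)
  have c: "g \<cdot>\<^bsub>Sets \<kappa>\<^esub> f \<in> Ar (Sets \<kappa>)" if "f \<in> Ar (Sets \<kappa>)" "g \<in> Ar (Sets \<kappa>)" "ssrc g = stgt f"
    for f g :: "'a setmap"
    by (rule SetsI) (use that Sets_small[OF that(1)] Sets_small[OF that(2)] in \<open>simp_all add: Sets_def PiE_iff\<close>)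
  show ?thesis
  proof (unfold_locales, goal_cases)
    case (1 f) then show ?case by (simp add: Sets_small)
  next
    case (2 f) then show ?case by (simp add: Sets_small)
  next
    case (3 a) then show ?case by (simp add: in_hom i)
  next
    case (4 f a b g d) then show ?case by (simp add: in_hom c)
  next
    case (5 f a b)
    then have "f \<in> Ar (Sets \<kappa>)" "ssrc f = a" "stgt f = b" "|b| <o \<kappa>"
      using Sets_small[of f \<kappa>] by (auto simp: in_hom)
    then show ?case by (intro setmap_eqI[of _ \<kappa>] c i) (simp_all add: sapp_in[of f \<kappa>])
  next
    case (6 f a b)
    then have "f \<in> Ar (Sets \<kappa>)" "ssrc f = a" "stgt f = b" "|a| <o \<kappa>"
      using Sets_small[of f \<kappa>] by (auto simp: in_hom)
    then show ?case by (intro setmap_eqI[of _ \<kappa>] c i) (simp_all add: sapp_in[of f \<kappa>])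
  next
    case (7 f a b g d h e)
    then show ?case by (intro setmap_eqI[of _ \<kappa>] c) (simp_all add: in_hom sapp_in[of f \<kappa>])
  qed
qed

section \<open>Matrices and their cells\<close>

lemma matrixI:
  assumes "|mdom p| <o \<kappa>" "|mcod p| <o \<kappa>" "\<And>x y. \<lbrakk>x \<in> mdom p; y \<in> mcod p\<rbrakk> \<Longrightarrow> ment p x y \<in> Ob V"
    "ment p \<in> extensional (mdom p)" "\<And>x. x \<in> mdom p \<Longrightarrow> ment p x \<in> extensional (mcod p)"
  shows "p \<in> matrices \<kappa> V"
  using assms by (simp add: matrices_def PiE_iff)

lemma matrix_simps:
  assumes "p \<in> matrices \<kappa> V"
  shows "|mdom p| <o \<kappa>" "|mcod p| <o \<kappa>" "\<lbrakk>x \<in> mdom p; y \<in> mcod p\<rbrakk> \<Longrightarrow> ment p x y \<in> Ob V"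
  using assms by (simp_all add: matrices_def PiE_iff)

lemma mat_sqs_simps [simp]:
  "Ob (mat_sqs \<kappa> V) = matrices \<kappa> V" "src (mat_sqs \<kappa> V) = csrc" "tgt (mat_sqs \<kappa> V) = ctgt"
  "csrc (idt (mat_sqs \<kappa> V) p) = p" "ctgt (idt (mat_sqs \<kappa> V) p) = p"
  "cleft (idt (mat_sqs \<kappa> V) p) = idt (Sets \<kappa>) (mdom p)"
  "cright (idt (mat_sqs \<kappa> V) p) = idt (Sets \<kappa>) (mcod p)"
  "\<lbrakk>x \<in> mdom p; y \<in> mcod p\<rbrakk> \<Longrightarrow> cmor (idt (mat_sqs \<kappa> V) p) x y = idt V (ment p x y)"
  "csrc (\<psi> \<cdot>\<^bsub>mat_sqs \<kappa> V\<^esub> \<phi>) = csrc \<phi>" "ctgt (\<psi> \<cdot>\<^bsub>mat_sqs \<kappa> V\<^esub> \<phi>) = ctgt \<psi>"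
  "cleft (\<psi> \<cdot>\<^bsub>mat_sqs \<kappa> V\<^esub> \<phi>) = cleft \<psi> \<cdot>\<^bsub>Sets \<kappa>\<^esub> cleft \<phi>"
  "cright (\<psi> \<cdot>\<^bsub>mat_sqs \<kappa> V\<^esub> \<phi>) = cright \<psi> \<cdot>\<^bsub>Sets \<kappa>\<^esub> cright \<phi>"
  "\<lbrakk>x \<in> mdom (csrc \<phi>); y \<in> mcod (csrc \<phi>)\<rbrakk> \<Longrightarrow> cmor (\<psi> \<cdot>\<^bsub>mat_sqs \<kappa> V\<^esub> \<phi>) x y =
     cmor \<psi> (sapp (cleft \<phi>) x) (sapp (cright \<phi>) y) \<cdot>\<^bsub>V\<^esub> cmor \<phi> x y"
  by (simp_all add: mat_sqs_def)

lemma cmor_mat_cmp: "cmor (\<psi> \<cdot>\<^bsub>mat_sqs \<kappa> V\<^esub> \<phi>) = (\<lambda>x\<in>mdom (csrc \<phi>). \<lambda>y\<in>mcod (csrc \<phi>).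
     cmor \<psi> (sapp (cleft \<phi>) x) (sapp (cright \<phi>) y) \<cdot>\<^bsub>V\<^esub> cmor \<phi> x y)"
  and cmor_mat_idt: "cmor (idt (mat_sqs \<kappa> V) p) = (\<lambda>x\<in>mdom p. \<lambda>y\<in>mcod p. idt V (ment p x y))"
  by (simp_all add: mat_sqs_def)

lemma mat_unit_simps [simp]:
  "mdom (mat_unit V X) = X" "mcod (mat_unit V X) = X"
  "\<lbrakk>x \<in> X; x' \<in> X\<rbrakk> \<Longrightarrow> ment (mat_unit V X) x x' = fst (copower V (truth (x = x')))"
  by (simp_all add: mat_unit_def)

lemma mat_cmp_simps [simp]:
  "mdom (mat_cmp V q p) = mdom p" "mcod (mat_cmp V q p) = mcod q"
  "\<lbrakk>x \<in> mdom p; z \<in> mcod q\<rbrakk> \<Longrightarrow> ment (mat_cmp V q p) x z = fst (mat_sum V q p x z)"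
  by (simp_all add: mat_cmp_def)

lemma Mat_simps [simp]:
  "vert (Mat \<kappa> V) = Sets \<kappa>" "sqs (Mat \<kappa> V) = mat_sqs \<kappa> V" "hdom (Mat \<kappa> V) = mdom" "hcod (Mat \<kappa> V) = mcod"
  "cdom (Mat \<kappa> V) = cleft" "ccod (Mat \<kappa> V) = cright"
  "hunit (Mat \<kappa> V) = mat_unit V" "hcmp (Mat \<kappa> V) = mat_cmp V"
  by (simp_all add: Mat_def)

lemma mat_cell_simps [simp]:
  "csrc (cunit (Mat \<kappa> V) f) = mat_unit V (ssrc f)" "ctgt (cunit (Mat \<kappa> V) f) = mat_unit V (stgt f)"
  "cleft (cunit (Mat \<kappa> V) f) = f" "cright (cunit (Mat \<kappa> V) f) = f"
  "csrc (\<psi> \<star>\<^bsub>Mat \<kappa> V\<^esub> \<phi>) = mat_cmp V (csrc \<psi>) (csrc \<phi>)"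
  "ctgt (\<psi> \<star>\<^bsub>Mat \<kappa> V\<^esub> \<phi>) = mat_cmp V (ctgt \<psi>) (ctgt \<phi>)"
  "cleft (\<psi> \<star>\<^bsub>Mat \<kappa> V\<^esub> \<phi>) = cleft \<phi>" "cright (\<psi> \<star>\<^bsub>Mat \<kappa> V\<^esub> \<phi>) = cright \<psi>"
  "csrc (lun (Mat \<kappa> V) p) = mat_cmp V (mat_unit V (mcod p)) p" "ctgt (lun (Mat \<kappa> V) p) = p"
  "cleft (lun (Mat \<kappa> V) p) = idt (Sets \<kappa>) (mdom p)" "cright (lun (Mat \<kappa> V) p) = idt (Sets \<kappa>) (mcod p)"
  "csrc (run (Mat \<kappa> V) p) = mat_cmp V p (mat_unit V (mdom p))" "ctgt (run (Mat \<kappa> V) p) = p"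
  "cleft (run (Mat \<kappa> V) p) = idt (Sets \<kappa>) (mdom p)" "cright (run (Mat \<kappa> V) p) = idt (Sets \<kappa>) (mcod p)"
  "csrc (asc (Mat \<kappa> V) t s r) = mat_cmp V (mat_cmp V t s) r"
  "ctgt (asc (Mat \<kappa> V) t s r) = mat_cmp V t (mat_cmp V s r)"
  "cleft (asc (Mat \<kappa> V) t s r) = idt (Sets \<kappa>) (mdom r)"
  "cright (asc (Mat \<kappa> V) t s r) = idt (Sets \<kappa>) (mcod t)"
  by (simp_all add: Mat_def)

context distributive_lex
begin

sublocale Sets: category "Sets \<kappa> :: ('a set, 'a setmap) cat"
  by (rule Sets_category)

lemmas Sets_matrix_simps [simp] = sapp_in[of _ \<kappa>] matrix_simps[of _ \<kappa> V]

text \<open>Cells of matrices are defined by nested restricted abstractions. Matching this form in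
  the first premise takes care of extensionality, so that only the entries \<open>k x y\<close> have
  to be typed.\<close>

lemma mat_cellI:
  assumes "cmor \<phi> = (\<lambda>x\<in>A. \<lambda>y\<in>B. k x y)" "mdom (csrc \<phi>) = A" "mcod (csrc \<phi>) = B"
    "csrc \<phi> \<in> matrices \<kappa> V" "ctgt \<phi> \<in> matrices \<kappa> V"
    "cleft \<phi> \<in> Ar (Sets \<kappa>)" "ssrc (cleft \<phi>) = A" "stgt (cleft \<phi>) = mdom (ctgt \<phi>)"
    "cright \<phi> \<in> Ar (Sets \<kappa>)" "ssrc (cright \<phi>) = B" "stgt (cright \<phi>) = mcod (ctgt \<phi>)"
    "\<And>x y. \<lbrakk>x \<in> A; y \<in> B\<rbrakk> \<Longrightarrow> k x y \<in> Ar V \<and> src V (k x y) = ment (csrc \<phi>) x y \<and>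
      tgt V (k x y) = ment (ctgt \<phi>) (sapp (cleft \<phi>) x) (sapp (cright \<phi>) y)"
  shows "\<phi> \<in> Ar (mat_sqs \<kappa> V)"
  using assms by (simp add: mat_sqs_def in_hom)

lemma mat_cell_unfold:
  assumes "\<phi> \<in> Ar (mat_sqs \<kappa> V)"
  shows "csrc \<phi> \<in> matrices \<kappa> V" "ctgt \<phi> \<in> matrices \<kappa> V"
    "cleft \<phi> \<in> Ar (Sets \<kappa>)" "ssrc (cleft \<phi>) = mdom (csrc \<phi>)" "stgt (cleft \<phi>) = mdom (ctgt \<phi>)"
    "cright \<phi> \<in> Ar (Sets \<kappa>)" "ssrc (cright \<phi>) = mcod (csrc \<phi>)" "stgt (cright \<phi>) = mcod (ctgt \<phi>)"
    "\<lbrakk>x \<in> mdom (csrc \<phi>); y \<in> mcod (csrc \<phi>)\<rbrakk> \<Longrightarrow> cmor \<phi> x y \<in> Ar V"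
    "\<lbrakk>x \<in> mdom (csrc \<phi>); y \<in> mcod (csrc \<phi>)\<rbrakk> \<Longrightarrow> src V (cmor \<phi> x y) = ment (csrc \<phi>) x y"
    "\<lbrakk>x \<in> mdom (csrc \<phi>); y \<in> mcod (csrc \<phi>)\<rbrakk> \<Longrightarrow> tgt V (cmor \<phi> x y) = ment (ctgt \<phi>) (sapp (cleft \<phi>) x) (sapp (cright \<phi>) y)"
    and mat_cell_extensional: "cmor \<phi> \<in> extensional (mdom (csrc \<phi>))"
      "x \<in> mdom (csrc \<phi>) \<Longrightarrow> cmor \<phi> x \<in> extensional (mcod (csrc \<phi>))"
  using assms by (simp_all add: mat_sqs_def in_hom PiE_iff)

declare mat_cell_unfold [simp]

lemma mat_cell_eqI:
  assumes "\<phi> \<in> Ar (mat_sqs \<kappa> V)" "\<psi> \<in> Ar (mat_sqs \<kappa> V)" "csrc \<phi> = csrc \<psi>" "ctgt \<phi> = ctgt \<psi>"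
    "cleft \<phi> = cleft \<psi>" "cright \<phi> = cright \<psi>"
    "\<And>x y. \<lbrakk>x \<in> mdom (csrc \<phi>); y \<in> mcod (csrc \<phi>)\<rbrakk> \<Longrightarrow> cmor \<phi> x y = cmor \<psi> x y"
  shows "\<phi> = \<psi>"
proof (rule cell_eqI)
  show "cmor \<phi> = cmor \<psi>"
  proof (rule extensionalityI[of _ "mdom (csrc \<phi>)"])
    fix x assume x: "x \<in> mdom (csrc \<phi>)"
    show "cmor \<phi> x = cmor \<psi> x"
      by (rule extensionalityI[of _ "mcod (csrc \<phi>)"])
        (use x assms mat_cell_extensional(2)[of \<phi> x] mat_cell_extensional(2)[of \<psi> x] in simp_all)
  qed (use assms mat_cell_extensional(1)[of \<phi>] mat_cell_extensional(1)[of \<psi>] in simp_all)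
qed (use assms in simp_all)

lemma mat_cell_match:
  assumes "\<phi> \<in> Ar (mat_sqs \<kappa> V)" "\<psi> \<in> Ar (mat_sqs \<kappa> V)" "cleft \<psi> = cright \<phi>"
  shows "mdom (csrc \<psi>) = mcod (csrc \<phi>)" "mdom (ctgt \<psi>) = mcod (ctgt \<phi>)"
  using mat_cell_unfold(4,5)[OF assms(2)] mat_cell_unfold(7,8)[OF assms(1)] assms(3) by simp_all

lemma mat_cmp_cell [simp]:
  assumes "\<phi> \<in> Ar (mat_sqs \<kappa> V)" "\<psi> \<in> Ar (mat_sqs \<kappa> V)" "csrc \<psi> = ctgt \<phi>"
  shows "\<psi> \<cdot>\<^bsub>mat_sqs \<kappa> V\<^esub> \<phi> \<in> Ar (mat_sqs \<kappa> V)"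
  by (rule mat_cellI[OF cmor_mat_cmp]) (use assms in simp_all)

lemma mat_idt_cell [simp]: "p \<in> matrices \<kappa> V \<Longrightarrow> idt (mat_sqs \<kappa> V) p \<in> Ar (mat_sqs \<kappa> V)"
  by (rule mat_cellI[OF cmor_mat_idt]) simp_all

lemma mat_category: "category (mat_sqs \<kappa> V)"
proof (unfold_locales, goal_cases)
  case (5 f a b) then show ?case by (intro mat_cell_eqI) (auto simp: in_hom)
next
  case (6 f a b) then show ?case by (intro mat_cell_eqI) (auto simp: in_hom)
next
  case (7 f a b g c h d) then show ?case by (intro mat_cell_eqI) (auto simp: in_hom)
qed (auto simp: in_hom)

lemma mat_unit_matrix [simp]: "|X| <o \<kappa> \<Longrightarrow> mat_unit V X \<in> matrices \<kappa> V"
  by (rule matrixI) (simp_all, simp_all add: mat_unit_def)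

section \<open>Arrows out of composites of matrices\<close>

context
  fixes q p :: "('a, 'o) matrix" and x z :: 'a
  assumes p: "p \<in> matrices \<kappa> V" and q: "q \<in> matrices \<kappa> V" and qp: "mdom q = mcod p"
    and x: "x \<in> mdom p" and z: "z \<in> mcod q"
begin

lemma mat_sum_coproduct:
  "is_coproduct V (mcod p) (\<lambda>y. prd V (ment q y z) (ment p x y)) (mat_sum V q p x z)"
  unfolding mat_sum_def by (rule cop_coproduct) (use p q qp x z in simp_all)

lemmas mat_sum_simps = coprod_inj[OF mat_sum_coproduct]

lemma mat_sum_ext:
  assumes h: "h \<in> Ar V" "k \<in> Ar V" "src V h = fst (mat_sum V q p x z)" "src V k = fst (mat_sum V q p x z)"
    "tgt V h = tgt V k"
    and eq: "\<And>y f g. \<lbrakk>y \<in> mcod p; f \<in> Ar V; g \<in> Ar V; src V f = src V g; tgt V f = ment q y z; tgt V g = ment p x y\<rbrakk>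
      \<Longrightarrow> h \<bullet> snd (mat_sum V q p x z) y \<bullet> tup V f g = k \<bullet> snd (mat_sum V q p x z) y \<bullet> tup V f g"
  shows "h = k"
proof (rule coprod_ext[OF mat_sum_coproduct h])
  fix y assume y: "y \<in> mcod p"
  then have "ment q y z \<in> Ob V" "ment p x y \<in> Ob V"
    using p q qp x z by simp_all
  then show "h \<bullet> snd (mat_sum V q p x z) y = k \<bullet> snd (mat_sum V q p x z) y"
    using eq[OF y, of "prj1 V (ment q y z) (ment p x y)" "prj2 V (ment q y z) (ment p x y)"] mat_sum_simps y h
    by simp
qed

lemma mat_sum_cotuple:
  assumes "I = mcod p" "d \<in> Ob V"
    "\<And>y. y \<in> mcod p \<Longrightarrow> k y \<in> Ar V \<and> src V (k y) = prd V (ment q y z) (ment p x y) \<and> tgt V (k y) = d"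
  shows "cotuple V I (mat_sum V q p x z) d k \<in> Ar V"
    "src V (cotuple V I (mat_sum V q p x z) d k) = fst (mat_sum V q p x z)"
    "tgt V (cotuple V I (mat_sum V q p x z) d k) = d"
    "\<lbrakk>y \<in> mcod p; h \<in> Ar V; tgt V h = prd V (ment q y z) (ment p x y)\<rbrakk>
       \<Longrightarrow> cotuple V I (mat_sum V q p x z) d k \<bullet> snd (mat_sum V q p x z) y \<bullet> h = k y \<bullet> h"
proof -
  note * = coprod_cotuple[OF mat_sum_coproduct assms(2), where k = k, OF assms(3)]
  show "cotuple V I (mat_sum V q p x z) d k \<in> Ar V"
    "src V (cotuple V I (mat_sum V q p x z) d k) = fst (mat_sum V q p x z)"
    "tgt V (cotuple V I (mat_sum V q p x z) d k) = d"
    using * assms(1) by simp_all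
  show "\<lbrakk>y \<in> mcod p; h \<in> Ar V; tgt V h = prd V (ment q y z) (ment p x y)\<rbrakk>
       \<Longrightarrow> cotuple V I (mat_sum V q p x z) d k \<bullet> snd (mat_sum V q p x z) y \<bullet> h = k y \<bullet> h"
    using * mat_sum_simps assms(1) by (intro extend_cmp) simp_all
qed

end

declare mat_sum_simps [simp]

lemma mat_cmp_matrix [simp]:
  "\<lbrakk>p \<in> matrices \<kappa> V; q \<in> matrices \<kappa> V; mdom q = mcod p\<rbrakk> \<Longrightarrow> mat_cmp V q p \<in> matrices \<kappa> V"
  by (rule matrixI) (simp_all, simp_all add: mat_cmp_def)


text \<open>By distributivity the outer summands are themselves sums of threefold products, so it is
  enough to test on elements \<open>f\<close>, \<open>g\<close> and \<open>e\<close> of the three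
  matrices, placed in the left bracketing.\<close>

lemma mat_sum_ext_left:
  assumes m: "r \<in> matrices \<kappa> V" "s \<in> matrices \<kappa> V" "t \<in> matrices \<kappa> V" "mdom s = mcod r" "mdom t = mcod s"
      "w \<in> mdom r" "z \<in> mcod t"
    and h: "h \<in> Ar V" "k \<in> Ar V" "src V h = fst (mat_sum V (mat_cmp V t s) r w z)"
      "src V k = fst (mat_sum V (mat_cmp V t s) r w z)" "tgt V h = tgt V k"
    and eq: "\<And>x y f g e. \<lbrakk>x \<in> mcod r; y \<in> mcod s; f \<in> Ar V; g \<in> Ar V; e \<in> Ar V; src V f = src V e; src V g = src V e;
        tgt V f = ment t y z; tgt V g = ment s x y; tgt V e = ment r w x\<rbrakk>
      \<Longrightarrow> h \<bullet> snd (mat_sum V (mat_cmp V t s) r w z) x \<bullet> tup V (snd (mat_sum V t s x z) y \<bullet> tup V f g) e =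
          k \<bullet> snd (mat_sum V (mat_cmp V t s) r w z) x \<bullet> tup V (snd (mat_sum V t s x z) y \<bullet> tup V f g) e"
  shows "h = k"
proof (rule coprod_ext[OF mat_sum_coproduct h])
  fix x assume x: "x \<in> mcod r"
  note [simp] = m h x
  let ?j = "snd (mat_sum V (mat_cmp V t s) r w z) x"
  show "h \<bullet> ?j = k \<bullet> ?j"
  proof (rule dist_ext_left[OF _ mat_sum_coproduct])
    fix y f e assume *: "y \<in> mcod s" "f \<in> Ar V" "e \<in> Ar V" "src V f = src V e"
      "tgt V f = prd V (ment t y z) (ment s x y)" "tgt V e = ment r w x"
    have [simp]: "ment t y z \<in> Ob V" "ment s x y \<in> Ob V"
      using * by simp_all
    show "(h \<bullet> ?j) \<bullet> tup V (snd (mat_sum V t s x z) y \<bullet> f) e = (k \<bullet> ?j) \<bullet> tup V (snd (mat_sum V t s x z) y \<bullet> f) e"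
      using eq[of x y "prj1 V (ment t y z) (ment s x y) \<bullet> f" "prj2 V (ment t y z) (ment s x y) \<bullet> f" e] * by simp
  qed simp_all
qed (use m in simp_all)

text \<open>The counterpart for the right bracketing, which is the source of the inverse of the
  associator.\<close>

lemma mat_sum_ext_right:
  assumes m: "r \<in> matrices \<kappa> V" "s \<in> matrices \<kappa> V" "t \<in> matrices \<kappa> V" "mdom s = mcod r" "mdom t = mcod s"
      "w \<in> mdom r" "z \<in> mcod t"
    and h: "h \<in> Ar V" "k \<in> Ar V" "src V h = fst (mat_sum V t (mat_cmp V s r) w z)"
      "src V k = fst (mat_sum V t (mat_cmp V s r) w z)" "tgt V h = tgt V k"
    and eq: "\<And>x y f g e. \<lbrakk>x \<in> mcod r; y \<in> mcod s; f \<in> Ar V; g \<in> Ar V; e \<in> Ar V; src V f = src V e; src V g = src V e;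
        tgt V f = ment t y z; tgt V g = ment s x y; tgt V e = ment r w x\<rbrakk>
      \<Longrightarrow> h \<bullet> snd (mat_sum V t (mat_cmp V s r) w z) y \<bullet> tup V f (snd (mat_sum V s r w y) x \<bullet> tup V g e) =
          k \<bullet> snd (mat_sum V t (mat_cmp V s r) w z) y \<bullet> tup V f (snd (mat_sum V s r w y) x \<bullet> tup V g e)"
  shows "h = k"
proof (rule coprod_ext[OF mat_sum_coproduct h])
  fix y assume "y \<in> mcod (mat_cmp V s r)"
  then have y: "y \<in> mcod s" by simp
  note [simp] = m h y
  let ?j = "snd (mat_sum V t (mat_cmp V s r) w z) y"
  show "h \<bullet> ?j = k \<bullet> ?j"
  proof (rule dist_ext_right[OF _ mat_sum_coproduct])
    fix x f g assume *: "x \<in> mcod r" "f \<in> Ar V" "g \<in> Ar V" "src V f = src V g"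
      "tgt V f = ment t y z" "tgt V g = prd V (ment s x y) (ment r w x)"
    have [simp]: "ment r w x \<in> Ob V" "ment s x y \<in> Ob V"
      using * by simp_all
    show "(h \<bullet> ?j) \<bullet> tup V f (snd (mat_sum V s r w y) x \<bullet> g) = (k \<bullet> ?j) \<bullet> tup V f (snd (mat_sum V s r w y) x \<bullet> g)"
      using eq[of x y f "prj1 V (ment s x y) (ment r w x) \<bullet> g" "prj2 V (ment s x y) (ment r w x) \<bullet> g"] * by simp
  qed simp_all
qed (use m in simp_all)

text \<open>This serves the pentagon, where the sum over \<open>y\<close> sits inside two products.
  It has to be distributed over the factor from \<open>r\<close> by \<open>dist_left\<close> and
  over the factor from \<open>q\<close> by \<open>dist_ext_left\<close>, after the sum over
  \<open>x\<close> has been treated.\<close>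

lemma mat_sum_ext_left_left:
  assumes m: "q \<in> matrices \<kappa> V" "r \<in> matrices \<kappa> V" "s \<in> matrices \<kappa> V" "t \<in> matrices \<kappa> V"
      "mdom r = mcod q" "mdom s = mcod r" "mdom t = mcod s" "v \<in> mdom q" "z \<in> mcod t"
    and h: "h \<in> Ar V" "k \<in> Ar V" "src V h = fst (mat_sum V (mat_cmp V (mat_cmp V t s) r) q v z)"
      "src V k = fst (mat_sum V (mat_cmp V (mat_cmp V t s) r) q v z)" "tgt V h = tgt V k"
    and eq: "\<And>w x y f g e d. \<lbrakk>w \<in> mcod q; x \<in> mcod r; y \<in> mcod s; f \<in> Ar V; g \<in> Ar V; e \<in> Ar V; d \<in> Ar V;
        src V f = src V d; src V g = src V d; src V e = src V d;
        tgt V f = ment t y z; tgt V g = ment s x y; tgt V e = ment r w x; tgt V d = ment q v w\<rbrakk>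
      \<Longrightarrow> h \<bullet> snd (mat_sum V (mat_cmp V (mat_cmp V t s) r) q v z) w \<bullet>
            tup V (snd (mat_sum V (mat_cmp V t s) r w z) x \<bullet> tup V (snd (mat_sum V t s x z) y \<bullet> tup V f g) e) d =
          k \<bullet> snd (mat_sum V (mat_cmp V (mat_cmp V t s) r) q v z) w \<bullet>
            tup V (snd (mat_sum V (mat_cmp V t s) r w z) x \<bullet> tup V (snd (mat_sum V t s x z) y \<bullet> tup V f g) e) d"
  shows "h = k"
proof (rule coprod_ext[OF mat_sum_coproduct h])
  fix w assume w: "w \<in> mcod q"
  note [simp] = m h w
  let ?j = "snd (mat_sum V (mat_cmp V (mat_cmp V t s) r) q v z) w"
  show "h \<bullet> ?j = k \<bullet> ?j"
  proof (rule dist_ext_left[OF _ mat_sum_coproduct])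
    fix x a d assume *: "x \<in> mcod r" "a \<in> Ar V" "d \<in> Ar V" "src V a = src V d"
      "tgt V a = prd V (ment (mat_cmp V t s) x z) (ment r w x)" "tgt V d = ment q v w"
    note [simp] = *(1)
    let ?i = "snd (mat_sum V (mat_cmp V t s) r w z) x" and ?P = "prd V (fst (mat_sum V t s x z)) (ment r w x)"
    \<comment> \<open>\<open>?e\<close> has projections in place of the variable elements
      \<open>a\<close> and \<open>d\<close>. It starts at a product, to which the second
      distribution applies, and the given elements are put back at the end.\<close>
    let ?e = "?j \<bullet> tup V (?i \<bullet> prj1 V ?P (ment q v w)) (prj2 V ?P (ment q v w))"
    have c: "is_coproduct V (mcod s) (\<lambda>i. prd V (prd V (ment t i z) (ment s x i)) (ment r w x))
        (prd V (fst (mat_sum V t s x z)) (ment r w x),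
         \<lambda>i. pmap V (snd (mat_sum V t s x z) i) (idt V (ment r w x)))"
      by (rule dist_left[OF _ mat_sum_coproduct]) simp_all
    have "h \<bullet> ?e = k \<bullet> ?e"
    proof (rule dist_ext_left[OF _ c])
      fix y b c assume **: "y \<in> mcod s" "b \<in> Ar V" "c \<in> Ar V" "src V b = src V c"
        "tgt V b = prd V (prd V (ment t y z) (ment s x y)) (ment r w x)" "tgt V c = ment q v w"
      have [simp]: "ment t y z \<in> Ob V" "ment s x y \<in> Ob V"
        using ** by simp_all
      let ?b = "prj1 V (prd V (ment t y z) (ment s x y)) (ment r w x) \<bullet> b"
      show "(h \<bullet> ?e) \<bullet> tup V (snd (prd V (fst (mat_sum V t s x z)) (ment r w x),
            \<lambda>i. pmap V (snd (mat_sum V t s x z) i) (idt V (ment r w x))) y \<bullet> b) c =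
          (k \<bullet> ?e) \<bullet> tup V (snd (prd V (fst (mat_sum V t s x z)) (ment r w x),
            \<lambda>i. pmap V (snd (mat_sum V t s x z) i) (idt V (ment r w x))) y \<bullet> b) c"
        using eq[of w x y "prj1 V (ment t y z) (ment s x y) \<bullet> ?b" "prj2 V (ment t y z) (ment s x y) \<bullet> ?b"
            "prj2 V (prd V (ment t y z) (ment s x y)) (ment r w x) \<bullet> b" c] **
        by (simp add: pmap_def)
    qed simp_all
    then have "(h \<bullet> ?e) \<bullet> tup V a d = (k \<bullet> ?e) \<bullet> tup V a d"
      by simp
    then show "(h \<bullet> ?j) \<bullet> tup V (?i \<bullet> a) d = (k \<bullet> ?j) \<bullet> tup V (?i \<bullet> a) d"
      using * by simp
  qed simp_all
qed (use m in simp_all)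

text \<open>Off the diagonal, \<open>f\<close> maps to an initial object, and strictness equates any
  two parallel arrows out of its source. On the diagonal, \<open>f\<close> factors through
  \<open>pt\<close>. So only the summand \<open>y = z\<close> and the element \<open>g\<close> of
  \<open>p\<close> remain.\<close>

lemma unit_sum_ext_left:
  assumes m: "p \<in> matrices \<kappa> V" "x \<in> mdom p" "z \<in> mcod p" "Y = mcod p"
    and h: "h \<in> Ar V" "k \<in> Ar V" "src V h = fst (mat_sum V (mat_unit V Y) p x z)"
      "src V k = fst (mat_sum V (mat_unit V Y) p x z)" "tgt V h = tgt V k"
    and eq: "\<And>g. \<lbrakk>g \<in> Ar V; tgt V g = ment p x z\<rbrakk> \<Longrightarrow>
      h \<bullet> snd (mat_sum V (mat_unit V Y) p x z) z \<bullet> tup V (pt \<bullet> bang (src V g)) g =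
      k \<bullet> snd (mat_sum V (mat_unit V Y) p x z) z \<bullet> tup V (pt \<bullet> bang (src V g)) g"
  shows "h = k"
proof (rule mat_sum_ext[OF _ _ _ _ _ h])
  fix y f g assume *: "y \<in> mcod p" "f \<in> Ar V" "g \<in> Ar V" "src V f = src V g"
    "tgt V f = ment (mat_unit V Y) y z" "tgt V g = ment p x y"
  show "h \<bullet> snd (mat_sum V (mat_unit V Y) p x z) y \<bullet> tup V f g =
     k \<bullet> snd (mat_sum V (mat_unit V Y) p x z) y \<bullet> tup V f g"
  proof (cases "y = z")
    case True
    then show ?thesis using eq[of g] eq_pt_bang[of f] * m by simp
  next
    case False
    then show ?thesis
      by (intro strict_initial[of f]) (use * m h in simp_all)
  qed
qed (use m in simp_all)

lemma unit_sum_ext_right: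
  assumes m: "p \<in> matrices \<kappa> V" "x \<in> mdom p" "z \<in> mcod p" "Y = mdom p"
    and h: "h \<in> Ar V" "k \<in> Ar V" "src V h = fst (mat_sum V p (mat_unit V Y) x z)"
      "src V k = fst (mat_sum V p (mat_unit V Y) x z)" "tgt V h = tgt V k"
    and eq: "\<And>f. \<lbrakk>f \<in> Ar V; tgt V f = ment p x z\<rbrakk> \<Longrightarrow>
      h \<bullet> snd (mat_sum V p (mat_unit V Y) x z) x \<bullet> tup V f (pt \<bullet> bang (src V f)) =
      k \<bullet> snd (mat_sum V p (mat_unit V Y) x z) x \<bullet> tup V f (pt \<bullet> bang (src V f))"
  shows "h = k"
proof (rule mat_sum_ext[OF _ _ _ _ _ h])
  fix y f g assume *: "y \<in> mcod (mat_unit V Y)" "f \<in> Ar V" "g \<in> Ar V" "src V f = src V g"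
    "tgt V f = ment p y z" "tgt V g = ment (mat_unit V Y) x y"
  show "h \<bullet> snd (mat_sum V p (mat_unit V Y) x z) y \<bullet> tup V f g =
     k \<bullet> snd (mat_sum V p (mat_unit V Y) x z) y \<bullet> tup V f g"
  proof (cases "x = y")
    case True
    then show ?thesis using eq[of f] eq_pt_bang[of g] * m by simp
  next
    case False
    then show ?thesis
      by (intro strict_initial[of g]) (use * m h in simp_all)
  qed
qed (use m in simp_all)

section \<open>The structural cells of matrices, evaluated on generalized elements\<close>

lemma cmor_cunit_mat: "cmor (cunit (Mat \<kappa> V) f) = (\<lambda>x\<in>ssrc f. \<lambda>x'\<in>ssrc f.
    cotuple V (truth (x = x')) (copower V (truth (x = x')))
      (fst (copower V (truth (sapp f x = sapp f x')))) (snd (copower V (truth (sapp f x = sapp f x')))))"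
  by (simp add: Mat_def Let_def)

text \<open>The entries exist because \<open>x = x'\<close> implies equality of the images; for
  distinct \<open>x\<close> and \<open>x'\<close> they start at an initial object.\<close>

lemma cunit_mat_cell [simp]:
  assumes "f \<in> Ar (Sets \<kappa>)"
  shows "cunit (Mat \<kappa> V) f \<in> Ar (mat_sqs \<kappa> V)"
  by (rule mat_cellI[OF cmor_cunit_mat])
    (use assms Sets_small[OF assms] in \<open>simp_all\<close>)

lemma cunit_mat_pt [simp]:
  assumes "f \<in> Ar (Sets \<kappa>)" "x \<in> ssrc f"
  shows "cmor (cunit (Mat \<kappa> V) f) x x \<bullet> pt = pt"
  using assms by (simp add: cmor_cunit_mat)

lemmas cunit_mat_pt' [simp] = cunit_mat_pt[THEN extend_cmp]

lemma cmor_ccmp_mat: "cmor (\<psi> \<star>\<^bsub>Mat \<kappa> V\<^esub> \<phi>) = (\<lambda>x\<in>mdom (csrc \<phi>). \<lambda>z\<in>mcod (csrc \<psi>).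
   cotuple V (mcod (csrc \<phi>)) (mat_sum V (csrc \<psi>) (csrc \<phi>) x z)
     (fst (mat_sum V (ctgt \<psi>) (ctgt \<phi>) (sapp (cleft \<phi>) x) (sapp (cright \<psi>) z)))
     (\<lambda>y. snd (mat_sum V (ctgt \<psi>) (ctgt \<phi>) (sapp (cleft \<phi>) x) (sapp (cright \<psi>) z)) (sapp (cright \<phi>) y)
       \<bullet> pmap V (cmor \<psi> y z) (cmor \<phi> x y)))"
  by (simp add: Mat_def Let_def)

text \<open>Horizontal composition acts componentwise on a pair of elements and moves the summation
  index along the common boundary. The axioms are checked with this rule instead of the
  cotuple.\<close>

lemma ccmp_mat_cell:
  assumes "\<phi> \<in> Ar (mat_sqs \<kappa> V)" "\<psi> \<in> Ar (mat_sqs \<kappa> V)" "cleft \<psi> = cright \<phi>"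
  shows "\<psi> \<star>\<^bsub>Mat \<kappa> V\<^esub> \<phi> \<in> Ar (mat_sqs \<kappa> V)"
    "\<lbrakk>p = csrc \<phi>; q = csrc \<psi>; x \<in> mdom p; z \<in> mcod q; y \<in> mcod p; f \<in> Ar V; g \<in> Ar V; src V f = src V g;
      tgt V f = ment q y z; tgt V g = ment p x y\<rbrakk> \<Longrightarrow>
      cmor (\<psi> \<star>\<^bsub>Mat \<kappa> V\<^esub> \<phi>) x z \<bullet> snd (mat_sum V q p x z) y \<bullet> tup V f g =
      snd (mat_sum V (ctgt \<psi>) (ctgt \<phi>) (sapp (cleft \<phi>) x) (sapp (cright \<psi>) z)) (sapp (cright \<phi>) y)
        \<bullet> tup V (cmor \<psi> y z \<bullet> f) (cmor \<phi> x y \<bullet> g)"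
proof -
  note m [simp] = mat_cell_match[OF assms]
  show "\<psi> \<star>\<^bsub>Mat \<kappa> V\<^esub> \<phi> \<in> Ar (mat_sqs \<kappa> V)"
    by (rule mat_cellI[OF cmor_ccmp_mat])
      (use assms in \<open>simp_all add: mat_sum_cotuple pmap_def\<close>)
  show "\<lbrakk>p = csrc \<phi>; q = csrc \<psi>; x \<in> mdom p; z \<in> mcod q; y \<in> mcod p; f \<in> Ar V; g \<in> Ar V; src V f = src V g;
      tgt V f = ment q y z; tgt V g = ment p x y\<rbrakk> \<Longrightarrow>
      cmor (\<psi> \<star>\<^bsub>Mat \<kappa> V\<^esub> \<phi>) x z \<bullet> snd (mat_sum V q p x z) y \<bullet> tup V f g =
      snd (mat_sum V (ctgt \<psi>) (ctgt \<phi>) (sapp (cleft \<phi>) x) (sapp (cright \<psi>) z)) (sapp (cright \<phi>) y)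
        \<bullet> tup V (cmor \<psi> y z \<bullet> f) (cmor \<phi> x y \<bullet> g)"
    using assms by (simp add: cmor_ccmp_mat mat_sum_cotuple pmap_def)
qed

declare ccmp_mat_cell [simp]


lemma lun_mat_cell:
  assumes p: "p \<in> matrices \<kappa> V"
  shows "lun (Mat \<kappa> V) p \<in> Ar (mat_sqs \<kappa> V)"
    "\<lbrakk>x \<in> mdom p; z \<in> mcod p; Y = mcod p; f \<in> Ar V; g \<in> Ar V; src V f = src V g;
      tgt V f = fst (copower V {()}); tgt V g = ment p x z\<rbrakk>
      \<Longrightarrow> cmor (lun (Mat \<kappa> V) p) x z \<bullet> snd (mat_sum V (mat_unit V Y) p x z) z \<bullet> tup V f g = g"
proof -
  let ?e = "\<lambda>y z. ment (mat_unit V (mcod p)) y z"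
  have c: "cmor (lun (Mat \<kappa> V) p) = (\<lambda>x\<in>mdom p. \<lambda>z\<in>mcod p.
          cotuple V (mcod p) (mat_sum V (mat_unit V (mcod p)) p x z) (ment p x z)
            (\<lambda>y. if y = z then prj2 V (?e y z) (ment p x y)
                 else the_arrow V (prd V (?e y z) (ment p x y)) (ment p x z)))"
    by (simp add: Mat_def Let_def)
  have k: "(if y = z then prj2 V (?e y z) (ment p x y)
                 else the_arrow V (prd V (?e y z) (ment p x y)) (ment p x z)) \<in> Ar V \<and>
      src V (if y = z then prj2 V (?e y z) (ment p x y)
                 else the_arrow V (prd V (?e y z) (ment p x y)) (ment p x z)) = prd V (?e y z) (ment p x y) \<and>
      tgt V (if y = z then prj2 V (?e y z) (ment p x y)
                 else the_arrow V (prd V (?e y z) (ment p x y)) (ment p x z)) = ment p x z"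
    if "x \<in> mdom p" "z \<in> mcod p" "y \<in> mcod p" for x y z
    \<comment> \<open>Off the diagonal the product projects to an initial object, whence the arrow
      out of it exists and is unique.\<close>
    using strict_initial_arrow[of "prj1 V (fst (copower V ({} :: unit set))) (ment p x y)" "ment p x z"] that p
    by (cases "y = z") simp_all
  note * = mat_sum_cotuple[OF _ _ _ _ _ refl _ k]
  show "lun (Mat \<kappa> V) p \<in> Ar (mat_sqs \<kappa> V)"
    by (rule mat_cellI[OF c]) (use p * in simp_all)
  show "\<lbrakk>x \<in> mdom p; z \<in> mcod p; Y = mcod p; f \<in> Ar V; g \<in> Ar V; src V f = src V g;
      tgt V f = fst (copower V {()}); tgt V g = ment p x z\<rbrakk>
      \<Longrightarrow> cmor (lun (Mat \<kappa> V) p) x z \<bullet> snd (mat_sum V (mat_unit V Y) p x z) z \<bullet> tup V f g = g"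
    using p by (simp add: c *)
qed

lemma run_mat_cell:
  assumes p: "p \<in> matrices \<kappa> V"
  shows "run (Mat \<kappa> V) p \<in> Ar (mat_sqs \<kappa> V)"
    "\<lbrakk>x \<in> mdom p; z \<in> mcod p; Y = mdom p; f \<in> Ar V; g \<in> Ar V; src V f = src V g;
      tgt V f = ment p x z; tgt V g = fst (copower V {()})\<rbrakk>
      \<Longrightarrow> cmor (run (Mat \<kappa> V) p) x z \<bullet> snd (mat_sum V p (mat_unit V Y) x z) x \<bullet> tup V f g = f"
proof -
  let ?e = "\<lambda>x y. ment (mat_unit V (mdom p)) x y"
  have c: "cmor (run (Mat \<kappa> V) p) = (\<lambda>x\<in>mdom p. \<lambda>z\<in>mcod p.
          cotuple V (mdom p) (mat_sum V p (mat_unit V (mdom p)) x z) (ment p x z)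
            (\<lambda>y. if y = x then prj1 V (ment p y z) (?e x y)
                 else the_arrow V (prd V (ment p y z) (?e x y)) (ment p x z)))"
    by (simp add: Mat_def Let_def)
  have k: "(if y = x then prj1 V (ment p y z) (?e x y)
                 else the_arrow V (prd V (ment p y z) (?e x y)) (ment p x z)) \<in> Ar V \<and>
      src V (if y = x then prj1 V (ment p y z) (?e x y)
                 else the_arrow V (prd V (ment p y z) (?e x y)) (ment p x z)) = prd V (ment p y z) (?e x y) \<and>
      tgt V (if y = x then prj1 V (ment p y z) (?e x y)
                 else the_arrow V (prd V (ment p y z) (?e x y)) (ment p x z)) = ment p x z"
    if "x \<in> mdom p" "z \<in> mcod p" "y \<in> mcod (mat_unit V (mdom p))" for x y z
    using strict_initial_arrow[of "prj2 V (ment p y z) (fst (copower V ({} :: unit set)))" "ment p x z"] that p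
    by (cases "y = x") (simp_all add: eq_commute[of x y])
  note * = mat_sum_cotuple[where p = "mat_unit V (mdom p)", OF _ _ _ _ _ _ _ k]
  show "run (Mat \<kappa> V) p \<in> Ar (mat_sqs \<kappa> V)"
    by (rule mat_cellI[OF c]) (use p * in simp_all)
  show "\<lbrakk>x \<in> mdom p; z \<in> mcod p; Y = mdom p; f \<in> Ar V; g \<in> Ar V; src V f = src V g;
      tgt V f = ment p x z; tgt V g = fst (copower V {()})\<rbrakk>
      \<Longrightarrow> cmor (run (Mat \<kappa> V) p) x z \<bullet> snd (mat_sum V p (mat_unit V Y) x z) x \<bullet> tup V f g = f"
    using p by (simp add: c, subst *(4)) simp_all
qed

declare lun_mat_cell [simp] run_mat_cell [simp]

text \<open>The nested cotuples amount to rebracketing a triple of elements, while \<open>x\<close>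
  and \<open>y\<close> exchange their places as outer and inner summation index. This evaluation
  replaces the definition from here on.\<close>

lemma asc_mat_cell:
  assumes m: "r \<in> matrices \<kappa> V" "s \<in> matrices \<kappa> V" "t \<in> matrices \<kappa> V" "mdom s = mcod r" "mdom t = mcod s"
  shows "asc (Mat \<kappa> V) t s r \<in> Ar (mat_sqs \<kappa> V)"
    "\<lbrakk>ts = mat_cmp V t s; w \<in> mdom r; z \<in> mcod t; x \<in> mcod r; y \<in> mcod s; f \<in> Ar V; g \<in> Ar V; e \<in> Ar V;
      src V f = src V e; src V g = src V e; tgt V f = ment t y z; tgt V g = ment s x y; tgt V e = ment r w x\<rbrakk>
     \<Longrightarrow> cmor (asc (Mat \<kappa> V) t s r) w z \<bullet> snd (mat_sum V ts r w z) x
           \<bullet> tup V (snd (mat_sum V t s x z) y \<bullet> tup V f g) e =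
         snd (mat_sum V t (mat_cmp V s r) w z) y \<bullet> tup V f (snd (mat_sum V s r w y) x \<bullet> tup V g e)"
proof -
  note [simp] = m
  let ?d = "\<lambda>w z. mat_sum V t (mat_cmp V s r) w z"
  let ?l = "\<lambda>w z x y. (snd (?d w z) y \<bullet> pmap V (idt V (ment t y z)) (snd (mat_sum V s r w y) x))
                                 \<bullet> pasc V (ment t y z) (ment s x y) (ment r w x)"
  let ?k = "\<lambda>w z x. cotuple V (mcod s) (prd V (fst (mat_sum V t s x z)) (ment r w x),
                           \<lambda>y. pmap V (snd (mat_sum V t s x z) y) (idt V (ment r w x))) (fst (?d w z)) (?l w z x)"
  have l: "?l w z x y \<in> Ar V \<and> src V (?l w z x y) = prd V (prd V (ment t y z) (ment s x y)) (ment r w x) \<and>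
      tgt V (?l w z x y) = fst (?d w z)"
    if "w \<in> mdom r" "z \<in> mcod t" "x \<in> mcod r" "y \<in> mcod s" for w z x y
    using that by (simp add: pmap_def pasc_def)
  have k: "?k w z x \<in> Ar V" "src V (?k w z x) = prd V (fst (mat_sum V t s x z)) (ment r w x)"
      "tgt V (?k w z x) = fst (?d w z)"
      "\<lbrakk>y \<in> mcod s; f \<in> Ar V; g \<in> Ar V; e \<in> Ar V; src V f = src V e; src V g = src V e;
        tgt V f = ment t y z; tgt V g = ment s x y; tgt V e = ment r w x\<rbrakk>
       \<Longrightarrow> ?k w z x \<bullet> tup V (snd (mat_sum V t s x z) y \<bullet> tup V f g) e = ?l w z x y \<bullet> tup V (tup V f g) e"
    if "w \<in> mdom r" "z \<in> mcod t" "x \<in> mcod r" for w z x y f g e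
    by (rule dist_cotuple_left[OF _ mat_sum_coproduct _ _ _ l]; use that in simp)+
  have c: "cmor (asc (Mat \<kappa> V) t s r) = (\<lambda>w\<in>mdom r. \<lambda>z\<in>mcod t.
      cotuple V (mcod r) (mat_sum V (mat_cmp V t s) r w z) (fst (?d w z)) (?k w z))"
    by (simp add: Mat_def Let_def)
  have *: "cotuple V (mcod r) (mat_sum V (mat_cmp V t s) r w z) (fst (?d w z)) (?k w z) \<in> Ar V"
      "src V (cotuple V (mcod r) (mat_sum V (mat_cmp V t s) r w z) (fst (?d w z)) (?k w z)) =
        fst (mat_sum V (mat_cmp V t s) r w z)"
      "tgt V (cotuple V (mcod r) (mat_sum V (mat_cmp V t s) r w z) (fst (?d w z)) (?k w z)) = fst (?d w z)"
      "\<lbrakk>x \<in> mcod r; h \<in> Ar V; tgt V h = prd V (fst (mat_sum V t s x z)) (ment r w x)\<rbrakk> \<Longrightarrow>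
        cotuple V (mcod r) (mat_sum V (mat_cmp V t s) r w z) (fst (?d w z)) (?k w z)
          \<bullet> snd (mat_sum V (mat_cmp V t s) r w z) x \<bullet> h = ?k w z x \<bullet> h"
    if "w \<in> mdom r" "z \<in> mcod t" for w z x h
    by (rule mat_sum_cotuple; use that k in simp)+
  show "asc (Mat \<kappa> V) t s r \<in> Ar (mat_sqs \<kappa> V)"
    by (rule mat_cellI[OF c]) (use * in simp_all)
  assume **: "ts = mat_cmp V t s" "w \<in> mdom r" "z \<in> mcod t" "x \<in> mcod r" "y \<in> mcod s" "f \<in> Ar V" "g \<in> Ar V" "e \<in> Ar V"
      "src V f = src V e" "src V g = src V e" "tgt V f = ment t y z" "tgt V g = ment s x y" "tgt V e = ment r w x"
  then have "cmor (asc (Mat \<kappa> V) t s r) w z \<bullet> snd (mat_sum V ts r w z) x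
           \<bullet> tup V (snd (mat_sum V t s x z) y \<bullet> tup V f g) e =
        ?k w z x \<bullet> tup V (snd (mat_sum V t s x z) y \<bullet> tup V f g) e"
    by (simp add: c *)
  also have "\<dots> = ?l w z x y \<bullet> tup V (tup V f g) e"
    by (rule k) (use ** in simp_all)
  also have "\<dots> = snd (mat_sum V t (mat_cmp V s r) w z) y \<bullet> tup V f (snd (mat_sum V s r w y) x \<bullet> tup V g e)"
    using ** by (simp add: pmap_def pasc_def)
  finally show "cmor (asc (Mat \<kappa> V) t s r) w z \<bullet> snd (mat_sum V ts r w z) x
           \<bullet> tup V (snd (mat_sum V t s x z) y \<bullet> tup V f g) e =
         snd (mat_sum V t (mat_cmp V s r) w z) y \<bullet> tup V f (snd (mat_sum V s r w y) x \<bullet> tup V g e)" .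
qed

declare asc_mat_cell [simp]


lemma mat_iso:
  assumes \<phi>: "\<phi> \<in> Ar (mat_sqs \<kappa> V)" and l: "cleft \<phi> = idt (Sets \<kappa>) (mdom (csrc \<phi>))"
    and r: "cright \<phi> = idt (Sets \<kappa>) (mcod (csrc \<phi>))"
    and g: "\<And>x y. \<lbrakk>x \<in> mdom (csrc \<phi>); y \<in> mcod (csrc \<phi>)\<rbrakk> \<Longrightarrow> g x y \<in> Ar V"
      "\<And>x y. \<lbrakk>x \<in> mdom (csrc \<phi>); y \<in> mcod (csrc \<phi>)\<rbrakk> \<Longrightarrow> src V (g x y) = ment (ctgt \<phi>) x y"
      "\<And>x y. \<lbrakk>x \<in> mdom (csrc \<phi>); y \<in> mcod (csrc \<phi>)\<rbrakk> \<Longrightarrow> tgt V (g x y) = ment (csrc \<phi>) x y"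
      "\<And>x y. \<lbrakk>x \<in> mdom (csrc \<phi>); y \<in> mcod (csrc \<phi>)\<rbrakk> \<Longrightarrow> g x y \<bullet> cmor \<phi> x y = idt V (ment (csrc \<phi>) x y)"
      "\<And>x y. \<lbrakk>x \<in> mdom (csrc \<phi>); y \<in> mcod (csrc \<phi>)\<rbrakk> \<Longrightarrow> cmor \<phi> x y \<bullet> g x y = idt V (ment (ctgt \<phi>) x y)"
  shows "iso_in (mat_sqs \<kappa> V) \<phi>"
proof -
  have m: "mdom (ctgt \<phi>) = mdom (csrc \<phi>)" "mcod (ctgt \<phi>) = mcod (csrc \<phi>)"
    using mat_cell_unfold(5,8)[OF \<phi>] l r by simp_all
  note s = mat_cell_unfold(1,2)[OF \<phi>]
  let ?g = "\<lparr>csrc = ctgt \<phi>, ctgt = csrc \<phi>, cleft = cleft \<phi>, cright = cright \<phi>,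
    cmor = \<lambda>x\<in>mdom (csrc \<phi>). \<lambda>y\<in>mcod (csrc \<phi>). g x y\<rparr>"
  have c: "?g \<in> Ar (mat_sqs \<kappa> V)"
    by (rule mat_cellI[where k = g and A = "mdom (csrc \<phi>)" and B = "mcod (csrc \<phi>)"])
      (use assms(1-3) g(1-3) m s in simp_all)
  moreover have "?g \<cdot>\<^bsub>mat_sqs \<kappa> V\<^esub> \<phi> = idt (mat_sqs \<kappa> V) (csrc \<phi>)"
    by (rule mat_cell_eqI) (use assms m c s in simp_all)
  moreover have "\<phi> \<cdot>\<^bsub>mat_sqs \<kappa> V\<^esub> ?g = idt (mat_sqs \<kappa> V) (ctgt \<phi>)"
    by (rule mat_cell_eqI) (use assms m c s in simp_all)
  ultimately show ?thesis
    using \<phi> unfolding iso_in_def by (intro conjI bexI[of _ ?g]) (simp_all add: in_hom)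
qed

text \<open>The inverse inserts the point \<open>pt\<close> and lands in the diagonal summand. That
  it is a left inverse needs a check on this summand only, the others being initial.\<close>

lemma mat_lun_iso:
  assumes p: "p \<in> matrices \<kappa> V"
  shows "iso_in (mat_sqs \<kappa> V) (lun (Mat \<kappa> V) p)"
proof (rule mat_iso[where g = "\<lambda>x z. snd (mat_sum V (mat_unit V (mcod p)) p x z) z
      \<bullet> tup V (pt \<bullet> bang (ment p x z)) (idt V (ment p x z))"])
  fix x z assume "x \<in> mdom (csrc (lun (Mat \<kappa> V) p))" "z \<in> mcod (csrc (lun (Mat \<kappa> V) p))"
  then have xz [simp]: "x \<in> mdom p" "z \<in> mcod p" by simp_all
  note [simp] = p
  let ?g = "snd (mat_sum V (mat_unit V (mcod p)) p x z) z \<bullet> tup V (pt \<bullet> bang (ment p x z)) (idt V (ment p x z))"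
  show "?g \<bullet> cmor (lun (Mat \<kappa> V) p) x z = idt V (ment (csrc (lun (Mat \<kappa> V) p)) x z)"
    by (rule unit_sum_ext_left[of p x z "mcod p"]) simp_all
qed (use p in simp_all)

lemma mat_run_iso:
  assumes p: "p \<in> matrices \<kappa> V"
  shows "iso_in (mat_sqs \<kappa> V) (run (Mat \<kappa> V) p)"
proof (rule mat_iso[where g = "\<lambda>x z. snd (mat_sum V p (mat_unit V (mdom p)) x z) x
      \<bullet> tup V (idt V (ment p x z)) (pt \<bullet> bang (ment p x z))"])
  fix x z assume "x \<in> mdom (csrc (run (Mat \<kappa> V) p))" "z \<in> mcod (csrc (run (Mat \<kappa> V) p))"
  then have xz [simp]: "x \<in> mdom p" "z \<in> mcod p" by simp_all
  note [simp] = p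
  let ?g = "snd (mat_sum V p (mat_unit V (mdom p)) x z) x \<bullet> tup V (idt V (ment p x z)) (pt \<bullet> bang (ment p x z))"
  show "?g \<bullet> cmor (run (Mat \<kappa> V) p) x z = idt V (ment (csrc (run (Mat \<kappa> V) p)) x z)"
    by (rule unit_sum_ext_right[of p x z "mdom p"]) simp_all
qed (use p in simp_all)

lemma mat_asc_iso:
  assumes m: "r \<in> matrices \<kappa> V" "s \<in> matrices \<kappa> V" "t \<in> matrices \<kappa> V" "mdom s = mcod r" "mdom t = mcod s"
  shows "iso_in (mat_sqs \<kappa> V) (asc (Mat \<kappa> V) t s r)"
proof -
  note [simp] = m
  let ?d = "\<lambda>w z. mat_sum V (mat_cmp V t s) r w z"
  \<comment> \<open>\<open>?pa\<close> and \<open>?pb\<close> rebracket the threefold product: the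
    factors from \<open>t\<close> and \<open>s\<close> on the one hand, the factor from
    \<open>r\<close> on the other.\<close>
  let ?pa = "\<lambda>w x y z. tup V (prj1 V (ment t y z) (prd V (ment s x y) (ment r w x)))
     (prj1 V (ment s x y) (ment r w x) \<bullet> prj2 V (ment t y z) (prd V (ment s x y) (ment r w x)))"
  let ?pb = "\<lambda>w x y z. prj2 V (ment s x y) (ment r w x) \<bullet> prj2 V (ment t y z) (prd V (ment s x y) (ment r w x))"
  let ?l = "\<lambda>w z y x. snd (?d w z) x \<bullet> tup V (snd (mat_sum V t s x z) y \<bullet> ?pa w x y z) (?pb w x y z)"
  let ?k = "\<lambda>w z y. cotuple V (mcod r) (prd V (ment t y z) (fst (mat_sum V s r w y)),
                           \<lambda>x. pmap V (idt V (ment t y z)) (snd (mat_sum V s r w y) x)) (fst (?d w z)) (?l w z y)"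
  let ?g = "\<lambda>w z. cotuple V (mcod s) (mat_sum V t (mat_cmp V s r) w z) (fst (?d w z)) (?k w z)"
  have l: "?l w z y x \<in> Ar V \<and> src V (?l w z y x) = prd V (ment t y z) (prd V (ment s x y) (ment r w x)) \<and>
      tgt V (?l w z y x) = fst (?d w z)"
    if "w \<in> mdom r" "z \<in> mcod t" "x \<in> mcod r" "y \<in> mcod s" for w z x y
    using that by simp
  have k: "?k w z y \<in> Ar V" "src V (?k w z y) = prd V (ment t y z) (fst (mat_sum V s r w y))"
      "tgt V (?k w z y) = fst (?d w z)"
      "\<lbrakk>x \<in> mcod r; f \<in> Ar V; g \<in> Ar V; e \<in> Ar V; src V f = src V e; src V g = src V e;
        tgt V f = ment t y z; tgt V g = ment s x y; tgt V e = ment r w x\<rbrakk>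
       \<Longrightarrow> ?k w z y \<bullet> tup V f (snd (mat_sum V s r w y) x \<bullet> tup V g e) = ?l w z y x \<bullet> tup V f (tup V g e)"
    if "w \<in> mdom r" "z \<in> mcod t" "y \<in> mcod s" for w z x y f g e
    by (rule dist_cotuple_right[OF _ mat_sum_coproduct _ _ _ l]; use that in simp)+
  have *: "?g w z \<in> Ar V" "src V (?g w z) = fst (mat_sum V t (mat_cmp V s r) w z)"
      "tgt V (?g w z) = fst (?d w z)"
      "\<lbrakk>y \<in> mcod s; h \<in> Ar V; tgt V h = prd V (ment t y z) (fst (mat_sum V s r w y))\<rbrakk> \<Longrightarrow>
        ?g w z \<bullet> snd (mat_sum V t (mat_cmp V s r) w z) y \<bullet> h = ?k w z y \<bullet> h"
    if "w \<in> mdom r" "z \<in> mcod t" for w z y h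
    by (rule mat_sum_cotuple; use that k in simp)+
  have g: "?g w z \<bullet> snd (mat_sum V t (mat_cmp V s r) w z) y \<bullet> tup V f (snd (mat_sum V s r w y) x \<bullet> tup V g e) =
      snd (?d w z) x \<bullet> tup V (snd (mat_sum V t s x z) y \<bullet> tup V f g) e"
    if **: "w \<in> mdom r" "z \<in> mcod t" "x \<in> mcod r" "y \<in> mcod s" "f \<in> Ar V" "g \<in> Ar V" "e \<in> Ar V"
      "src V f = src V e" "src V g = src V e" "tgt V f = ment t y z" "tgt V g = ment s x y" "tgt V e = ment r w x"
    for w z x y f g e
  proof -
    have "?g w z \<bullet> snd (mat_sum V t (mat_cmp V s r) w z) y \<bullet> tup V f (snd (mat_sum V s r w y) x \<bullet> tup V g e) =
        ?k w z y \<bullet> tup V f (snd (mat_sum V s r w y) x \<bullet> tup V g e)"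
      by (rule *) (use ** in simp_all)
    also have "\<dots> = ?l w z y x \<bullet> tup V f (tup V g e)"
      by (rule k) (use ** in simp_all)
    finally show ?thesis
      using ** by simp
  qed
  \<comment> \<open>Hiding the nested cotuples behind a name leaves only typing and the evaluation
    on triples, on which \<open>g\<close> and the associator undo each other.\<close>
  define g where "g = ?g"
  have [simp]: "g w z \<in> Ar V" "src V (g w z) = fst (mat_sum V t (mat_cmp V s r) w z)" "tgt V (g w z) = fst (?d w z)"
      "\<lbrakk>x \<in> mcod r; y \<in> mcod s; f \<in> Ar V; k \<in> Ar V; e \<in> Ar V; src V f = src V e; src V k = src V e;
        tgt V f = ment t y z; tgt V k = ment s x y; tgt V e = ment r w x\<rbrakk> \<Longrightarrow>
        g w z \<bullet> snd (mat_sum V t (mat_cmp V s r) w z) y \<bullet> tup V f (snd (mat_sum V s r w y) x \<bullet> tup V k e) =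
        snd (?d w z) x \<bullet> tup V (snd (mat_sum V t s x z) y \<bullet> tup V f k) e"
    if "w \<in> mdom r" "z \<in> mcod t" for w z x y f k e
    unfolding g_def by (rule * g; use that in simp)+
  show ?thesis
  proof (rule mat_iso[where g = g])
    fix w z assume "w \<in> mdom (csrc (asc (Mat \<kappa> V) t s r))" "z \<in> mcod (csrc (asc (Mat \<kappa> V) t s r))"
    then have [simp]: "w \<in> mdom r" "z \<in> mcod t" by simp_all
    show "g w z \<bullet> cmor (asc (Mat \<kappa> V) t s r) w z = idt V (ment (csrc (asc (Mat \<kappa> V) t s r)) w z)"
      by (rule mat_sum_ext_left[of r s t w z]) simp_all
    show "cmor (asc (Mat \<kappa> V) t s r) w z \<bullet> g w z = idt V (ment (ctgt (asc (Mat \<kappa> V) t s r)) w z)"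
      by (rule mat_sum_ext_right[of r s t w z]) simp_all
  qed simp_all
qed

section \<open>The structural functors of matrices and the coherence axioms\<close>

lemma mat_dom: "cat_functor (mat_sqs \<kappa> V) (Sets \<kappa>) mdom cleft"
  by (intro cat_functor.intro cat_functor_axioms.intro mat_category Sets_category) (auto simp: in_hom)

lemma mat_cod: "cat_functor (mat_sqs \<kappa> V) (Sets \<kappa>) mcod cright"
  by (intro cat_functor.intro cat_functor_axioms.intro mat_category Sets_category) (auto simp: in_hom)

text \<open>If \<open>P\<close> fails, the source is initial; so the comparison at \<open>pt\<close>
  is asked for under \<open>P\<close> only.\<close>

lemma unit_ext:
  assumes "h \<in> Ar V" "k \<in> Ar V" "src V h = fst (copower V (truth P))" "src V k = fst (copower V (truth P))"
    "tgt V h = tgt V k" "P \<Longrightarrow> h \<bullet> pt = k \<bullet> pt"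
  shows "h = k"
  by (rule coprod_ext[OF truth_coproduct[of P]]) (use assms in \<open>cases P; simp\<close>)+

lemma mat_unit_functor: "cat_functor (Sets \<kappa>) (mat_sqs \<kappa> V) (mat_unit V) (cunit (Mat \<kappa> V))"
proof (intro cat_functor.intro cat_functor_axioms.intro mat_category Sets_category, goal_cases)
  case (2 f a b) then show ?case by (simp add: in_hom)
next
  case (3 a)
  then have [simp]: "|a| <o \<kappa>" by simp
  show ?case
  proof (rule mat_cell_eqI; simp?)
    fix x y assume [simp]: "x \<in> a" "y \<in> a"
    show "cmor (cunit (Mat \<kappa> V) (idt (Sets \<kappa>) a)) x y = idt V (fst (copower V (truth (x = y))))"
      by (rule unit_ext[of _ _ "x = y"]) auto
  qed
next
  case (4 f a b g c)
  then have [simp]: "f \<in> Ar (Sets \<kappa>)" "g \<in> Ar (Sets \<kappa>)" "ssrc g = stgt f"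
    by (auto simp: in_hom)
  show ?case
  proof (rule mat_cell_eqI; simp?)
    fix x y assume [simp]: "x \<in> ssrc f" "y \<in> ssrc f"
    show "cmor (cunit (Mat \<kappa> V) (g \<cdot>\<^bsub>Sets \<kappa>\<^esub> f)) x y =
        cmor (cunit (Mat \<kappa> V) g) (sapp f x) (sapp f y) \<bullet> cmor (cunit (Mat \<kappa> V) f) x y"
      by (rule unit_ext[of _ _ "x = y"]) auto
  qed
qed simp_all

theorem Mat_pseudodouble: "pseudodouble_category (Mat \<kappa> V)"
proof (intro pseudodouble_category.intro pseudodouble_category_axioms.intro, unfold Mat_simps, goal_cases)
  case 1 show ?case by (rule Sets_category)
next
  case 2 show ?case by (rule mat_category)
next
  case 3 show ?case by (rule mat_dom)
next
  case 4 show ?case by (rule mat_cod)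
next
  case 5 show ?case by (rule mat_unit_functor)
next
  case (11 \<phi> r r' \<psi> s s') then show ?case by (auto simp: in_hom)
next
  case (12 r s)
  then have [simp]: "r \<in> matrices \<kappa> V" "s \<in> matrices \<kappa> V" "mdom s = mcod r"
    by simp_all
  show ?case
  proof (rule mat_cell_eqI; simp?)
    fix x z assume [simp]: "x \<in> mdom r" "z \<in> mcod s"
    show "cmor (idt (mat_sqs \<kappa> V) s \<star>\<^bsub>Mat \<kappa> V\<^esub> idt (mat_sqs \<kappa> V) r) x z = idt V (fst (mat_sum V s r x z))"
      by (rule mat_sum_ext[of r s x z]) simp_all
  qed
next
  case (13 \<phi> r r' \<phi>' r'' \<psi> s s' \<psi>' s'')
  then have c: "\<phi> \<in> Ar (mat_sqs \<kappa> V)" "\<psi> \<in> Ar (mat_sqs \<kappa> V)" "\<phi>' \<in> Ar (mat_sqs \<kappa> V)" "\<psi>' \<in> Ar (mat_sqs \<kappa> V)"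
    "csrc \<phi>' = ctgt \<phi>" "csrc \<psi>' = ctgt \<psi>" "cleft \<psi> = cright \<phi>" "cleft \<psi>' = cright \<phi>'"
    by (auto simp: in_hom)
  note [simp] = c mat_cell_match[OF c(1,2,7)] mat_cell_match(2)[OF c(3,4,8)]
  show ?case
  proof (rule mat_cell_eqI; simp?)
    fix x z assume [simp]: "x \<in> mdom (csrc \<phi>)" "z \<in> mcod (csrc \<psi>)"
    show "cmor ((\<psi>' \<cdot>\<^bsub>mat_sqs \<kappa> V\<^esub> \<psi>) \<star>\<^bsub>Mat \<kappa> V\<^esub> (\<phi>' \<cdot>\<^bsub>mat_sqs \<kappa> V\<^esub> \<phi>)) x z =
        cmor (\<psi>' \<star>\<^bsub>Mat \<kappa> V\<^esub> \<phi>') (sapp (cleft \<phi>) x) (sapp (cright \<psi>) z) \<bullet> cmor (\<psi> \<star>\<^bsub>Mat \<kappa> V\<^esub> \<phi>) x z"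
      by (rule mat_sum_ext[of "csrc \<phi>" "csrc \<psi>" x z]) simp_all
  qed
next
  case (14 r)
  then show ?case by (simp add: globular_def in_hom mat_lun_iso)
next
  case (15 \<phi> r r')
  then have [simp]: "\<phi> \<in> Ar (mat_sqs \<kappa> V)" "r = csrc \<phi>" "r' = ctgt \<phi>"
    by (auto simp: in_hom)
  show ?case
  proof (rule mat_cell_eqI; simp?)
    fix x z assume [simp]: "x \<in> mdom (csrc \<phi>)" "z \<in> mcod (csrc \<phi>)"
    show "cmor \<phi> x z \<bullet> cmor (lun (Mat \<kappa> V) (csrc \<phi>)) x z =
        cmor (lun (Mat \<kappa> V) (ctgt \<phi>)) (sapp (cleft \<phi>) x) (sapp (cright \<phi>) z)
          \<bullet> cmor (cunit (Mat \<kappa> V) (cright \<phi>) \<star>\<^bsub>Mat \<kappa> V\<^esub> \<phi>) x z"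
      by (rule unit_sum_ext_left[of "csrc \<phi>" x z "mcod (csrc \<phi>)"]) simp_all
  qed
next
  case (16 r)
  then show ?case by (simp add: globular_def in_hom mat_run_iso)
next
  case (17 \<phi> r r')
  then have [simp]: "\<phi> \<in> Ar (mat_sqs \<kappa> V)" "r = csrc \<phi>" "r' = ctgt \<phi>"
    by (auto simp: in_hom)
  show ?case
  proof (rule mat_cell_eqI; simp?)
    fix x z assume [simp]: "x \<in> mdom (csrc \<phi>)" "z \<in> mcod (csrc \<phi>)"
    show "cmor \<phi> x z \<bullet> cmor (run (Mat \<kappa> V) (csrc \<phi>)) x z =
        cmor (run (Mat \<kappa> V) (ctgt \<phi>)) (sapp (cleft \<phi>) x) (sapp (cright \<phi>) z)
          \<bullet> cmor (\<phi> \<star>\<^bsub>Mat \<kappa> V\<^esub> cunit (Mat \<kappa> V) (cleft \<phi>)) x z"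
      by (rule unit_sum_ext_right[of "csrc \<phi>" x z "mdom (csrc \<phi>)"]) simp_all
  qed
next
  case (18 r s t)
  then show ?case by (simp add: globular_def in_hom mat_asc_iso)
next
  case (19 \<phi> r r' \<psi> s s' \<chi> t t')
  then have c: "\<phi> \<in> Ar (mat_sqs \<kappa> V)" "\<psi> \<in> Ar (mat_sqs \<kappa> V)" "\<chi> \<in> Ar (mat_sqs \<kappa> V)"
    "r = csrc \<phi>" "s = csrc \<psi>" "t = csrc \<chi>" "r' = ctgt \<phi>" "s' = ctgt \<psi>" "t' = ctgt \<chi>"
    "cleft \<psi> = cright \<phi>" "cleft \<chi> = cright \<psi>"
    by (auto simp: in_hom)
  note [simp] = c mat_cell_match[OF c(1,2,10)] mat_cell_match[OF c(2,3,11)]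
  show ?case
  proof (rule mat_cell_eqI; simp?)
    fix x z assume [simp]: "x \<in> mdom (csrc \<phi>)" "z \<in> mcod (csrc \<chi>)"
    show "cmor (\<chi> \<star>\<^bsub>Mat \<kappa> V\<^esub> (\<psi> \<star>\<^bsub>Mat \<kappa> V\<^esub> \<phi>)) x z \<bullet> cmor (asc (Mat \<kappa> V) (csrc \<chi>) (csrc \<psi>) (csrc \<phi>)) x z =
        cmor (asc (Mat \<kappa> V) (ctgt \<chi>) (ctgt \<psi>) (ctgt \<phi>)) (sapp (cleft \<phi>) x) (sapp (cright \<chi>) z)
          \<bullet> cmor (\<chi> \<star>\<^bsub>Mat \<kappa> V\<^esub> \<psi> \<star>\<^bsub>Mat \<kappa> V\<^esub> \<phi>) x z"
      by (rule mat_sum_ext_left[of "csrc \<phi>" "csrc \<psi>" "csrc \<chi>" x z]) simp_all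
  qed
next
  case (20 r s)
  then have [simp]: "r \<in> matrices \<kappa> V" "s \<in> matrices \<kappa> V" "mdom s = mcod r"
    by simp_all
  show ?case
  proof (rule mat_cell_eqI; simp?)
    fix w z assume [simp]: "w \<in> mdom r" "z \<in> mcod s"
    let ?L = "(idt (mat_sqs \<kappa> V) s \<star>\<^bsub>Mat \<kappa> V\<^esub> lun (Mat \<kappa> V) r)"
    let ?R = "run (Mat \<kappa> V) s \<star>\<^bsub>Mat \<kappa> V\<^esub> idt (mat_sqs \<kappa> V) r"
    let ?A = "asc (Mat \<kappa> V) s (mat_unit V (mcod r)) r"
    show "cmor ?L w z \<bullet> cmor ?A w z = cmor ?R w z"
    proof (rule mat_sum_ext_left[of r "mat_unit V (mcod r)" s w z]; (simp; fail)?)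
      fix x y f g e
      assume [simp]: "x \<in> mcod r" "f \<in> Ar V" "g \<in> Ar V" "e \<in> Ar V" "src V f = src V e" "src V g = src V e"
        "tgt V f = ment s y z" "tgt V e = ment r w x"
        and y: "y \<in> mcod (mat_unit V (mcod r))" and g: "tgt V g = ment (mat_unit V (mcod r)) x y"
      have [simp]: "y \<in> mcod r" using y by simp
      let ?i = "snd (mat_sum V (mat_cmp V s (mat_unit V (mcod r))) r w z) x
        \<bullet> tup V (snd (mat_sum V s (mat_unit V (mcod r)) x z) y \<bullet> tup V f g) e"
      show "(cmor ?L w z \<bullet> cmor ?A w z) \<bullet> ?i = cmor ?R w z \<bullet> ?i"
      \<comment> \<open>The middle element \<open>g\<close> lies in an entry of the unit matrix. On
        the diagonal both unitors evaluate; off it, \<open>g\<close> maps to an initial object and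
        strictness equates the two sides.\<close>
      proof (cases "x = y")
        case True
        then show ?thesis using g by simp
      next
        case False
        then show ?thesis using g by (intro strict_initial[of g]) simp_all
      qed
    qed
  qed
next
  case (21 q r s t)
  then have [simp]: "q \<in> matrices \<kappa> V" "r \<in> matrices \<kappa> V" "s \<in> matrices \<kappa> V" "t \<in> matrices \<kappa> V"
    "mdom r = mcod q" "mdom s = mcod r" "mdom t = mcod s"
    by simp_all
  show ?case
  proof (rule mat_cell_eqI; simp?)
    fix x z assume [simp]: "x \<in> mdom q" "z \<in> mcod t"
    show "cmor (asc (Mat \<kappa> V) t s (mat_cmp V r q)) x z \<bullet> cmor (asc (Mat \<kappa> V) (mat_cmp V t s) r q) x z =
        cmor (idt (mat_sqs \<kappa> V) t \<star>\<^bsub>Mat \<kappa> V\<^esub> asc (Mat \<kappa> V) s r q) x z \<bullet> cmor (asc (Mat \<kappa> V) t (mat_cmp V s r) q) x z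
          \<bullet> cmor (asc (Mat \<kappa> V) t s r \<star>\<^bsub>Mat \<kappa> V\<^esub> idt (mat_sqs \<kappa> V) q) x z"
      by (rule mat_sum_ext_left_left[of q r s t x z]) simp_all
  qed
qed simp_all

end


section \<open>The oplax functor\<close>

lemma star_simps [simp]:
  "omap (star V) X = fst (copower V X)" "hmap (star V) = star_span V"
  "csrc (cmap (star V) \<phi>) = star_span V (csrc \<phi>)" "ctgt (cmap (star V) \<phi>) = star_span V (ctgt \<phi>)"
  "cleft (cmap (star V) \<phi>) = vmap (star V) (cleft \<phi>)" "cright (cmap (star V) \<phi>) = vmap (star V) (cright \<phi>)"
  "csrc (ecell (star V) X) = star_span V (mat_unit V X)"
  "ctgt (ecell (star V) X) = span_unit V (fst (copower V X))"
  "cleft (ecell (star V) X) = idt V (fst (copower V X))" "cright (ecell (star V) X) = idt V (fst (copower V X))"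
  "csrc (mcell (star V) q p) = star_span V (mat_cmp V q p)"
  "ctgt (mcell (star V) q p) = span_cmp V (star_span V q) (star_span V p)"
  "cleft (mcell (star V) q p) = idt V (fst (copower V (mdom p)))"
  "cright (mcell (star V) q p) = idt V (fst (copower V (mcod q)))"
  by (simp_all add: star_def Let_def)

context distributive_lex
begin

text \<open>The index set consists of pairs, so it is not of the type for which small coproducts are given;
  the coproduct is obtained as an iterated one.\<close>

lemma mat_total_coproduct:
  assumes p: "p \<in> matrices \<kappa> V"
  shows "is_coproduct V (mdom p \<times> mcod p) (\<lambda>(x, y). ment p x y) (mat_total V p)"
proof -
  let ?c = "\<lambda>x. cop V (mcod p) (\<lambda>y. ment p x y)"
  have c: "is_coproduct V (mcod p) (\<lambda>y. ment p x y) (?c x)" if "x \<in> mdom p" for x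
    by (rule cop_coproduct) (use that p in simp_all)
  have "is_coproduct V (mdom p) (\<lambda>x. fst (?c x)) (cop V (mdom p) (\<lambda>x. fst (?c x)))"
    by (rule cop_coproduct) (use coprod_inj(1)[OF c] p in simp_all)
  from coprod_cop[OF coprod_sigma[OF c this]] show ?thesis
    by (simp add: mat_total_def)
qed

section \<open>Arrows out of the total object of a matrix\<close>

lemma mat_total_simps [simp]:
  assumes "p \<in> matrices \<kappa> V"
  shows "fst (mat_total V p) \<in> Ob V"
    "\<lbrakk>x \<in> mdom p; y \<in> mcod p\<rbrakk> \<Longrightarrow> snd (mat_total V p) (x, y) \<in> Ar V"
    "\<lbrakk>x \<in> mdom p; y \<in> mcod p\<rbrakk> \<Longrightarrow> src V (snd (mat_total V p) (x, y)) = ment p x y"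
    "\<lbrakk>x \<in> mdom p; y \<in> mcod p\<rbrakk> \<Longrightarrow> tgt V (snd (mat_total V p) (x, y)) = fst (mat_total V p)"
  using coprod_inj[OF mat_total_coproduct[OF assms]] by auto

lemma mat_total_ext:
  assumes p: "p \<in> matrices \<kappa> V"
    and h: "h \<in> Ar V" "k \<in> Ar V" "src V h = fst (mat_total V p)" "src V k = fst (mat_total V p)"
    "tgt V h = tgt V k"
    and eq: "\<And>x y. \<lbrakk>x \<in> mdom p; y \<in> mcod p\<rbrakk>
      \<Longrightarrow> h \<bullet> snd (mat_total V p) (x, y) = k \<bullet> snd (mat_total V p) (x, y)"
  shows "h = k"
  by (rule coprod_ext[OF mat_total_coproduct[OF p] h]) (use eq in auto)

text \<open>The identity as \<open>f\<close> shows that nothing is lost against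
  \<open>mat_total_ext\<close>. The extra arrow gives the goals the shape in which the rules for
  legs and cells, stated with a tail, can rewrite.\<close>

lemma mat_total_ext_elt:
  assumes p: "p \<in> matrices \<kappa> V"
    and h: "h \<in> Ar V" "k \<in> Ar V" "src V h = fst (mat_total V p)" "src V k = fst (mat_total V p)"
    "tgt V h = tgt V k"
    and eq: "\<And>x y f. \<lbrakk>x \<in> mdom p; y \<in> mcod p; f \<in> Ar V; tgt V f = ment p x y\<rbrakk>
      \<Longrightarrow> h \<bullet> snd (mat_total V p) (x, y) \<bullet> f = k \<bullet> snd (mat_total V p) (x, y) \<bullet> f"
  shows "h = k"
proof (rule mat_total_ext[OF p h])
  fix x y assume "x \<in> mdom p" "y \<in> mcod p"
  then show "h \<bullet> snd (mat_total V p) (x, y) = k \<bullet> snd (mat_total V p) (x, y)"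
    using eq[of x y "idt V (ment p x y)"] p h by simp
qed

text \<open>The summands off the diagonal are initial and those on it are copies of
  \<open>one V\<close>, so the total object of a unit matrix behaves like the copower over
  \<open>X\<close>.\<close>

lemma mat_total_ext_unit:
  assumes X: "|X| <o \<kappa>"
    and h: "h \<in> Ar V" "k \<in> Ar V" "src V h = fst (mat_total V (mat_unit V X))"
      "src V k = fst (mat_total V (mat_unit V X))" "tgt V h = tgt V k"
    and eq: "\<And>x. x \<in> X \<Longrightarrow> h \<bullet> snd (mat_total V (mat_unit V X)) (x, x) \<bullet> pt =
        k \<bullet> snd (mat_total V (mat_unit V X)) (x, x) \<bullet> pt"
  shows "h = k"
proof (rule mat_total_ext[OF _ h])
  fix x y assume xy: "x \<in> mdom (mat_unit V X)" "y \<in> mcod (mat_unit V X)"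
  show "h \<bullet> snd (mat_total V (mat_unit V X)) (x, y) = k \<bullet> snd (mat_total V (mat_unit V X)) (x, y)"
    by (rule unit_ext[of _ _ "x = y"]) (use xy X h eq in auto)
qed (use X in simp)

text \<open>This rule and the following three fit the sources that occur in the oplax axioms: a
  composite, its composites with units, and a threefold composite. Each applies a rule for a single
  entry inside every summand.\<close>

lemma mat_total_ext_cmp:
  assumes m: "p \<in> matrices \<kappa> V" "q \<in> matrices \<kappa> V" "mdom q = mcod p"
    and h: "h \<in> Ar V" "k \<in> Ar V" "src V h = fst (mat_total V (mat_cmp V q p))"
      "src V k = fst (mat_total V (mat_cmp V q p))" "tgt V h = tgt V k"
    and eq: "\<And>x y z f g. \<lbrakk>x \<in> mdom p; y \<in> mcod p; z \<in> mcod q; f \<in> Ar V; g \<in> Ar V; src V f = src V g;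
        tgt V f = ment q y z; tgt V g = ment p x y\<rbrakk>
      \<Longrightarrow> h \<bullet> snd (mat_total V (mat_cmp V q p)) (x, z) \<bullet> snd (mat_sum V q p x z) y \<bullet> tup V f g =
          k \<bullet> snd (mat_total V (mat_cmp V q p)) (x, z) \<bullet> snd (mat_sum V q p x z) y \<bullet> tup V f g"
  shows "h = k"
proof (rule mat_total_ext[OF _ h])
  fix x z assume xz: "x \<in> mdom (mat_cmp V q p)" "z \<in> mcod (mat_cmp V q p)"
  show "h \<bullet> snd (mat_total V (mat_cmp V q p)) (x, z) = k \<bullet> snd (mat_total V (mat_cmp V q p)) (x, z)"
    by (rule mat_sum_ext[of p q x z]) (use xz m h eq in simp_all)
qed (use m in simp)

lemma mat_total_ext_unit_left:
  assumes p: "p \<in> matrices \<kappa> V" and Y: "Y = mcod p"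
    and h: "h \<in> Ar V" "k \<in> Ar V" "src V h = fst (mat_total V (mat_cmp V (mat_unit V Y) p))"
      "src V k = fst (mat_total V (mat_cmp V (mat_unit V Y) p))" "tgt V h = tgt V k"
    and eq: "\<And>x z g. \<lbrakk>x \<in> mdom p; z \<in> mcod p; g \<in> Ar V; tgt V g = ment p x z\<rbrakk>
      \<Longrightarrow> h \<bullet> snd (mat_total V (mat_cmp V (mat_unit V Y) p)) (x, z)
            \<bullet> snd (mat_sum V (mat_unit V Y) p x z) z \<bullet> tup V (pt \<bullet> bang (src V g)) g =
          k \<bullet> snd (mat_total V (mat_cmp V (mat_unit V Y) p)) (x, z)
            \<bullet> snd (mat_sum V (mat_unit V Y) p x z) z \<bullet> tup V (pt \<bullet> bang (src V g)) g"
  shows "h = k"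
proof (rule mat_total_ext[OF _ h])
  fix x z assume xz: "x \<in> mdom (mat_cmp V (mat_unit V Y) p)" "z \<in> mcod (mat_cmp V (mat_unit V Y) p)"
  show "h \<bullet> snd (mat_total V (mat_cmp V (mat_unit V Y) p)) (x, z) =
      k \<bullet> snd (mat_total V (mat_cmp V (mat_unit V Y) p)) (x, z)"
    by (rule unit_sum_ext_left[of p x z Y]) (use xz p Y h eq in simp_all)
qed (use p Y in simp)

lemma mat_total_ext_unit_right:
  assumes p: "p \<in> matrices \<kappa> V" and Y: "Y = mdom p"
    and h: "h \<in> Ar V" "k \<in> Ar V" "src V h = fst (mat_total V (mat_cmp V p (mat_unit V Y)))"
      "src V k = fst (mat_total V (mat_cmp V p (mat_unit V Y)))" "tgt V h = tgt V k"
    and eq: "\<And>x z f. \<lbrakk>x \<in> mdom p; z \<in> mcod p; f \<in> Ar V; tgt V f = ment p x z\<rbrakk>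
      \<Longrightarrow> h \<bullet> snd (mat_total V (mat_cmp V p (mat_unit V Y))) (x, z)
            \<bullet> snd (mat_sum V p (mat_unit V Y) x z) x \<bullet> tup V f (pt \<bullet> bang (src V f)) =
          k \<bullet> snd (mat_total V (mat_cmp V p (mat_unit V Y))) (x, z)
            \<bullet> snd (mat_sum V p (mat_unit V Y) x z) x \<bullet> tup V f (pt \<bullet> bang (src V f))"
  shows "h = k"
proof (rule mat_total_ext[OF _ h])
  fix x z assume xz: "x \<in> mdom (mat_cmp V p (mat_unit V Y))" "z \<in> mcod (mat_cmp V p (mat_unit V Y))"
  show "h \<bullet> snd (mat_total V (mat_cmp V p (mat_unit V Y))) (x, z) =
      k \<bullet> snd (mat_total V (mat_cmp V p (mat_unit V Y))) (x, z)"
    by (rule unit_sum_ext_right[of p x z Y]) (use xz p Y h eq in simp_all)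
qed (use p Y in simp)

lemma mat_total_ext_cmp_left:
  assumes m: "r \<in> matrices \<kappa> V" "s \<in> matrices \<kappa> V" "t \<in> matrices \<kappa> V" "mdom s = mcod r" "mdom t = mcod s"
    and h: "h \<in> Ar V" "k \<in> Ar V" "src V h = fst (mat_total V (mat_cmp V (mat_cmp V t s) r))"
      "src V k = fst (mat_total V (mat_cmp V (mat_cmp V t s) r))" "tgt V h = tgt V k"
    and eq: "\<And>w z x y f g e. \<lbrakk>w \<in> mdom r; z \<in> mcod t; x \<in> mcod r; y \<in> mcod s; f \<in> Ar V; g \<in> Ar V; e \<in> Ar V;
        src V f = src V e; src V g = src V e; tgt V f = ment t y z; tgt V g = ment s x y; tgt V e = ment r w x\<rbrakk>
      \<Longrightarrow> h \<bullet> snd (mat_total V (mat_cmp V (mat_cmp V t s) r)) (w, z)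
            \<bullet> snd (mat_sum V (mat_cmp V t s) r w z) x \<bullet> tup V (snd (mat_sum V t s x z) y \<bullet> tup V f g) e =
          k \<bullet> snd (mat_total V (mat_cmp V (mat_cmp V t s) r)) (w, z)
            \<bullet> snd (mat_sum V (mat_cmp V t s) r w z) x \<bullet> tup V (snd (mat_sum V t s x z) y \<bullet> tup V f g) e"
  shows "h = k"
proof (rule mat_total_ext[OF _ h])
  fix w z assume wz: "w \<in> mdom (mat_cmp V (mat_cmp V t s) r)" "z \<in> mcod (mat_cmp V (mat_cmp V t s) r)"
  show "h \<bullet> snd (mat_total V (mat_cmp V (mat_cmp V t s) r)) (w, z) =
      k \<bullet> snd (mat_total V (mat_cmp V (mat_cmp V t s) r)) (w, z)"
    by (rule mat_sum_ext_left[of r s t w z]) (use wz m h eq in simp_all)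
qed (use m in simp)

lemma mat_total_cotuple:
  assumes p: "p \<in> matrices \<kappa> V" and I: "I = mdom p \<times> mcod p" and d: "d \<in> Ob V"
    and k: "\<And>x y. \<lbrakk>x \<in> mdom p; y \<in> mcod p\<rbrakk> \<Longrightarrow> k (x, y) \<in> Ar V \<and> src V (k (x, y)) = ment p x y \<and> tgt V (k (x, y)) = d"
  shows "cotuple V I (mat_total V p) d k \<in> Ar V"
    "src V (cotuple V I (mat_total V p) d k) = fst (mat_total V p)"
    "tgt V (cotuple V I (mat_total V p) d k) = d"
    "\<lbrakk>x \<in> mdom p; y \<in> mcod p; h \<in> Ar V; tgt V h = ment p x y\<rbrakk>
       \<Longrightarrow> cotuple V I (mat_total V p) d k \<bullet> snd (mat_total V p) (x, y) \<bullet> h = k (x, y) \<bullet> h"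
proof -
  have k': "k i \<in> Ar V \<and> src V (k i) = (\<lambda>(x, y). ment p x y) i \<and> tgt V (k i) = d" if "i \<in> mdom p \<times> mcod p" for i
    using that k by (cases i) auto
  note * = coprod_cotuple[OF mat_total_coproduct[OF p] d, where k = k, OF k']
  show "cotuple V I (mat_total V p) d k \<in> Ar V"
    "src V (cotuple V I (mat_total V p) d k) = fst (mat_total V p)"
    "tgt V (cotuple V I (mat_total V p) d k) = d"
    using *(1-3) I by simp_all
  show "\<lbrakk>x \<in> mdom p; y \<in> mcod p; h \<in> Ar V; tgt V h = ment p x y\<rbrakk>
       \<Longrightarrow> cotuple V I (mat_total V p) d k \<bullet> snd (mat_total V p) (x, y) \<bullet> h = k (x, y) \<bullet> h"
    using * I p by (intro extend_cmp) simp_all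
qed

section \<open>Action and comparison cells of the oplax functor\<close>

lemma vmap_star [simp]:
  assumes "f \<in> Ar (Sets \<kappa>)"
  shows "vmap (star V) f \<in> Ar V" "src V (vmap (star V) f) = fst (copower V (ssrc f))"
    "tgt V (vmap (star V) f) = fst (copower V (stgt f))"
    "\<lbrakk>x \<in> ssrc f; X = ssrc f\<rbrakk> \<Longrightarrow> vmap (star V) f \<bullet> snd (copower V X) x = snd (copower V (stgt f)) (sapp f x)"
  using assms Sets_small[OF assms] by (simp_all add: star_def Let_def)

lemmas vmap_star' [simp] = vmap_star(4)[THEN extend_cmp]

lemma star_span_simps [simp]:
  assumes p: "p \<in> matrices \<kappa> V"
  shows "lleg (star_span V p) \<in> Ar V" "rleg (star_span V p) \<in> Ar V"
    "src V (lleg (star_span V p)) = fst (mat_total V p)" "src V (rleg (star_span V p)) = fst (mat_total V p)"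
    "tgt V (lleg (star_span V p)) = fst (copower V (mdom p))"
    "tgt V (rleg (star_span V p)) = fst (copower V (mcod p))"
    "\<lbrakk>x \<in> mdom p; y \<in> mcod p; f \<in> Ar V; tgt V f = ment p x y\<rbrakk> \<Longrightarrow>
      lleg (star_span V p) \<bullet> snd (mat_total V p) (x, y) \<bullet> f = snd (copower V (mdom p)) x \<bullet> bang (src V f)"
    "\<lbrakk>x \<in> mdom p; y \<in> mcod p; f \<in> Ar V; tgt V f = ment p x y\<rbrakk> \<Longrightarrow>
      rleg (star_span V p) \<bullet> snd (mat_total V p) (x, y) \<bullet> f = snd (copower V (mcod p)) y \<bullet> bang (src V f)"
  using p by (simp_all add: star_span_def mat_total_cotuple)

lemma cmor_cmap_star:
  "cmor (cmap (star V) \<phi>) = cotuple V (mdom (csrc \<phi>) \<times> mcod (csrc \<phi>)) (mat_total V (csrc \<phi>)) (fst (mat_total V (ctgt \<phi>)))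
          (\<lambda>(x, y). snd (mat_total V (ctgt \<phi>)) (sapp (cleft \<phi>) x, sapp (cright \<phi>) y) \<bullet> cmor \<phi> x y)"
  by (simp add: star_def Let_def)

lemma cmap_star [simp]:
  assumes \<phi>: "\<phi> \<in> Ar (mat_sqs \<kappa> V)"
  shows "cmap (star V) \<phi> \<in> Ar (span_sqs V)"
    "\<lbrakk>p = csrc \<phi>; x \<in> mdom p; y \<in> mcod p; f \<in> Ar V; tgt V f = ment p x y\<rbrakk>
      \<Longrightarrow> cmor (cmap (star V) \<phi>) \<bullet> snd (mat_total V p) (x, y) \<bullet> f =
          snd (mat_total V (ctgt \<phi>)) (sapp (cleft \<phi>) x, sapp (cright \<phi>) y) \<bullet> cmor \<phi> x y \<bullet> f"
proof -
  have *: "cmor (cmap (star V) \<phi>) \<in> Ar V" "src V (cmor (cmap (star V) \<phi>)) = fst (mat_total V (csrc \<phi>))"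
      "tgt V (cmor (cmap (star V) \<phi>)) = fst (mat_total V (ctgt \<phi>))"
    and e: "\<lbrakk>x \<in> mdom (csrc \<phi>); y \<in> mcod (csrc \<phi>); f \<in> Ar V; tgt V f = ment (csrc \<phi>) x y\<rbrakk>
      \<Longrightarrow> cmor (cmap (star V) \<phi>) \<bullet> snd (mat_total V (csrc \<phi>)) (x, y) \<bullet> f =
          snd (mat_total V (ctgt \<phi>)) (sapp (cleft \<phi>) x, sapp (cright \<phi>) y) \<bullet> cmor \<phi> x y \<bullet> f" for x y f
    using \<phi> by (simp_all add: cmor_cmap_star mat_total_cotuple)
  show "cmap (star V) \<phi> \<in> Ar (span_sqs V)"
  proof (rule span_cellI)
    show "lleg (ctgt (cmap (star V) \<phi>)) \<bullet> cmor (cmap (star V) \<phi>) =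
        cleft (cmap (star V) \<phi>) \<bullet> lleg (csrc (cmap (star V) \<phi>))"
      by (rule mat_total_ext_elt[of "csrc \<phi>"]) (use \<phi> * e in simp_all)
    show "rleg (ctgt (cmap (star V) \<phi>)) \<bullet> cmor (cmap (star V) \<phi>) =
        cright (cmap (star V) \<phi>) \<bullet> rleg (csrc (cmap (star V) \<phi>))"
      by (rule mat_total_ext_elt[of "csrc \<phi>"]) (use \<phi> * e in simp_all)
  qed (use \<phi> * in simp_all)
  show "\<lbrakk>p = csrc \<phi>; x \<in> mdom p; y \<in> mcod p; f \<in> Ar V; tgt V f = ment p x y\<rbrakk>
      \<Longrightarrow> cmor (cmap (star V) \<phi>) \<bullet> snd (mat_total V p) (x, y) \<bullet> f =
          snd (mat_total V (ctgt \<phi>)) (sapp (cleft \<phi>) x, sapp (cright \<phi>) y) \<bullet> cmor \<phi> x y \<bullet> f"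
    using e by simp
qed

lemma ecell_star [simp]:
  assumes X: "|X| <o \<kappa>"
  shows "ecell (star V) X \<in> Ar (span_sqs V)"
    "\<lbrakk>Y = X; x \<in> X; f \<in> Ar V; tgt V f = fst (copower V {()})\<rbrakk>
      \<Longrightarrow> cmor (ecell (star V) X) \<bullet> snd (mat_total V (mat_unit V Y)) (x, x) \<bullet> f =
          snd (copower V X) x \<bullet> bang (src V f)"
proof -
  let ?k = "\<lambda>x x'. cotuple V (truth (x = x')) (copower V (truth (x = x'))) (fst (copower V X)) (\<lambda>_. snd (copower V X) x)"
  have c: "cmor (ecell (star V) X) = cotuple V (X \<times> X) (mat_total V (mat_unit V X)) (fst (copower V X)) (\<lambda>(x, x'). ?k x x')"
    by (simp add: star_def Let_def)
  have k: "?k x x' \<in> Ar V" "src V (?k x x') = fst (copower V (truth (x = x')))" "tgt V (?k x x') = fst (copower V X)"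
    if "x \<in> X" for x x'
    by (rule truth_cotuple; use that X in simp)+
  have *: "cmor (ecell (star V) X) \<in> Ar V" "src V (cmor (ecell (star V) X)) = fst (mat_total V (mat_unit V X))"
      "tgt V (cmor (ecell (star V) X)) = fst (copower V X)"
    unfolding c by (rule mat_total_cotuple; use X k in simp)+
  have e: "cmor (ecell (star V) X) \<bullet> snd (mat_total V (mat_unit V X)) (x, x) \<bullet> f =
          snd (copower V X) x \<bullet> bang (src V f)"
    if "x \<in> X" "f \<in> Ar V" "tgt V f = fst (copower V {()})" for x f
  proof -
    \<comment> \<open>The inner cotuple can be evaluated only at \<open>pt\<close>, through which
      \<open>f\<close> factors.\<close>
    have "cmor (ecell (star V) X) \<bullet> snd (mat_total V (mat_unit V X)) (x, x) \<bullet> f = ?k x x \<bullet> pt \<bullet> bang (src V f)"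
      unfolding c eq_pt_bang[OF that(2,3), symmetric]
      by (subst mat_total_cotuple(4); use that X k in simp)
    also have "\<dots> = snd (copower V X) x \<bullet> bang (src V f)"
      by (rule extend_cmp) (use that X k[of x x] in simp_all)
    finally show ?thesis .
  qed
  have e': "cmor (ecell (star V) X) \<bullet> snd (mat_total V (mat_unit V X)) (x, x) \<bullet> pt = snd (copower V X) x"
    if "x \<in> X" for x
    using e[of x pt] that X by simp
  show "ecell (star V) X \<in> Ar (span_sqs V)"
  proof (rule span_cellI)
    show "lleg (ctgt (ecell (star V) X)) \<bullet> cmor (ecell (star V) X) =
        cleft (ecell (star V) X) \<bullet> lleg (csrc (ecell (star V) X))"
      by (rule mat_total_ext_unit[OF X]) (use X * e' in simp_all)
    show "rleg (ctgt (ecell (star V) X)) \<bullet> cmor (ecell (star V) X) =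
        cright (ecell (star V) X) \<bullet> rleg (csrc (ecell (star V) X))"
      by (rule mat_total_ext_unit[OF X]) (use X * e' in simp_all)
  qed (use X * in simp_all)
  show "\<lbrakk>Y = X; x \<in> X; f \<in> Ar V; tgt V f = fst (copower V {()})\<rbrakk>
      \<Longrightarrow> cmor (ecell (star V) X) \<bullet> snd (mat_total V (mat_unit V Y)) (x, x) \<bullet> f =
          snd (copower V X) x \<bullet> bang (src V f)"
    using e by simp
qed

text \<open>On the summands at (x, y) and (y, z) the legs to the middle copower are both constant
  with value the injection at \<open>y\<close>; this is what allows \<open>g\<close> and
  \<open>f\<close> to be paired into the pullback. The projections of the pair are then known on
  every summand, which determines the cell.\<close>

lemma mcell_star:
  assumes p: "p \<in> matrices \<kappa> V" and q: "q \<in> matrices \<kappa> V" and qp: "mdom q = mcod p"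
  shows "mcell (star V) q p \<in> Ar (span_sqs V)"
    "\<lbrakk>qp = mat_cmp V q p; a = rleg (star_span V p); b = lleg (star_span V q);
      x \<in> mdom p; y \<in> mcod p; z \<in> mcod q; f \<in> Ar V; g \<in> Ar V; src V f = src V g;
      tgt V f = ment q y z; tgt V g = ment p x y\<rbrakk>
      \<Longrightarrow> pb1 V a b \<bullet> cmor (mcell (star V) q p) \<bullet> snd (mat_total V qp) (x, z)
             \<bullet> snd (mat_sum V q p x z) y \<bullet> tup V f g = snd (mat_total V p) (x, y) \<bullet> g \<and>
        pb2 V a b \<bullet> cmor (mcell (star V) q p) \<bullet> snd (mat_total V qp) (x, z)
             \<bullet> snd (mat_sum V q p x z) y \<bullet> tup V f g = snd (mat_total V q) (y, z) \<bullet> f"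
proof -
  note [simp] = p q qp
  let ?M = "cmor (mcell (star V) q p)"
  let ?l = "rleg (star_span V p)" and ?l' = "lleg (star_span V q)"
  define t where "t = (\<lambda>x z y. pbtup V ?l ?l'
                    (snd (mat_total V p) (x, y) \<bullet> prj2 V (ment q y z) (ment p x y))
                    (snd (mat_total V q) (y, z) \<bullet> prj1 V (ment q y z) (ment p x y)))"
  define k where "k = (\<lambda>x z. cotuple V (mcod p) (mat_sum V q p x z) (pbo V ?l ?l') (t x z))"
  have o: "pbo V ?l ?l' \<in> Ob V"
    by simp
  have t: "t x z y \<in> Ar V" "src V (t x z y) = prd V (ment q y z) (ment p x y)" "tgt V (t x z y) = pbo V ?l ?l'"
      "pb1 V ?l ?l' \<bullet> t x z y = snd (mat_total V p) (x, y) \<bullet> prj2 V (ment q y z) (ment p x y)"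
      "pb2 V ?l ?l' \<bullet> t x z y = snd (mat_total V q) (y, z) \<bullet> prj1 V (ment q y z) (ment p x y)"
    if "x \<in> mdom p" "y \<in> mcod p" "z \<in> mcod q" for x y z
    unfolding t_def using that by simp_all
  have k: "k x z \<in> Ar V" "src V (k x z) = fst (mat_sum V q p x z)" "tgt V (k x z) = pbo V ?l ?l'"
      "\<lbrakk>y \<in> mcod p; h \<in> Ar V; tgt V h = prd V (ment q y z) (ment p x y)\<rbrakk>
        \<Longrightarrow> k x z \<bullet> snd (mat_sum V q p x z) y \<bullet> h = t x z y \<bullet> h"
    if "x \<in> mdom p" "z \<in> mcod q" for x z y h
    unfolding k_def by (rule mat_sum_cotuple; use that t o in simp)+
  have c: "?M = cotuple V (mdom p \<times> mcod q) (mat_total V (mat_cmp V q p)) (pbo V ?l ?l') (\<lambda>(x, z). k x z)"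
    unfolding k_def t_def by (simp add: star_def Let_def)
  have *: "?M \<in> Ar V" "src V ?M = fst (mat_total V (mat_cmp V q p))" "tgt V ?M = pbo V ?l ?l'"
    and M: "\<lbrakk>x \<in> mdom p; z \<in> mcod q; h \<in> Ar V; tgt V h = fst (mat_sum V q p x z)\<rbrakk>
      \<Longrightarrow> ?M \<bullet> snd (mat_total V (mat_cmp V q p)) (x, z) \<bullet> h = k x z \<bullet> h" for x z h
    unfolding c by (rule mat_total_cotuple; use k o in simp; fail | subst mat_total_cotuple(4); use k o in simp)+
  have e: "pb1 V ?l ?l' \<bullet> ?M \<bullet> snd (mat_total V (mat_cmp V q p)) (x, z)
             \<bullet> snd (mat_sum V q p x z) y \<bullet> tup V f g = snd (mat_total V p) (x, y) \<bullet> g"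
      "pb2 V ?l ?l' \<bullet> ?M \<bullet> snd (mat_total V (mat_cmp V q p)) (x, z)
             \<bullet> snd (mat_sum V q p x z) y \<bullet> tup V f g = snd (mat_total V q) (y, z) \<bullet> f"
    if "x \<in> mdom p" "y \<in> mcod p" "z \<in> mcod q" "f \<in> Ar V" "g \<in> Ar V" "src V f = src V g"
      "tgt V f = ment q y z" "tgt V g = ment p x y" for x y z f g
    using that t extend_cmp[OF t(4)[of x y z], of "tup V f g"] extend_cmp[OF t(5)[of x y z], of "tup V f g"]
    by (simp_all add: M k)
  show "mcell (star V) q p \<in> Ar (span_sqs V)"
  proof (rule span_cellI)
    show "lleg (ctgt (mcell (star V) q p)) \<bullet> ?M = cleft (mcell (star V) q p) \<bullet> lleg (csrc (mcell (star V) q p))"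
      by (rule mat_total_ext_cmp[of p q]) (use * e in simp_all)
    show "rleg (ctgt (mcell (star V) q p)) \<bullet> ?M = cright (mcell (star V) q p) \<bullet> rleg (csrc (mcell (star V) q p))"
      by (rule mat_total_ext_cmp[of p q]) (use * e in simp_all)
  qed (use * in simp_all)
  show "\<lbrakk>qp = mat_cmp V q p; a = rleg (star_span V p); b = lleg (star_span V q);
      x \<in> mdom p; y \<in> mcod p; z \<in> mcod q; f \<in> Ar V; g \<in> Ar V; src V f = src V g;
      tgt V f = ment q y z; tgt V g = ment p x y\<rbrakk>
      \<Longrightarrow> pb1 V a b \<bullet> cmor (mcell (star V) q p) \<bullet> snd (mat_total V qp) (x, z)
             \<bullet> snd (mat_sum V q p x z) y \<bullet> tup V f g = snd (mat_total V p) (x, y) \<bullet> g \<and>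
        pb2 V a b \<bullet> cmor (mcell (star V) q p) \<bullet> snd (mat_total V qp) (x, z)
             \<bullet> snd (mat_sum V q p x z) y \<bullet> tup V f g = snd (mat_total V q) (y, z) \<bullet> f"
    using e by simp
qed

declare mcell_star [simp]

section \<open>Functoriality and coherence of the oplax functor\<close>

lemma star_vmap_functor: "cat_functor (Sets \<kappa>) (cat.truncate V) (\<lambda>X. fst (copower V X)) (vmap (star V))"
proof (intro cat_functor.intro cat_functor_axioms.intro Sets_category category_truncate, goal_cases)
  case (2 f a b) then show ?case by (auto simp: in_hom)
next
  case (3 a)
  then have [simp]: "|a| <o \<kappa>" "idt (Sets \<kappa>) a \<in> Ar (Sets \<kappa>)" by simp_all
  show ?case
    unfolding truncate_simps by (rule copower_ext[of a]) simp_all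
next
  case (4 f a b g c)
  then have [simp]: "f \<in> Ar (Sets \<kappa>)" "g \<in> Ar (Sets \<kappa>)" "ssrc g = stgt f" and f: "ssrc f = a"
    by (auto simp: in_hom)
  note Sets_small[OF \<open>f \<in> Ar (Sets \<kappa>)\<close>, simp]
  have [simp]: "g \<cdot>\<^bsub>Sets \<kappa>\<^esub> f \<in> Ar (Sets \<kappa>)" by simp
  show ?case
    unfolding truncate_simps by (rule copower_ext[of "ssrc f"]) simp_all
qed simp_all

lemma star_idt [simp]: "|X :: 'a set| <o \<kappa> \<Longrightarrow> vmap (star V) (idt (Sets \<kappa>) X) = idt V (fst (copower V X))"
  using cat_functor.map_idt[OF star_vmap_functor, of X] by simp

lemma star_cmp [simp]:
  assumes "f \<in> Ar (Sets \<kappa>)" "g \<in> Ar (Sets \<kappa>)" "ssrc g = stgt f"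
  shows "vmap (star V) (g \<cdot>\<^bsub>Sets \<kappa>\<^esub> f) = vmap (star V) g \<bullet> vmap (star V) f"
  using cat_functor.map_cmp[OF star_vmap_functor, of f "ssrc f" "stgt f" g "stgt g"] assms by (simp add: in_hom)

lemma star_cmap_functor: "cat_functor (mat_sqs \<kappa> V) (span_sqs V) (star_span V) (cmap (star V))"
proof (intro cat_functor.intro cat_functor_axioms.intro mat_category span_category, goal_cases)
  case (2 f a b) then show ?case by (auto simp: in_hom)
next
  case (3 a)
  then have [simp]: "a \<in> matrices \<kappa> V" by simp
  show ?case
    by (rule cell_eqI; simp?) (rule mat_total_ext_elt[of a]; simp)
next
  case (4 f a b g c)
  then have [simp]: "f \<in> Ar (mat_sqs \<kappa> V)" "g \<in> Ar (mat_sqs \<kappa> V)" "csrc g = ctgt f"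
    by (auto simp: in_hom)
  show ?case
    by (rule cell_eqI; simp?) (rule mat_total_ext_elt[of "csrc f"]; simp)
qed simp_all

theorem star_oplax: "oplax_functor (Mat \<kappa> V) (Span V) (star V)"
proof (intro oplax_functor.intro double_map.intro oplax_functor_axioms.intro double_map_axioms.intro
    Mat_pseudodouble Span_pseudodouble, unfold Mat_simps Span_simps star_simps(1,2), goal_cases)
  case 1 show ?case by (rule star_vmap_functor)
next
  case 2 show ?case by (rule star_cmap_functor)
next
  case (7 x) then show ?case by (simp add: globular_def in_hom)
next
  case (8 f x y)
  then have [simp]: "f \<in> Ar (Sets \<kappa>)" "x = ssrc f" "y = stgt f" by (auto simp: in_hom)
  note Sets_small[OF \<open>f \<in> Ar (Sets \<kappa>)\<close>, simp]
  show ?case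
    by (rule cell_eqI; simp?) (rule mat_total_ext_unit[of "ssrc f"]; simp)
next
  case (9 r s) then show ?case by (simp add: globular_def in_hom)
next
  case (10 \<phi> r r' \<psi> s s')
  then have c: "\<phi> \<in> Ar (mat_sqs \<kappa> V)" "\<psi> \<in> Ar (mat_sqs \<kappa> V)" "r = csrc \<phi>" "s = csrc \<psi>" "r' = ctgt \<phi>" "s' = ctgt \<psi>"
    "cleft \<psi> = cright \<phi>"
    by (auto simp: in_hom)
  note [simp] = c mat_cell_match[OF c(1,2,7)]
  show ?case
  proof (rule cell_eqI; simp?)
    let ?a = "rleg (star_span V r')" and ?b = "lleg (star_span V s')"
    let ?L = "cmor (cmap (star V) \<psi> \<star>\<^bsub>Span V\<^esub> cmap (star V) \<phi>) \<bullet> cmor (mcell (star V) s r)"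
    let ?R = "cmor (mcell (star V) s' r') \<bullet> cmor (cmap (star V) (\<psi> \<star>\<^bsub>Mat \<kappa> V\<^esub> \<phi>))"
    \<comment> \<open>Arrows from a total object into a pullback are compared by projecting first
      and restricting to summands afterwards.\<close>
    have e: "pb1 V ?a ?b \<bullet> ?L = pb1 V ?a ?b \<bullet> ?R" "pb2 V ?a ?b \<bullet> ?L = pb2 V ?a ?b \<bullet> ?R"
      by (rule mat_total_ext_cmp[of r s]; simp)+
    show "cmor (cmap (star V) \<psi> \<star>\<^bsub>Span V\<^esub> cmap (star V) \<phi>) \<bullet> cmor (mcell (star V) (csrc \<psi>) (csrc \<phi>)) =
        cmor (mcell (star V) (ctgt \<psi>) (ctgt \<phi>)) \<bullet> cmor (cmap (star V) (\<psi> \<star>\<^bsub>Mat \<kappa> V\<^esub> \<phi>))"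
      by (rule pb_ext[of ?a ?b]) (use e in simp_all)
  qed
next
  case (11 r)
  then have [simp]: "r \<in> matrices \<kappa> V" by simp
  show ?case
    by (rule cell_eqI; simp?) (rule mat_total_ext_unit_left[of r "mcod r"]; simp)
next
  case (12 r)
  then have [simp]: "r \<in> matrices \<kappa> V" by simp
  show ?case
    by (rule cell_eqI; simp?) (rule mat_total_ext_unit_right[of r "mdom r"]; simp)
next
  case (13 r s t)
  then have [simp]: "r \<in> matrices \<kappa> V" "s \<in> matrices \<kappa> V" "t \<in> matrices \<kappa> V" "mdom s = mcod r" "mdom t = mcod s"
    by simp_all
  let ?L = "cmor (asc (Span V) (star_span V t) (star_span V s) (star_span V r))
    \<bullet> cmor (mcell (star V) t s \<star>\<^bsub>Span V\<^esub> idt (span_sqs V) (star_span V r)) \<bullet> cmor (mcell (star V) (mat_cmp V t s) r)"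
  let ?R = "cmor (idt (span_sqs V) (star_span V t) \<star>\<^bsub>Span V\<^esub> mcell (star V) s r)
    \<bullet> cmor (mcell (star V) t (mat_cmp V s r)) \<bullet> cmor (cmap (star V) (asc (Mat \<kappa> V) t s r))"
  let ?a = "rleg (star_span V r)" and ?b = "lleg (star_span V s)"
  let ?c = "rleg (span_cmp V (star_span V s) (star_span V r))" and ?d = "lleg (star_span V t)"
  \<comment> \<open>The target is an iterated pullback, so the axiom splits into the components in
    the apices for \<open>r\<close>, \<open>s\<close> and \<open>t\<close>, each tested on
    summands.\<close>
  have 11: "pb1 V ?a ?b \<bullet> pb1 V ?c ?d \<bullet> ?L = pb1 V ?a ?b \<bullet> pb1 V ?c ?d \<bullet> ?R"
    by (rule mat_total_ext_cmp_left[of r s t]; simp)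
  have 21: "pb2 V ?a ?b \<bullet> pb1 V ?c ?d \<bullet> ?L = pb2 V ?a ?b \<bullet> pb1 V ?c ?d \<bullet> ?R"
    by (rule mat_total_ext_cmp_left[of r s t]; simp)
  have 1: "pb1 V ?c ?d \<bullet> ?L = pb1 V ?c ?d \<bullet> ?R"
    \<comment> \<open>The equations are applied in a pass of their own, since full simplification
      would rewrite the terms that they have to match.\<close>
    by (rule pb_ext[of ?a ?b]) (simp_all only: 11 21, simp_all)
  have 2: "pb2 V ?c ?d \<bullet> ?L = pb2 V ?c ?d \<bullet> ?R"
    by (rule mat_total_ext_cmp_left[of r s t]; simp)
  have "?L = ?R"
    by (rule pb_ext[of ?c ?d]) (simp_all only: 1 2, simp_all)
  then show ?case
    by (intro cell_eqI) simp_all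
qed simp_all

end


section \<open>The lax functor\<close>

lemma points_mat_simps [simp]:
  "mdom (points_mat V s) = points V (tgt V (lleg s))" "mcod (points_mat V s) = points V (tgt V (rleg s))"
  "\<lbrakk>v \<in> points V (tgt V (lleg s)); w \<in> points V (tgt V (rleg s))\<rbrakk>
     \<Longrightarrow> ment (points_mat V s) v w = src V (fibre_incl V s v w)"
  by (simp_all add: points_mat_def)

lemma global_points_simps [simp]:
  "omap (global_points V) = points V" "hmap (global_points V) = points_mat V"
  "ssrc (vmap (global_points V) f) = points V (src V f)" "stgt (vmap (global_points V) f) = points V (tgt V f)"
  "v \<in> points V (src V f) \<Longrightarrow> sapp (vmap (global_points V) f) v = f \<cdot>\<^bsub>V\<^esub> v"
  "csrc (cmap (global_points V) \<phi>) = points_mat V (csrc \<phi>)" "ctgt (cmap (global_points V) \<phi>) = points_mat V (ctgt \<phi>)"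
  "cleft (cmap (global_points V) \<phi>) = vmap (global_points V) (cleft \<phi>)"
  "cright (cmap (global_points V) \<phi>) = vmap (global_points V) (cright \<phi>)"
  "csrc (ecell (global_points V) a) = mat_unit V (points V a)"
  "ctgt (ecell (global_points V) a) = points_mat V (span_unit V a)"
  "csrc (mcell (global_points V) t s) = mat_cmp V (points_mat V t) (points_mat V s)"
  "ctgt (mcell (global_points V) t s) = points_mat V (span_cmp V t s)"
  by (simp_all add: global_points_def Let_def)

context distributive_lex
begin

text \<open>The definition of \<open>global_points\<close> does not have \<open>\<kappa>\<close> at
  hand and writes the identity functions out. They are the identities of
  \<open>Sets \<kappa>\<close>, whose data do not involve the bound.\<close>

lemma global_points_comparison [simp]:
  "cleft (ecell (global_points V) a) = idt (Sets \<kappa>) (points V a)"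
  "cright (ecell (global_points V) a) = idt (Sets \<kappa>) (points V a)"
  "cleft (mcell (global_points V) t s) = idt (Sets \<kappa>) (points V (tgt V (lleg s)))"
  "cright (mcell (global_points V) t s) = idt (Sets \<kappa>) (points V (tgt V (rleg t)))"
  by (simp_all add: global_points_def Let_def Sets_def)

text \<open>Local smallness makes the sets of points legitimate 0-cells of
  \<open>Mat \<kappa> V\<close>.\<close>

lemma small_points [simp]: "a \<in> Ob V \<Longrightarrow> |points V a| <o \<kappa>"
  by (simp add: locally_small)

section \<open>Fibres of a span over a pair of points\<close>

context
  fixes s :: "'a span" and v w :: 'a
  assumes s: "s \<in> Ob (span_sqs V)"
    and v: "v \<in> points V (tgt V (lleg s))" and w: "w \<in> points V (tgt V (rleg s))"
begin

text \<open>Arrows to \<open>one V\<close> are unique, so the second projection of the pullback is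
  forced, and the square says precisely that along the inclusion the legs become constant with
  values \<open>v\<close> and \<open>w\<close>.\<close>

lemma fibre_incl:
  shows "fibre_incl V s v w \<in> Ar V" "tgt V (fibre_incl V s v w) = src V (lleg s)"
    "lleg s \<bullet> fibre_incl V s v w = v \<bullet> bang (src V (fibre_incl V s v w))"
    "rleg s \<bullet> fibre_incl V s v w = w \<bullet> bang (src V (fibre_incl V s v w))"
proof -
  note [simp] = s[simplified] v[unfolded in_hom] w[unfolded in_hom]
  let ?f = "tup V (lleg s) (rleg s)" and ?g = "tup V v w"
  let ?J = "pb1 V ?f ?g"
  have J: "?J \<in> Ar V" "tgt V ?J = src V (lleg s)"
    by simp_all
  have "?f \<bullet> ?J = ?g \<bullet> pb2 V ?f ?g"
    by (rule pb_square) simp_all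
  moreover have "pb2 V ?f ?g = bang (src V ?J)"
    using eq_bang[of "pb2 V ?f ?g"] by simp
  ultimately have eq: "tup V (lleg s \<bullet> ?J) (rleg s \<bullet> ?J) = tup V (v \<bullet> bang (src V ?J)) (w \<bullet> bang (src V ?J))"
    using J by (simp del: pb_square)
  have "prj1 V (tgt V (lleg s)) (tgt V (rleg s)) \<bullet> tup V (lleg s \<bullet> ?J) (rleg s \<bullet> ?J) = v \<bullet> bang (src V ?J)"
    "prj2 V (tgt V (lleg s)) (tgt V (rleg s)) \<bullet> tup V (lleg s \<bullet> ?J) (rleg s \<bullet> ?J) = w \<bullet> bang (src V ?J)"
    unfolding eq using J by simp_all
  then have "lleg s \<bullet> ?J = v \<bullet> bang (src V ?J)" "rleg s \<bullet> ?J = w \<bullet> bang (src V ?J)"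
    using J by (simp_all del: tup_cmp)
  with J show "fibre_incl V s v w \<in> Ar V" "tgt V (fibre_incl V s v w) = src V (lleg s)"
    "lleg s \<bullet> fibre_incl V s v w = v \<bullet> bang (src V (fibre_incl V s v w))"
    "rleg s \<bullet> fibre_incl V s v w = w \<bullet> bang (src V (fibre_incl V s v w))"
    by (simp_all add: fibre_incl_def)
qed

text \<open>The inclusion is a monomorphism, because the other projection of the pullback goes to
  the terminal object.\<close>

lemma fibre_ext:
  assumes h: "h \<in> Ar V" "k \<in> Ar V" "src V h = src V k"
    "tgt V h = src V (fibre_incl V s v w)" "tgt V k = src V (fibre_incl V s v w)"
    and eq: "fibre_incl V s v w \<bullet> h = fibre_incl V s v w \<bullet> k"
  shows "h = k"
proof -
  note [simp] = s[simplified] v[unfolded in_hom] w[unfolded in_hom]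
  let ?f = "tup V (lleg s) (rleg s)" and ?g = "tup V v w"
  show ?thesis
  proof (rule pb_ext[of ?f ?g])
    show "pb2 V ?f ?g \<bullet> h = pb2 V ?f ?g \<bullet> k"
      using eq_bang[of "pb2 V ?f ?g \<bullet> h"] eq_bang[of "pb2 V ?f ?g \<bullet> k"] h by (simp add: fibre_incl_def)
  qed (use h eq in \<open>simp_all add: fibre_incl_def\<close>)
qed

lemma fibre_tup:
  assumes m: "m \<in> Ar V" "tgt V m = src V (lleg s)" "lleg s \<bullet> m = v \<bullet> bang (src V m)" "rleg s \<bullet> m = w \<bullet> bang (src V m)"
  shows "fibre_tup V s v w m \<in> Ar V" "src V (fibre_tup V s v w m) = src V m"
    "tgt V (fibre_tup V s v w m) = src V (fibre_incl V s v w)"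
    "fibre_incl V s v w \<bullet> fibre_tup V s v w m = m"
proof -
  note [simp] = s[simplified] v[unfolded in_hom] w[unfolded in_hom]
  show "fibre_tup V s v w m \<in> Ar V" "src V (fibre_tup V s v w m) = src V m"
    "tgt V (fibre_tup V s v w m) = src V (fibre_incl V s v w)"
    "fibre_incl V s v w \<bullet> fibre_tup V s v w m = m"
    unfolding fibre_tup_def fibre_incl_def using m by simp_all
qed

end

lemmas fibre_simps [simp] = fibre_incl fibre_incl(3,4)[THEN extend_cmp]

section \<open>Action and comparison cells of the lax functor\<close>

lemma points_mat_matrix [simp]: "s \<in> Ob (span_sqs V) \<Longrightarrow> points_mat V s \<in> matrices \<kappa> V"
  by (rule matrixI) (simp_all, simp_all add: points_mat_def)

lemma global_points_vmap [simp]: "f \<in> Ar V \<Longrightarrow> vmap (global_points V) f \<in> Ar (Sets \<kappa>)"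
  by (rule SetsI) (simp_all add: in_hom, simp add: global_points_def Let_def)

lemma global_points_vmap_functor: "cat_functor (cat.truncate V) (Sets \<kappa>) (points V) (vmap (global_points V))"
proof (intro cat_functor.intro cat_functor_axioms.intro category_truncate Sets_category, goal_cases)
  case (2 f a b) then show ?case by (simp add: in_hom[of _ "Sets \<kappa>"]) (auto simp: in_hom)
next
  case (3 a) then show ?case by (intro setmap_eqI[of _ \<kappa>]) (simp_all add: in_hom)
next
  case (4 f a b g c) then show ?case by (intro setmap_eqI[of _ \<kappa>]) (auto simp: in_hom)
qed simp_all

lemma global_points_idt [simp]:
  "a \<in> Ob V \<Longrightarrow> vmap (global_points V) (idt V a) = idt (Sets \<kappa>) (points V a)"
  using cat_functor.map_idt[OF global_points_vmap_functor, of a] by simp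

lemma global_points_cmp [simp]:
  "\<lbrakk>f \<in> Ar V; g \<in> Ar V; src V g = tgt V f\<rbrakk> \<Longrightarrow>
    vmap (global_points V) (g \<bullet> f) = vmap (global_points V) g \<cdot>\<^bsub>Sets \<kappa>\<^esub> vmap (global_points V) f"
  using cat_functor.map_cmp[OF global_points_vmap_functor, of f "src V f" "tgt V f" g "tgt V g"]
  by (simp add: in_hom)

lemma cmap_global_points:
  assumes \<phi>: "\<phi> \<in> Ar (span_sqs V)"
  shows "cmap (global_points V) \<phi> \<in> Ar (mat_sqs \<kappa> V)"
    "\<lbrakk>s = csrc \<phi>; s' = ctgt \<phi>; v \<in> points V (tgt V (lleg s)); w \<in> points V (tgt V (rleg s));
      v' = cleft \<phi> \<bullet> v; w' = cright \<phi> \<bullet> w\<rbrakk> \<Longrightarrow>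
      fibre_incl V s' v' w' \<bullet> cmor (cmap (global_points V) \<phi>) v w = cmor \<phi> \<bullet> fibre_incl V s v w"
proof -
  let ?m = "\<lambda>v w. fibre_tup V (ctgt \<phi>) (cleft \<phi> \<bullet> v) (cright \<phi> \<bullet> w) (cmor \<phi> \<bullet> fibre_incl V (csrc \<phi>) v w)"
  have c: "cmor (cmap (global_points V) \<phi>) =
      (\<lambda>v\<in>points V (tgt V (lleg (csrc \<phi>))). \<lambda>w\<in>points V (tgt V (rleg (csrc \<phi>))). ?m v w)"
    by (simp add: global_points_def Let_def)
  have m: "?m v w \<in> Ar V" "src V (?m v w) = src V (fibre_incl V (csrc \<phi>) v w)"
      "tgt V (?m v w) = src V (fibre_incl V (ctgt \<phi>) (cleft \<phi> \<bullet> v) (cright \<phi> \<bullet> w))"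
      "fibre_incl V (ctgt \<phi>) (cleft \<phi> \<bullet> v) (cright \<phi> \<bullet> w) \<bullet> ?m v w = cmor \<phi> \<bullet> fibre_incl V (csrc \<phi>) v w"
    if "v \<in> points V (tgt V (lleg (csrc \<phi>)))" "w \<in> points V (tgt V (rleg (csrc \<phi>)))" for v w
    by (subst fibre_tup; use \<phi> that in \<open>simp add: in_hom\<close>)+
  show "cmap (global_points V) \<phi> \<in> Ar (mat_sqs \<kappa> V)"
    by (rule mat_cellI[OF c]) (use \<phi> m in \<open>simp_all add: in_hom\<close>)
  show "\<lbrakk>s = csrc \<phi>; s' = ctgt \<phi>; v \<in> points V (tgt V (lleg s)); w \<in> points V (tgt V (rleg s));
      v' = cleft \<phi> \<bullet> v; w' = cright \<phi> \<bullet> w\<rbrakk> \<Longrightarrow>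
      fibre_incl V s' v' w' \<bullet> cmor (cmap (global_points V) \<phi>) v w = cmor \<phi> \<bullet> fibre_incl V s v w"
    using m by (simp add: c)
qed

lemmas cmap_global_points_simps [simp] = cmap_global_points cmap_global_points(2)[THEN extend_cmp]

text \<open>Over distinct points the source entry is initial. Over \<open>v\<close> twice, an arrow
  factors through the fibre of the identity span if it is constant at \<open>v\<close>, a condition
  that \<open>v\<close> itself satisfies.\<close>

lemma ecell_global_points:
  assumes a: "a \<in> Ob V"
  shows "ecell (global_points V) a \<in> Ar (mat_sqs \<kappa> V)"
    "\<lbrakk>s = span_unit V a; v \<in> points V a\<rbrakk> \<Longrightarrow>
      fibre_incl V s v v \<bullet> cmor (ecell (global_points V) a) v v \<bullet> pt = v"
proof -
  let ?m = "\<lambda>v w. cotuple V (truth (v = w)) (copower V (truth (v = w)))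
            (src V (fibre_incl V (span_unit V a) v w)) (\<lambda>_. fibre_tup V (span_unit V a) v w v)"
  have c: "cmor (ecell (global_points V) a) = (\<lambda>v\<in>points V a. \<lambda>w\<in>points V a. ?m v w)"
    by (simp add: global_points_def Let_def)
  have t: "fibre_tup V (span_unit V a) v v v \<in> Ar V" "src V (fibre_tup V (span_unit V a) v v v) = one V"
      "tgt V (fibre_tup V (span_unit V a) v v v) = src V (fibre_incl V (span_unit V a) v v)"
      "fibre_incl V (span_unit V a) v v \<bullet> fibre_tup V (span_unit V a) v v v = v"
    if "v \<in> points V a" for v
    by (subst fibre_tup; use a that in \<open>simp add: in_hom\<close>)+
  have o: "src V (fibre_incl V (span_unit V a) v w) \<in> Ob V" if "v \<in> points V a" "w \<in> points V a" for v w
    using a that by simp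
  have m: "?m v w \<in> Ar V" "src V (?m v w) = fst (copower V (truth (v = w)))"
      "tgt V (?m v w) = src V (fibre_incl V (span_unit V a) v w)"
    if "v \<in> points V a" "w \<in> points V a" for v w
    by (rule truth_cotuple; use that t o in simp)+
  show "ecell (global_points V) a \<in> Ar (mat_sqs \<kappa> V)"
    by (rule mat_cellI[OF c]) (use a m in simp_all)
  show "\<lbrakk>s = span_unit V a; v \<in> points V a\<rbrakk> \<Longrightarrow>
      fibre_incl V s v v \<bullet> cmor (ecell (global_points V) a) v v \<bullet> pt = v"
    using t o by (simp add: c)
qed

lemmas ecell_global_points_simps [simp] = ecell_global_points ecell_global_points(2)[THEN extend_cmp_cmp]

text \<open>An element of the fibre of \<open>s\<close> over (v, u) and one of the fibre of
  \<open>t\<close> over (u, w) agree on the middle foot, where both are constant at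
  \<open>u\<close>. So they pair to an element of the pullback, which then lies over (v, w). The
  cell is recorded by what it becomes after the inclusion of the fibre and the projections of the
  pullback.\<close>

lemma mcell_global_points:
  assumes s: "s \<in> Ob (span_sqs V)" and t: "t \<in> Ob (span_sqs V)" and ts: "tgt V (lleg t) = tgt V (rleg s)"
  shows "mcell (global_points V) t s \<in> Ar (mat_sqs \<kappa> V)"
    "\<lbrakk>c = span_cmp V t s; a = rleg s; b = lleg t; s' = points_mat V s; t' = points_mat V t;
      v \<in> points V (tgt V (lleg s)); w \<in> points V (tgt V (rleg t)); u \<in> points V (tgt V (rleg s));
      f \<in> Ar V; g \<in> Ar V; src V f = src V g; tgt V f = src V (fibre_incl V t u w); tgt V g = src V (fibre_incl V s v u)\<rbrakk>
     \<Longrightarrow> pb1 V a b \<bullet> fibre_incl V c v w \<bullet> cmor (mcell (global_points V) t s) v w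
          \<bullet> snd (mat_sum V t' s' v w) u \<bullet> tup V f g = fibre_incl V s v u \<bullet> g \<and>
       pb2 V a b \<bullet> fibre_incl V c v w \<bullet> cmor (mcell (global_points V) t s) v w
          \<bullet> snd (mat_sum V t' s' v w) u \<bullet> tup V f g = fibre_incl V t u w \<bullet> f"
proof -
  note [simp] = s[simplified] t[simplified] ts
  let ?P = "\<lambda>v w u. prd V (src V (fibre_incl V t u w)) (src V (fibre_incl V s v u))"
  let ?p1 = "\<lambda>v w u. prj1 V (src V (fibre_incl V t u w)) (src V (fibre_incl V s v u))"
  let ?p2 = "\<lambda>v w u. prj2 V (src V (fibre_incl V t u w)) (src V (fibre_incl V s v u))"
  define e where "e = (\<lambda>v w u. pbtup V (rleg s) (lleg t) (fibre_incl V s v u \<bullet> ?p2 v w u) (fibre_incl V t u w \<bullet> ?p1 v w u))"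
  define k where "k = (\<lambda>v w u. fibre_tup V (span_cmp V t s) v w (e v w u))"
  let ?m = "\<lambda>v w. cotuple V (points V (tgt V (rleg s))) (mat_sum V (points_mat V t) (points_mat V s) v w)
            (src V (fibre_incl V (span_cmp V t s) v w)) (k v w)"
  have c: "cmor (mcell (global_points V) t s) =
      (\<lambda>v\<in>points V (tgt V (lleg s)). \<lambda>w\<in>points V (tgt V (rleg t)). ?m v w)"
    unfolding k_def e_def by (simp add: global_points_def Let_def)
  have e: "e v w u \<in> Ar V" "src V (e v w u) = ?P v w u" "tgt V (e v w u) = pbo V (rleg s) (lleg t)"
      "pb1 V (rleg s) (lleg t) \<bullet> e v w u = fibre_incl V s v u \<bullet> ?p2 v w u"
      "pb2 V (rleg s) (lleg t) \<bullet> e v w u = fibre_incl V t u w \<bullet> ?p1 v w u"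
    if "v \<in> points V (tgt V (lleg s))" "w \<in> points V (tgt V (rleg t))" "u \<in> points V (tgt V (rleg s))" for v w u
    unfolding e_def using that by (simp_all add: in_hom)
  have k: "k v w u \<in> Ar V" "src V (k v w u) = ?P v w u" "tgt V (k v w u) = src V (fibre_incl V (span_cmp V t s) v w)"
      "fibre_incl V (span_cmp V t s) v w \<bullet> k v w u = e v w u"
    if "v \<in> points V (tgt V (lleg s))" "w \<in> points V (tgt V (rleg t))" "u \<in> points V (tgt V (rleg s))" for v w u
    unfolding k_def by (subst fibre_tup; use e that in \<open>simp add: in_hom\<close>)+
  have o: "src V (fibre_incl V (span_cmp V t s) v w) \<in> Ob V"
    if "v \<in> points V (tgt V (lleg s))" "w \<in> points V (tgt V (rleg t))" for v w
    using that by simp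
  have m: "?m v w \<in> Ar V" "src V (?m v w) = fst (mat_sum V (points_mat V t) (points_mat V s) v w)"
      "tgt V (?m v w) = src V (fibre_incl V (span_cmp V t s) v w)"
      "\<lbrakk>u \<in> points V (tgt V (rleg s)); h \<in> Ar V; tgt V h = ?P v w u\<rbrakk>
         \<Longrightarrow> ?m v w \<bullet> snd (mat_sum V (points_mat V t) (points_mat V s) v w) u \<bullet> h = k v w u \<bullet> h"
    if "v \<in> points V (tgt V (lleg s))" "w \<in> points V (tgt V (rleg t))" for v w u h
    by (rule mat_sum_cotuple; use that k o in simp)+
  show "mcell (global_points V) t s \<in> Ar (mat_sqs \<kappa> V)"
    by (rule mat_cellI[OF c]) (use m in simp_all)
  have J: "fibre_incl V (span_cmp V t s) v w \<bullet> cmor (mcell (global_points V) t s) v w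
          \<bullet> snd (mat_sum V (points_mat V t) (points_mat V s) v w) u \<bullet> tup V f g = e v w u \<bullet> tup V f g"
    if "v \<in> points V (tgt V (lleg s))" "w \<in> points V (tgt V (rleg t))" "u \<in> points V (tgt V (rleg s))"
      "f \<in> Ar V" "g \<in> Ar V" "src V f = src V g" "tgt V f = src V (fibre_incl V t u w)"
      "tgt V g = src V (fibre_incl V s v u)" for v w u f g
  proof -
    have "cmor (mcell (global_points V) t s) v w
          \<bullet> snd (mat_sum V (points_mat V t) (points_mat V s) v w) u \<bullet> tup V f g = k v w u \<bullet> tup V f g"
      using that m(4)[of v w u "tup V f g"] by (simp add: c)
    then show ?thesis
      using extend_cmp[OF k(4), of v w u "tup V f g"] that k by simp
  qed
  show "\<lbrakk>c = span_cmp V t s; a = rleg s; b = lleg t; s' = points_mat V s; t' = points_mat V t;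
      v \<in> points V (tgt V (lleg s)); w \<in> points V (tgt V (rleg t)); u \<in> points V (tgt V (rleg s));
      f \<in> Ar V; g \<in> Ar V; src V f = src V g; tgt V f = src V (fibre_incl V t u w); tgt V g = src V (fibre_incl V s v u)\<rbrakk>
     \<Longrightarrow> pb1 V a b \<bullet> fibre_incl V c v w \<bullet> cmor (mcell (global_points V) t s) v w
          \<bullet> snd (mat_sum V t' s' v w) u \<bullet> tup V f g = fibre_incl V s v u \<bullet> g \<and>
       pb2 V a b \<bullet> fibre_incl V c v w \<bullet> cmor (mcell (global_points V) t s) v w
          \<bullet> snd (mat_sum V t' s' v w) u \<bullet> tup V f g = fibre_incl V t u w \<bullet> f" for a b c s' t' v w u f g
    using extend_cmp[OF e(4), of v w u "tup V f g"] extend_cmp[OF e(5), of v w u "tup V f g"] e(1-3)[of v w u]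
    by (simp add: J)
qed

declare mcell_global_points [simp]

section \<open>Functoriality and coherence of the lax functor\<close>

lemma global_points_cmap_functor:
  "cat_functor (span_sqs V) (mat_sqs \<kappa> V) (points_mat V) (cmap (global_points V))"
proof (intro cat_functor.intro cat_functor_axioms.intro mat_category span_category, goal_cases)
  case (2 f a b) then show ?case by (auto simp: in_hom)
next
  case (3 a)
  then have [simp]: "lleg a \<in> Ar V" "rleg a \<in> Ar V" "src V (rleg a) = src V (lleg a)" by simp_all
  show ?case
  proof (rule mat_cell_eqI; simp?)
    fix v w assume [simp]: "v \<in> points V (tgt V (lleg a))" "w \<in> points V (tgt V (rleg a))"
    \<comment> \<open>Rules about fibres ask for membership in \<open>points\<close>, rules about
      arrows for source and target; both forms are made available.\<close>
    note [simp] = \<open>v \<in> _\<close>[unfolded in_hom] \<open>w \<in> _\<close>[unfolded in_hom]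
    show "cmor (cmap (global_points V) (idt (span_sqs V) a)) v w = idt V (src V (fibre_incl V a v w))"
      by (rule fibre_ext[of a v w]) simp_all
  qed
next
  case (4 f a b g c)
  then have [simp]: "f \<in> Ar (span_sqs V)" "g \<in> Ar (span_sqs V)" "csrc g = ctgt f"
    by (auto simp: in_hom)
  show ?case
  proof (rule mat_cell_eqI; simp?)
    fix v w assume [simp]: "v \<in> points V (tgt V (lleg (csrc f)))" "w \<in> points V (tgt V (rleg (csrc f)))"
    note [simp] = \<open>v \<in> _\<close>[unfolded in_hom] \<open>w \<in> _\<close>[unfolded in_hom]
    show "cmor (cmap (global_points V) (g \<cdot>\<^bsub>span_sqs V\<^esub> f)) v w =
        cmor (cmap (global_points V) g) (cleft f \<bullet> v) (cright f \<bullet> w) \<bullet> cmor (cmap (global_points V) f) v w"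
      by (rule fibre_ext[of "ctgt g" "cleft g \<bullet> cleft f \<bullet> v" "cright g \<bullet> cright f \<bullet> w"]) (simp_all add: in_hom)
  qed
qed simp_all

theorem global_points_lax: "lax_functor (Span V) (Mat \<kappa> V) (global_points V)"
proof (intro lax_functor.intro double_map.intro lax_functor_axioms.intro double_map_axioms.intro
    Mat_pseudodouble Span_pseudodouble, unfold Mat_simps Span_simps global_points_simps(1,2), goal_cases)
  case 1 show ?case by (rule global_points_vmap_functor)
next
  case 2 show ?case by (rule global_points_cmap_functor)
next
  case (7 x) then show ?case by (simp add: globular_def in_hom)
next
  case (8 f x y)
  then have [simp]: "f \<in> Ar V" "x = src V f" "y = tgt V f" by (auto simp: in_hom)
  show ?case
  proof (rule mat_cell_eqI; simp?)
    fix v w assume [simp]: "v \<in> points V (src V f)" "w \<in> points V (src V f)"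
    note [simp] = \<open>v \<in> _\<close>[unfolded in_hom] \<open>w \<in> _\<close>[unfolded in_hom]
    show "cmor (cmap (global_points V) (cunit (Span V) f)) v w \<bullet> cmor (ecell (global_points V) (src V f)) v w =
        cmor (ecell (global_points V) (tgt V f)) (f \<bullet> v) (f \<bullet> w) \<bullet> cmor (cunit (Mat \<kappa> V) (vmap (global_points V) f)) v w"
    proof (rule unit_ext[of _ _ "v = w"])
      assume "v = w"
      show "(cmor (cmap (global_points V) (cunit (Span V) f)) v w \<bullet> cmor (ecell (global_points V) (src V f)) v w) \<bullet> pt =
          (cmor (ecell (global_points V) (tgt V f)) (f \<bullet> v) (f \<bullet> w)
            \<bullet> cmor (cunit (Mat \<kappa> V) (vmap (global_points V) f)) v w) \<bullet> pt"
        unfolding \<open>v = w\<close>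
        by (rule fibre_ext[of "span_unit V (tgt V f)" "f \<bullet> w" "f \<bullet> w"]) (simp_all add: in_hom)
    qed (simp_all add: in_hom)
  qed
next
  case (9 r s) then show ?case by (simp add: globular_def in_hom)
next
  case (10 \<phi> r r' \<psi> s s')
  then have c: "\<phi> \<in> Ar (span_sqs V)" "\<psi> \<in> Ar (span_sqs V)" "r = csrc \<phi>" "s = csrc \<psi>" "r' = ctgt \<phi>" "s' = ctgt \<psi>"
    "cleft \<psi> = cright \<phi>"
    by (auto simp: in_hom)
  note [simp] = c span_cell_match[OF c(1,2,7)]
  show ?case
  proof (rule mat_cell_eqI; simp?)
    fix v w assume [simp]: "v \<in> points V (tgt V (lleg (csrc \<phi>)))" "w \<in> points V (tgt V (rleg (csrc \<psi>)))"
    note [simp] = \<open>v \<in> _\<close>[unfolded in_hom] \<open>w \<in> _\<close>[unfolded in_hom]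
    let ?L = "cmor (cmap (global_points V) (\<psi> \<star>\<^bsub>Span V\<^esub> \<phi>)) v w \<bullet> cmor (mcell (global_points V) (csrc \<psi>) (csrc \<phi>)) v w"
    let ?R = "cmor (mcell (global_points V) (ctgt \<psi>) (ctgt \<phi>)) (cleft \<phi> \<bullet> v) (cright \<psi> \<bullet> w)
      \<bullet> cmor (cmap (global_points V) \<psi> \<star>\<^bsub>Mat \<kappa> V\<^esub> cmap (global_points V) \<phi>) v w"
    let ?a = "rleg (ctgt \<phi>)" and ?b = "lleg (ctgt \<psi>)"
    let ?J = "fibre_incl V (span_cmp V (ctgt \<psi>) (ctgt \<phi>)) (cleft \<phi> \<bullet> v) (cright \<psi> \<bullet> w)"
    \<comment> \<open>An arrow from a sum into a fibre of a composite span is tested in three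
      stages: after the inclusion of the fibre, after the projections of the pullback, and on
      summands.\<close>
    have 1: "pb1 V ?a ?b \<bullet> ?J \<bullet> ?L = pb1 V ?a ?b \<bullet> ?J \<bullet> ?R"
      by (rule mat_sum_ext[of "points_mat V (csrc \<phi>)" "points_mat V (csrc \<psi>)" v w]) (simp_all add: in_hom)
    have 2: "pb2 V ?a ?b \<bullet> ?J \<bullet> ?L = pb2 V ?a ?b \<bullet> ?J \<bullet> ?R"
      by (rule mat_sum_ext[of "points_mat V (csrc \<phi>)" "points_mat V (csrc \<psi>)" v w]) (simp_all add: in_hom)
    have J: "?J \<bullet> ?L = ?J \<bullet> ?R"
      by (rule pb_ext[of ?a ?b]) (simp_all only: 1 2, simp_all add: in_hom)
    show "?L = ?R"
      by (rule fibre_ext[of "span_cmp V (ctgt \<psi>) (ctgt \<phi>)" "cleft \<phi> \<bullet> v" "cright \<psi> \<bullet> w"])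
        (simp_all only: J, simp_all add: in_hom)
  qed
next
  case (11 r)
  then have [simp]: "lleg r \<in> Ar V" "rleg r \<in> Ar V" "src V (rleg r) = src V (lleg r)" by simp_all
  show ?case
  proof (rule mat_cell_eqI; simp?)
    fix v w assume [simp]: "v \<in> points V (tgt V (lleg r))" "w \<in> points V (tgt V (rleg r))"
    note [simp] = \<open>v \<in> _\<close>[unfolded in_hom] \<open>w \<in> _\<close>[unfolded in_hom]
    let ?u = "span_unit V (tgt V (rleg r))"
    let ?L = "cmor (cmap (global_points V) (lun (Span V) r)) v w \<bullet> cmor (mcell (global_points V) ?u r) v w
      \<bullet> cmor (ecell (global_points V) (tgt V (rleg r)) \<star>\<^bsub>Mat \<kappa> V\<^esub> idt (mat_sqs \<kappa> V) (points_mat V r)) v w"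
    let ?R = "cmor (lun (Mat \<kappa> V) (points_mat V r)) v w"
    \<comment> \<open>The target is a fibre of \<open>r\<close> itself, so the inclusion suffices;
      the source is a composite with a unit, so only its diagonal summand counts.\<close>
    have J: "fibre_incl V r v w \<bullet> ?L = fibre_incl V r v w \<bullet> ?R"
      by (rule unit_sum_ext_left[of "points_mat V r" v w "points V (tgt V (rleg r))"]) (simp_all add: in_hom)
    show "?L = ?R"
      by (rule fibre_ext[of r v w]) (simp_all only: J, simp_all add: in_hom)
  qed
next
  case (12 r)
  then have [simp]: "lleg r \<in> Ar V" "rleg r \<in> Ar V" "src V (rleg r) = src V (lleg r)" by simp_all
  show ?case
  proof (rule mat_cell_eqI; simp?)
    fix v w assume [simp]: "v \<in> points V (tgt V (lleg r))" "w \<in> points V (tgt V (rleg r))"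
    note [simp] = \<open>v \<in> _\<close>[unfolded in_hom] \<open>w \<in> _\<close>[unfolded in_hom]
    let ?u = "span_unit V (tgt V (lleg r))"
    let ?L = "cmor (cmap (global_points V) (run (Span V) r)) v w \<bullet> cmor (mcell (global_points V) r ?u) v w
      \<bullet> cmor (idt (mat_sqs \<kappa> V) (points_mat V r) \<star>\<^bsub>Mat \<kappa> V\<^esub> ecell (global_points V) (tgt V (lleg r))) v w"
    let ?R = "cmor (run (Mat \<kappa> V) (points_mat V r)) v w"
    have J: "fibre_incl V r v w \<bullet> ?L = fibre_incl V r v w \<bullet> ?R"
      by (rule unit_sum_ext_right[of "points_mat V r" v w "points V (tgt V (lleg r))"]) (simp_all add: in_hom)
    show "?L = ?R"
      by (rule fibre_ext[of r v w]) (simp_all only: J, simp_all add: in_hom)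
  qed
next
  case (13 r s t)
  then have [simp]: "lleg r \<in> Ar V" "rleg r \<in> Ar V" "src V (rleg r) = src V (lleg r)"
    "lleg s \<in> Ar V" "rleg s \<in> Ar V" "src V (rleg s) = src V (lleg s)" "tgt V (lleg s) = tgt V (rleg r)"
    "lleg t \<in> Ar V" "rleg t \<in> Ar V" "src V (rleg t) = src V (lleg t)" "tgt V (lleg t) = tgt V (rleg s)"
    by simp_all
  show ?case
  proof (rule mat_cell_eqI; simp?)
    fix v w assume [simp]: "v \<in> points V (tgt V (lleg r))" "w \<in> points V (tgt V (rleg t))"
    note [simp] = \<open>v \<in> _\<close>[unfolded in_hom] \<open>w \<in> _\<close>[unfolded in_hom]
    let ?r = "points_mat V r" and ?s = "points_mat V s" and ?t = "points_mat V t"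
    let ?L = "cmor (cmap (global_points V) (asc (Span V) t s r)) v w
      \<bullet> cmor (mcell (global_points V) (span_cmp V t s) r) v w
      \<bullet> cmor (mcell (global_points V) t s \<star>\<^bsub>Mat \<kappa> V\<^esub> idt (mat_sqs \<kappa> V) ?r) v w"
    let ?R = "cmor (mcell (global_points V) t (span_cmp V s r)) v w
      \<bullet> cmor (idt (mat_sqs \<kappa> V) ?t \<star>\<^bsub>Mat \<kappa> V\<^esub> mcell (global_points V) s r) v w
      \<bullet> cmor (asc (Mat \<kappa> V) ?t ?s ?r) v w"
    let ?a = "rleg r" and ?b = "lleg s" and ?c = "rleg (span_cmp V s r)" and ?d = "lleg t"
    let ?J = "fibre_incl V (span_cmp V t (span_cmp V s r)) v w"
    have 11: "pb1 V ?a ?b \<bullet> pb1 V ?c ?d \<bullet> ?J \<bullet> ?L = pb1 V ?a ?b \<bullet> pb1 V ?c ?d \<bullet> ?J \<bullet> ?R"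
      by (rule mat_sum_ext_left[of ?r ?s ?t v w]) (simp_all add: in_hom)
    have 21: "pb2 V ?a ?b \<bullet> pb1 V ?c ?d \<bullet> ?J \<bullet> ?L = pb2 V ?a ?b \<bullet> pb1 V ?c ?d \<bullet> ?J \<bullet> ?R"
      by (rule mat_sum_ext_left[of ?r ?s ?t v w]) (simp_all add: in_hom)
    have 1: "pb1 V ?c ?d \<bullet> ?J \<bullet> ?L = pb1 V ?c ?d \<bullet> ?J \<bullet> ?R"
      by (rule pb_ext[of ?a ?b]) (simp_all only: 11 21, simp_all add: in_hom)
    have 2: "pb2 V ?c ?d \<bullet> ?J \<bullet> ?L = pb2 V ?c ?d \<bullet> ?J \<bullet> ?R"
      by (rule mat_sum_ext_left[of ?r ?s ?t v w]) (simp_all add: in_hom)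
    have J: "?J \<bullet> ?L = ?J \<bullet> ?R"
      by (rule pb_ext[of ?c ?d]) (simp_all only: 1 2, simp_all add: in_hom)
    show "?L = ?R"
      by (rule fibre_ext[of "span_cmp V t (span_cmp V s r)" v w]) (simp_all only: J, simp_all add: in_hom)
  qed
qed simp_all

end


section \<open>The conjunction\<close>

context pseudodouble_category
begin

lemma lun_hom: "r \<in> Ob (sqs D) \<Longrightarrow> lun D r \<in> hom (sqs D) (hunit D (hcod D r) \<odot>\<^bsub>D\<^esub> r) r"
  and run_hom: "r \<in> Ob (sqs D) \<Longrightarrow> run D r \<in> hom (sqs D) (r \<odot>\<^bsub>D\<^esub> hunit D (hdom D r)) r"
  using lun_iso run_iso by (simp_all add: globular_def)

lemma asc_hom: "\<lbrakk>r \<in> Ob (sqs D); s \<in> Ob (sqs D); t \<in> Ob (sqs D); hdom D s = hcod D r; hdom D t = hcod D s\<rbrakk>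
  \<Longrightarrow> asc D t s r \<in> hom (sqs D) ((t \<odot>\<^bsub>D\<^esub> s) \<odot>\<^bsub>D\<^esub> r) (t \<odot>\<^bsub>D\<^esub> (s \<odot>\<^bsub>D\<^esub> r))"
  using asc_iso by (simp add: globular_def)

lemma identity_simps:
  "omap (identity_psfun D) = (\<lambda>x. x)" "vmap (identity_psfun D) = (\<lambda>f. f)" "hmap (identity_psfun D) = (\<lambda>r. r)"
  "cmap (identity_psfun D) = (\<lambda>\<phi>. \<phi>)" "ecell (identity_psfun D) x = idt (sqs D) (hunit D x)"
  "mcell (identity_psfun D) s r = idt (sqs D) (s \<odot>\<^bsub>D\<^esub> r)"
  by (simp_all add: identity_psfun_def)

lemma identity_double_map: "double_map D D (identity_psfun D)"
  by (intro double_map.intro double_map_axioms.intro cat_functor.intro cat_functor_axioms.intro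
      pseudodouble_category_axioms vert.category_axioms sqs.category_axioms)
    (simp_all add: identity_simps)

lemma identity_comparison:
  "x \<in> Ob (vert D) \<Longrightarrow> globular D (hunit D x) (hunit D x) (idt (sqs D) (hunit D x))"
  "f \<in> hom (vert D) x y \<Longrightarrow> cunit D f \<cdot>\<^bsub>sqs D\<^esub> idt (sqs D) (hunit D x) = idt (sqs D) (hunit D y) \<cdot>\<^bsub>sqs D\<^esub> cunit D f"
  "\<lbrakk>r \<in> Ob (sqs D); s \<in> Ob (sqs D); hdom D s = hcod D r\<rbrakk>
    \<Longrightarrow> globular D (s \<odot>\<^bsub>D\<^esub> r) (s \<odot>\<^bsub>D\<^esub> r) (idt (sqs D) (s \<odot>\<^bsub>D\<^esub> r))"
  "\<lbrakk>\<phi> \<in> hom (sqs D) r r'; \<psi> \<in> hom (sqs D) s s'; cdom D \<psi> = ccod D \<phi>\<rbrakk>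
    \<Longrightarrow> (\<psi> \<star>\<^bsub>D\<^esub> \<phi>) \<cdot>\<^bsub>sqs D\<^esub> idt (sqs D) (s \<odot>\<^bsub>D\<^esub> r) = idt (sqs D) (s' \<odot>\<^bsub>D\<^esub> r') \<cdot>\<^bsub>sqs D\<^esub> (\<psi> \<star>\<^bsub>D\<^esub> \<phi>)"
  using unit.map_Ob[of x] dom.map_idt[of "hunit D x"] cod.map_idt[of "hunit D x"] unit.map_hom[of f x y]
    hcmp_Ob[of r s] dom.map_idt[of "s \<odot>\<^bsub>D\<^esub> r"] cod.map_idt[of "s \<odot>\<^bsub>D\<^esub> r"] ccmp_hom[of \<phi> r r' \<psi> s s']
  by (simp_all add: globular_def in_hom)

lemma ccmp_idt_hom: "\<lbrakk>r \<in> Ob (sqs D); s \<in> Ob (sqs D); hdom D s = hcod D r\<rbrakk>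
  \<Longrightarrow> idt (sqs D) (s \<odot>\<^bsub>D\<^esub> r) \<in> hom (sqs D) (s \<odot>\<^bsub>D\<^esub> r) (s \<odot>\<^bsub>D\<^esub> r)"
  using hcmp_Ob[of r s] by (simp add: in_hom)

lemmas identity_coherence = lun_hom run_hom asc_hom ccmp_idt ccmp_idt_hom hcmp_Ob hdom_hunit hcod_hunit
  cod.map_Ob dom.map_Ob unit.map_Ob

text \<open>The boundaries of the unit and the counit contain identities in both roles, horizontally
  as lax and vertically as oplax functors.\<close>

lemma identity_lax: "lax_functor D D (identity_psfun D)"
  by (intro lax_functor.intro lax_functor_axioms.intro identity_double_map, unfold identity_simps)
    (simp_all add: identity_comparison identity_coherence[unfolded in_hom])

lemma identity_oplax: "oplax_functor D D (identity_psfun D)"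
  by (intro oplax_functor.intro oplax_functor_axioms.intro identity_double_map, unfold identity_simps)
    (simp_all add: identity_comparison identity_coherence[unfolded in_hom])

end

section \<open>Unit and counit of the conjunction\<close>

definition eta0 :: "('o, 'a) cart_cat \<Rightarrow> 'a set \<Rightarrow> 'a setmap" where
  "eta0 V X = \<lparr>ssrc = X, stgt = points V (fst (copower V X)), sapp = \<lambda>x\<in>X. snd (copower V X) x\<rparr>"

text \<open>The legs of \<open>star_span V p\<close> are constant on the summand at (x, y), so its
  injection factors through the fibre over the injections at \<open>x\<close> and \<open>y\<close>.
  The entry is this factorisation.\<close>

definition eta1 :: "('o, 'a) cart_cat \<Rightarrow> ('a, 'o) matrix \<Rightarrow> (('a, 'o) matrix, 'a setmap, 'a \<Rightarrow> 'a \<Rightarrow> 'a) cell" where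
  "eta1 V p = \<lparr>csrc = p, ctgt = points_mat V (star_span V p), cleft = eta0 V (mdom p), cright = eta0 V (mcod p),
     cmor = \<lambda>x\<in>mdom p. \<lambda>y\<in>mcod p. fibre_tup V (star_span V p) (snd (copower V (mdom p)) x) (snd (copower V (mcod p)) y)
       (snd (mat_total V p) (x, y))\<rparr>"

definition eps0 :: "('o, 'a) cart_cat \<Rightarrow> 'o \<Rightarrow> 'a" where
  "eps0 V a = cotuple V (points V a) (copower V (points V a)) a (\<lambda>v. v)"

definition eps1 :: "('o, 'a) cart_cat \<Rightarrow> 'a span \<Rightarrow> ('a span, 'a, 'a) cell" where
  "eps1 V s = \<lparr>csrc = star_span V (points_mat V s), ctgt = s, cleft = eps0 V (tgt V (lleg s)),
     cright = eps0 V (tgt V (rleg s)),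
     cmor = cotuple V (points V (tgt V (lleg s)) \<times> points V (tgt V (rleg s))) (mat_total V (points_mat V s))
       (src V (lleg s)) (\<lambda>(v, w). fibre_incl V s v w)\<rparr>"

lemma eta_simps [simp]:
  "ssrc (eta0 V X) = X" "stgt (eta0 V X) = points V (fst (copower V X))"
  "x \<in> X \<Longrightarrow> sapp (eta0 V X) x = snd (copower V X) x"
  "csrc (eta1 V p) = p" "ctgt (eta1 V p) = points_mat V (star_span V p)"
  "cleft (eta1 V p) = eta0 V (mdom p)" "cright (eta1 V p) = eta0 V (mcod p)"
  by (simp_all add: eta0_def eta1_def)

lemma eps_simps [simp]:
  "csrc (eps1 V s) = star_span V (points_mat V s)" "ctgt (eps1 V s) = s"
  "cleft (eps1 V s) = eps0 V (tgt V (lleg s))" "cright (eps1 V s) = eps0 V (tgt V (rleg s))"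
  by (simp_all add: eps1_def)

context distributive_lex
begin

lemma copower_point [simp]: "\<lbrakk>|X :: 'a set| <o \<kappa>; x \<in> X\<rbrakk> \<Longrightarrow> snd (copower V X) x \<in> points V (fst (copower V X))"
  by (simp add: in_hom)

lemma eta0_arrow [simp]: "|X| <o \<kappa> \<Longrightarrow> eta0 V X \<in> Ar (Sets \<kappa>)"
  by (rule SetsI) (simp_all, simp add: eta0_def)

lemma eta1_cell:
  assumes p: "p \<in> matrices \<kappa> V"
  shows "eta1 V p \<in> Ar (mat_sqs \<kappa> V)"
    "\<lbrakk>s = star_span V p; x \<in> mdom p; y \<in> mcod p; v = snd (copower V (mdom p)) x; w = snd (copower V (mcod p)) y\<rbrakk> \<Longrightarrow>
      fibre_incl V s v w \<bullet> cmor (eta1 V p) x y = snd (mat_total V p) (x, y)"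
proof -
  let ?m = "\<lambda>x y. fibre_tup V (star_span V p) (snd (copower V (mdom p)) x) (snd (copower V (mcod p)) y)
       (snd (mat_total V p) (x, y))"
  have c: "cmor (eta1 V p) = (\<lambda>x\<in>mdom p. \<lambda>y\<in>mcod p. ?m x y)"
    by (simp add: eta1_def)
  have m: "?m x y \<in> Ar V" "src V (?m x y) = ment p x y"
      "tgt V (?m x y) = src V (fibre_incl V (star_span V p) (snd (copower V (mdom p)) x) (snd (copower V (mcod p)) y))"
      "fibre_incl V (star_span V p) (snd (copower V (mdom p)) x) (snd (copower V (mcod p)) y) \<bullet> ?m x y =
        snd (mat_total V p) (x, y)"
    if "x \<in> mdom p" "y \<in> mcod p" for x y
    \<comment> \<open>The rules for the legs carry a tail; the identity of the entry as tail gives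
      their values on the injection itself.\<close>
    using star_span_simps(7,8)[OF p that, of "idt V (ment p x y)"] p that
    by (subst fibre_tup; simp)+
  show "eta1 V p \<in> Ar (mat_sqs \<kappa> V)"
    by (rule mat_cellI[OF c]) (use p m in simp_all)
  show "\<lbrakk>s = star_span V p; x \<in> mdom p; y \<in> mcod p; v = snd (copower V (mdom p)) x; w = snd (copower V (mcod p)) y\<rbrakk> \<Longrightarrow>
      fibre_incl V s v w \<bullet> cmor (eta1 V p) x y = snd (mat_total V p) (x, y)"
    using m by (simp add: c)
qed

lemmas eta1_simps [simp] = eta1_cell eta1_cell(2)[THEN extend_cmp]

text \<open>A point of \<open>a\<close> is itself an arrow from \<open>one V\<close>, so the points
  form a cocone on the copies of \<open>one V\<close> that they index.\<close>

lemma eps0_arrow [simp]: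
  assumes "a \<in> Ob V"
  shows "eps0 V a \<in> Ar V" "src V (eps0 V a) = fst (copower V (points V a))" "tgt V (eps0 V a) = a"
    "\<lbrakk>X = points V a; v \<in> points V a\<rbrakk> \<Longrightarrow> eps0 V a \<bullet> snd (copower V X) v = v"
proof -
  have "v \<in> Ar V \<and> src V v = one V \<and> tgt V v = a" if "v \<in> points V a" for v
    using that by (simp add: in_hom)
  note * = coprod_cotuple[OF copower_coproduct assms, where k = "\<lambda>v. v", OF small_points[OF assms] this]
  show "eps0 V a \<in> Ar V" "src V (eps0 V a) = fst (copower V (points V a))" "tgt V (eps0 V a) = a"
    "\<lbrakk>X = points V a; v \<in> points V a\<rbrakk> \<Longrightarrow> eps0 V a \<bullet> snd (copower V X) v = v"
    using * by (simp_all add: eps0_def)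
qed

lemmas eps0_arrow' [simp] = eps0_arrow(4)[THEN extend_cmp]

text \<open>On the summand at (v, w) both ways around the left leg are constant at \<open>v\<close>,
  once by the nature of the fibre and once by the value of \<open>eps0\<close> on an injection;
  similarly \<open>w\<close> on the right.\<close>

lemma eps1_cell:
  assumes s: "s \<in> Ob (span_sqs V)"
  shows "eps1 V s \<in> Ar (span_sqs V)"
    "\<lbrakk>p = points_mat V s; v \<in> points V (tgt V (lleg s)); w \<in> points V (tgt V (rleg s)); f \<in> Ar V;
      tgt V f = src V (fibre_incl V s v w)\<rbrakk> \<Longrightarrow>
      cmor (eps1 V s) \<bullet> snd (mat_total V p) (v, w) \<bullet> f = fibre_incl V s v w \<bullet> f"
proof -
  note [simp] = s[simplified]
  let ?p = "points_mat V s"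
  have c: "cmor (eps1 V s) = cotuple V (mdom ?p \<times> mcod ?p) (mat_total V ?p) (src V (lleg s)) (\<lambda>(v, w). fibre_incl V s v w)"
    by (simp add: eps1_def)
  have *: "cmor (eps1 V s) \<in> Ar V" "src V (cmor (eps1 V s)) = fst (mat_total V ?p)"
      "tgt V (cmor (eps1 V s)) = src V (lleg s)"
    unfolding c by (rule mat_total_cotuple; simp)+
  have e: "cmor (eps1 V s) \<bullet> snd (mat_total V ?p) (v, w) \<bullet> f = fibre_incl V s v w \<bullet> f"
    if "v \<in> points V (tgt V (lleg s))" "w \<in> points V (tgt V (rleg s))" "f \<in> Ar V"
      "tgt V f = src V (fibre_incl V s v w)" for v w f
    unfolding c by (subst mat_total_cotuple(4); use that in simp)
  show "eps1 V s \<in> Ar (span_sqs V)"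
  proof (rule span_cellI)
    show "lleg (ctgt (eps1 V s)) \<bullet> cmor (eps1 V s) = cleft (eps1 V s) \<bullet> lleg (csrc (eps1 V s))"
      by (rule mat_total_ext_elt[of ?p]) (use * e in \<open>simp_all add: in_hom\<close>)
    show "rleg (ctgt (eps1 V s)) \<bullet> cmor (eps1 V s) = cright (eps1 V s) \<bullet> rleg (csrc (eps1 V s))"
      by (rule mat_total_ext_elt[of ?p]) (use * e in \<open>simp_all add: in_hom\<close>)
  qed (use * in simp_all)
  show "\<lbrakk>p = points_mat V s; v \<in> points V (tgt V (lleg s)); w \<in> points V (tgt V (rleg s)); f \<in> Ar V;
      tgt V f = src V (fibre_incl V s v w)\<rbrakk> \<Longrightarrow>
      cmor (eps1 V s) \<bullet> snd (mat_total V p) (v, w) \<bullet> f = fibre_incl V s v w \<bullet> f"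
    using e by simp
qed

declare eps1_cell [simp]

lemmas identity_Mat_simps [simp] = pseudodouble_category.identity_simps[OF Mat_pseudodouble]
lemmas identity_Span_simps [simp] = pseudodouble_category.identity_simps[OF Span_pseudodouble]

text \<open>As \<open>H\<close> and \<open>G\<close> are identities, compatibility compares the lax
  cells of \<open>global_points V\<close>, preceded by the unit, with the images under
  \<open>global_points V\<close> of the oplax cells of \<open>star V\<close>, again preceded by the
  unit.\<close>

lemma eta_psdb_cell:
  "psdb_cell (Mat \<kappa> V) (Mat \<kappa> V) (Span V) (Mat \<kappa> V) (identity_psfun (Mat \<kappa> V)) (global_points V) (star V)
     (identity_psfun (Mat \<kappa> V)) \<lparr>tr0 = eta0 V, tr1 = eta1 V\<rparr>"
proof (intro psdb_cell.intro psdb_cell_axioms.intro global_points_lax star_oplax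
    pseudodouble_category.identity_lax pseudodouble_category.identity_oplax Mat_pseudodouble, goal_cases)
  case (1 x) then show ?case by (simp add: in_hom[of _ "Sets \<kappa>"])
next
  case (2 f x y)
  then have [simp]: "f \<in> Ar (Sets \<kappa>)" "x = ssrc f" "y = stgt f" by (auto simp: in_hom)
  note Sets_small[OF \<open>f \<in> Ar (Sets \<kappa>)\<close>, simp]
  show ?case by (rule setmap_eqI[of _ \<kappa>]) simp_all
next
  case (3 r) then show ?case by (simp add: in_hom[of _ "mat_sqs \<kappa> V"])
next
  case (4 \<theta> r s)
  then have [simp]: "\<theta> \<in> Ar (mat_sqs \<kappa> V)" "r = csrc \<theta>" "s = ctgt \<theta>" by (auto simp: in_hom)
  show ?case
  proof (rule mat_cell_eqI; simp?)
    show "eta0 V (mdom (ctgt \<theta>)) \<cdot>\<^bsub>Sets \<kappa>\<^esub> cleft \<theta> = vmap (global_points V) (vmap (star V) (cleft \<theta>)) \<cdot>\<^bsub>Sets \<kappa>\<^esub> eta0 V (mdom (csrc \<theta>))"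
      "eta0 V (mcod (ctgt \<theta>)) \<cdot>\<^bsub>Sets \<kappa>\<^esub> cright \<theta> = vmap (global_points V) (vmap (star V) (cright \<theta>)) \<cdot>\<^bsub>Sets \<kappa>\<^esub> eta0 V (mcod (csrc \<theta>))"
      by (rule setmap_eqI[of _ \<kappa>]; simp)+
    fix x y assume [simp]: "x \<in> mdom (csrc \<theta>)" "y \<in> mcod (csrc \<theta>)"
    show "cmor (eta1 V (ctgt \<theta>)) (sapp (cleft \<theta>) x) (sapp (cright \<theta>) y) \<bullet> cmor \<theta> x y =
        cmor (cmap (global_points V) (cmap (star V) \<theta>)) (snd (copower V (mdom (csrc \<theta>))) x) (snd (copower V (mcod (csrc \<theta>))) y)
          \<bullet> cmor (eta1 V (csrc \<theta>)) x y"
      by (rule fibre_ext[of "star_span V (ctgt \<theta>)" "snd (copower V (mdom (ctgt \<theta>))) (sapp (cleft \<theta>) x)"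
            "snd (copower V (mcod (ctgt \<theta>))) (sapp (cright \<theta>) y)"])
        (use cmap_star(2)[of \<theta> "csrc \<theta>" x y "idt V (ment (csrc \<theta>) x y)"] in simp_all)
  qed
next
  case (7 X)
  then have [simp]: "|X| <o \<kappa>" by simp
  show ?case
  proof (rule mat_cell_eqI; simp?)
    fix x y assume [simp]: "x \<in> X" "y \<in> X"
    let ?F = "fst (copower V X)"
    let ?L = "cmor (ecell (global_points V) ?F) (snd (copower V X) x) (snd (copower V X) y)
      \<bullet> cmor (cunit (Mat \<kappa> V) (eta0 V X)) x y"
    let ?R = "cmor (cmap (global_points V) (ecell (star V) X)) (snd (copower V X) x) (snd (copower V X) y)
      \<bullet> cmor (eta1 V (mat_unit V X)) x y"
    show "?L = ?R"
    proof (rule unit_ext[of _ _ "x = y"])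
      assume "x = y"
      show "?L \<bullet> pt = ?R \<bullet> pt"
        unfolding \<open>x = y\<close>
        by (rule fibre_ext[of "span_unit V ?F" "snd (copower V X) y" "snd (copower V X) y"]) simp_all
    qed simp_all
  qed
next
  case (8 r s)
  then have [simp]: "r \<in> matrices \<kappa> V" "s \<in> matrices \<kappa> V" "mdom s = mcod r"
    by simp_all
  show ?case
  proof (rule mat_cell_eqI; simp?)
    fix x z assume [simp]: "x \<in> mdom r" "z \<in> mcod s"
    let ?a = "rleg (star_span V r)" and ?b = "lleg (star_span V s)"
    let ?v = "snd (copower V (mdom r)) x" and ?w = "snd (copower V (mcod s)) z"
    let ?J = "fibre_incl V (span_cmp V (star_span V s) (star_span V r)) ?v ?w"
    let ?L = "cmor (mcell (global_points V) (star_span V s) (star_span V r)) ?v ?w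
      \<bullet> cmor (eta1 V s \<star>\<^bsub>Mat \<kappa> V\<^esub> eta1 V r) x z"
    let ?R = "cmor (cmap (global_points V) (mcell (star V) s r)) ?v ?w \<bullet> cmor (eta1 V (mat_cmp V s r)) x z"
    have 1: "pb1 V ?a ?b \<bullet> ?J \<bullet> ?L = pb1 V ?a ?b \<bullet> ?J \<bullet> ?R"
      by (rule mat_sum_ext[of r s x z]) simp_all
    have 2: "pb2 V ?a ?b \<bullet> ?J \<bullet> ?L = pb2 V ?a ?b \<bullet> ?J \<bullet> ?R"
      by (rule mat_sum_ext[of r s x z]) simp_all
    have J: "?J \<bullet> ?L = ?J \<bullet> ?R"
      by (rule pb_ext[of ?a ?b]) (simp_all only: 1 2, simp_all)
    show "?L = ?R"
      by (rule fibre_ext[of "span_cmp V (star_span V s) (star_span V r)" ?v ?w]) (simp_all only: J, simp_all)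
  qed
qed simp_all

text \<open>Dually, \<open>K\<close> and \<open>F\<close> are identities, and the oplax cells of
  \<open>star V\<close> are compared with the images under \<open>star V\<close> of the lax cells,
  both followed by the counit. The targets are apices of spans rather than fibres, so testing on
  summands and on projections of pullbacks suffices.\<close>

lemma eps_psdb_cell:
  "psdb_cell (Span V) (Mat \<kappa> V) (Span V) (Span V) (global_points V) (identity_psfun (Span V))
     (identity_psfun (Span V)) (star V) \<lparr>tr0 = eps0 V, tr1 = eps1 V\<rparr>"
proof (intro psdb_cell.intro psdb_cell_axioms.intro global_points_lax star_oplax
    pseudodouble_category.identity_lax pseudodouble_category.identity_oplax Span_pseudodouble, goal_cases)
  case (1 x) then show ?case by (simp add: in_hom[of "eps0 V x"])
next
  case (2 f x y)
  then have [simp]: "f \<in> Ar V" "x = src V f" "y = tgt V f" by (auto simp: in_hom)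
  have "eps0 V (tgt V f) \<bullet> vmap (star V) (vmap (global_points V) f) = f \<bullet> eps0 V (src V f)"
    by (rule copower_ext[of "points V (src V f)"]) (simp_all add: in_hom)
  then show ?case by simp
next
  case (3 r) then show ?case by (simp add: in_hom[of "eps1 V r"])
next
  case (4 \<theta> r s)
  then have [simp]: "\<theta> \<in> Ar (span_sqs V)" "r = csrc \<theta>" "s = ctgt \<theta>" by (auto simp: in_hom)
  show ?case
  proof (rule cell_eqI; simp?)
    show "eps0 V (tgt V (lleg (ctgt \<theta>))) \<bullet> vmap (star V) (vmap (global_points V) (cleft \<theta>)) = cleft \<theta> \<bullet> eps0 V (tgt V (lleg (csrc \<theta>)))"
      by (rule copower_ext[of "points V (tgt V (lleg (csrc \<theta>)))"]) (simp_all add: in_hom)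
    show "eps0 V (tgt V (rleg (ctgt \<theta>))) \<bullet> vmap (star V) (vmap (global_points V) (cright \<theta>)) = cright \<theta> \<bullet> eps0 V (tgt V (rleg (csrc \<theta>)))"
      by (rule copower_ext[of "points V (tgt V (rleg (csrc \<theta>)))"]) (simp_all add: in_hom)
    show "cmor (eps1 V (ctgt \<theta>)) \<bullet> cmor (cmap (star V) (cmap (global_points V) \<theta>)) = cmor \<theta> \<bullet> cmor (eps1 V (csrc \<theta>))"
      by (rule mat_total_ext_elt[of "points_mat V (csrc \<theta>)"]) (simp_all add: in_hom)
  qed
next
  case (7 a)
  then have [simp]: "a \<in> Ob V" by simp
  show ?case
  proof (rule cell_eqI; simp?)
    show "eps0 V a \<bullet> cmor (ecell (star V) (points V a)) =
        cmor (eps1 V (span_unit V a)) \<bullet> cmor (cmap (star V) (ecell (global_points V) a))"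
      by (rule mat_total_ext_unit[of "points V a"]) (simp_all add: in_hom)
  qed
next
  case (8 r s)
  then have [simp]: "lleg r \<in> Ar V" "rleg r \<in> Ar V" "src V (rleg r) = src V (lleg r)"
    "lleg s \<in> Ar V" "rleg s \<in> Ar V" "src V (rleg s) = src V (lleg s)" "tgt V (lleg s) = tgt V (rleg r)"
    by simp_all
  show ?case
  proof (rule cell_eqI; simp?)
    let ?a = "rleg r" and ?b = "lleg s"
    let ?L = "cmor (eps1 V s \<star>\<^bsub>Span V\<^esub> eps1 V r) \<bullet> cmor (mcell (star V) (points_mat V s) (points_mat V r))"
    let ?R = "cmor (eps1 V (span_cmp V s r)) \<bullet> cmor (cmap (star V) (mcell (global_points V) s r))"
    have 1: "pb1 V ?a ?b \<bullet> ?L = pb1 V ?a ?b \<bullet> ?R"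
      by (rule mat_total_ext_cmp[of "points_mat V r" "points_mat V s"]) (simp_all add: in_hom)
    have 2: "pb2 V ?a ?b \<bullet> ?L = pb2 V ?a ?b \<bullet> ?R"
      by (rule mat_total_ext_cmp[of "points_mat V r" "points_mat V s"]) (simp_all add: in_hom)
    show "?L = ?R"
      by (rule pb_ext[of ?a ?b]) (simp_all only: 1 2, simp_all)
  qed
qed simp_all

text \<open>The components of the pastings are ordinary composites, so the two equations are the
  triangle identities of an adjunction on 0-cells and of one on horizontal 1-cells.\<close>

theorem star_global_points_conjoint: "is_conjoint (Mat \<kappa> V) (Span V) (star V) (global_points V)"
  unfolding is_conjoint_def
proof (intro conjI exI star_oplax global_points_lax)
  show "psdb_cell (Mat \<kappa> V) (Mat \<kappa> V) (Span V) (Mat \<kappa> V) (identity_psfun (Mat \<kappa> V)) (global_points V) (star V)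
     (identity_psfun (Mat \<kappa> V)) \<lparr>tr0 = eta0 V, tr1 = eta1 V\<rparr>"
    by (rule eta_psdb_cell)
  show "psdb_cell (Span V) (Mat \<kappa> V) (Span V) (Span V) (global_points V) (identity_psfun (Span V))
     (identity_psfun (Span V)) (star V) \<lparr>tr0 = eps0 V, tr1 = eps1 V\<rparr>"
    by (rule eps_psdb_cell)
  \<comment> \<open>The triangle identities on 0-cells; they occur again as the vertical boundaries
    in the equations between 2-cells.\<close>
  have l: "eps0 V (fst (copower V X)) \<bullet> vmap (star V) (eta0 V X) = idt V (fst (copower V X))"
    if "|X :: 'a set| <o \<kappa>" for X
    by (rule copower_ext[of X]) (use that in simp_all)
  have r: "vmap (global_points V) (eps0 V a) \<cdot>\<^bsub>Sets \<kappa>\<^esub> eta0 V (points V a) = idt (Sets \<kappa>) (points V a)"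
    if "a \<in> Ob V" for a
    by (rule setmap_eqI[of _ \<kappa>]) (use that in \<open>simp_all add: in_hom[of _ V]\<close>)
  show "transf_eq (Mat \<kappa> V) (psdb_vcmp (Span V) (star V) (star V) \<lparr>tr0 = eps0 V, tr1 = eps1 V\<rparr> \<lparr>tr0 = eta0 V, tr1 = eta1 V\<rparr>)
      (psdb_identity (Span V) (star V))"
    unfolding transf_eq_def psdb_vcmp_def psdb_identity_def
  proof (intro conjI ballI, goal_cases)
    case (1 X) then show ?case by (simp add: l)
  next
    case (2 p)
    then have [simp]: "p \<in> matrices \<kappa> V" by simp
    show ?case
    proof (rule cell_eqI; simp add: l)
      show "cmor (eps1 V (star_span V p)) \<bullet> cmor (cmap (star V) (eta1 V p)) = idt V (fst (mat_total V p))"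
        by (rule mat_total_ext_elt[of p]) simp_all
    qed
  qed
  show "transf_eq (Span V) (psdb_hcmp (Mat \<kappa> V) (global_points V) (global_points V)
        \<lparr>tr0 = eta0 V, tr1 = eta1 V\<rparr> \<lparr>tr0 = eps0 V, tr1 = eps1 V\<rparr>)
      (psdb_identity (Mat \<kappa> V) (global_points V))"
    unfolding transf_eq_def psdb_hcmp_def psdb_identity_def
  proof (intro conjI ballI, goal_cases)
    case (1 a) then show ?case by (simp add: r)
  next
    case (2 s)
    then have [simp]: "lleg s \<in> Ar V" "rleg s \<in> Ar V" "src V (rleg s) = src V (lleg s)" by simp_all
    show ?case
    proof (rule mat_cell_eqI; simp add: r)
      fix v w assume [simp]: "v \<in> points V (tgt V (lleg s))" "w \<in> points V (tgt V (rleg s))"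
      note [simp] = \<open>v \<in> _\<close>[unfolded in_hom] \<open>w \<in> _\<close>[unfolded in_hom]
      let ?p = "points_mat V s"
      show "cmor (cmap (global_points V) (eps1 V s)) (snd (copower V (points V (tgt V (lleg s)))) v)
          (snd (copower V (points V (tgt V (rleg s)))) w) \<bullet> cmor (eta1 V ?p) v w = idt V (src V (fibre_incl V s v w))"
        \<comment> \<open>Followed by the inclusion, the left side becomes the counit on the summand
          at (v, w), that is, the inclusion itself.\<close>
        by (rule fibre_ext[of s v w])
          (use eps1_cell(2)[of s ?p v w "idt V (src V (fibre_incl V s v w))"] in simp_all)
    qed
  qed
qed

end

theorem proposition4p4:
  fixes V :: "('o, 'a) cart_cat" and \<kappa> :: "'k rel"
  assumes "Cinfinite \<kappa>" and "regularCard \<kappa>"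
    and "distributive_category \<kappa> V"
    and "has_finite_limits V"
  shows "lax_functor (Span V) (Mat \<kappa> V) (global_points V) \<and>
    is_conjoint (Mat \<kappa> V) (Span V) (star V) (global_points V)"
proof -
  interpret distributive_lex \<kappa> V
    using assms by (simp add: distributive_lex_def distributive_lex_axioms_def)
  show ?thesis
    using global_points_lax star_global_points_conjoint by blast
qed

end
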